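(* Let $u\in H^1(\Omega)$ be an arbitrary solution of $\Delta u+k^2u=F_{\rho,D}$ in $\Omega$. Let $\omega\in S^2$ be regular with respect to $D$. Assume that $D$ has a circular cone singularity at $p(\omega)$ and that the source $F_{\rho,D}$ is active at $p(\omega)$. Choose two linearly independent vectors $\vartheta_1,\vartheta_2\in S(\omega)$. Then the point $p(\omega)$, and thus $h_D(\omega)=p(\omega)\cdot\omega$, can be extracted from the Cauchy data of $u$ on $\partial\Omega$ by the formula $$p(\omega)\cdot\omega+i\,p(\omega)\cdot\vartheta_j=\lim_{\tau\to\infty}\frac{I'_{\omega,\vartheta_j}(\tau)}{I_{\omega,\vartheta_j}(\tau)},\qquad j=1,2.$$
   Context: Setting. $\Omega\subset\mathbb R^3$ is a bounded domain with $C^2$ boundary and outward unit normal $\nu$; $k\ge 0$. $D$ is a nonempty open set with $\overline D\subset\Omega$, $\rho\in L^2(D)$ is complex-valued, and $F=F_{\rho,D}$ equals $\rho$ on $D$ and $0$ on $\Omega\setminus D$. Solutions $u\in H^1(\Omega)$ (complex-valued) of $\Delta u+k^2u=F$ are in the weak sense, with no boundary condition prescribed. The normal derivative $\partial u/\partial\nu\in H^{-1/2}(\partial\Omega)$ is defined weakly by $\langle \partial u/\partial\nu,g|_{\partial\Omega}\rangle=\int_\Omega(\nabla u\cdot\nabla g-k^2ug+Fg)\,dx$ for $g\in H^1(\Omega)$, and boundary integrals containing it are understood as this pairing. The Cauchy data are $(u|_{\partial\Omega},\partial u/\partial\nu)$. For $\omega\in S^2$, $S(\omega)=\{\vartheta\in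 S^2:\omega\cdot\vartheta=0\}$. For $\vartheta\in S(\omega)$, $\tau>0$, put $v=e^{x\cdot(\tau\omega+i\sqrt{\tau^2+k^2}\,\vartheta)}$ (bilinear dot product), $v_\tau=\partial_\tau v=\{x\cdot(\omega+i\frac{\tau}{\sqrt{\tau^2+k^2}}\vartheta)\}v$, and $$I_{\omega,\vartheta}(\tau)=\int_{\partial\Omega}\Bigl(\frac{\partial u}{\partial\nu}v-\frac{\partial v}{\partial\nu}u\Bigr)dS,\qquad I'_{\omega,\vartheta}(\tau)=\int_{\partial\Omega}\Bigl(\frac{\partial u}{\partial\nu}v_\tau-\frac{\partial v_\tau}{\partial\nu}u\Bigr)dS.$$ $h_D(\omega)=\sup_{x\in D}x\cdot\omega$. $\omega$ is regular with respect to $D$ if $\{x\in\overline D: x\cdot\omega=h_D(\omega)\}$ is a single point, denoted $p(\omega)$. For $p\in\mathbb R^3$, $\mathbf n\in S^2$, $\theta\in\,]0,\frac\pi2[$: $V_p(-\mathbf n,\theta)=\{x\in\mathbb R^3:(x-p)\cdot(-\mathbf n)>|x-p|\cos\theta\}$. $D$ has a circular cone singularity at $p\in\partial D$ if there exist $\epsilon>0$, $\mathbf n\in S^2$ and $\theta\in\,]0,\frac\pi2[$ such that $D\cap B_\epsilon(p)=V_p(-\mathbf n,\theta)\cap B_\epsilon(p)$, where $B_\epsilon(p)$ is the open ball of radius $\epsilon$ centered at $p$. $F_{\rho,D}$ is active at $p\in\partial D$ if there exist $\eta>0$, $0<\alpha\le1$ and a (complex-valued) $\tilde\rho\in C^{0,\alpha}(\overline{B_\eta(p)})$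 such that $\rho=\tilde\rho$ almost everywhere on $B_\eta(p)\cap D$ and $\tilde\rho(p)\ne0$. *)

theory Defs
  imports "HOL-Analysis.Analysis"
begin

section \<open>Differentiability classes and vector calculus\<close>

text \<open>Functions on the whole space that are continuously differentiable up to order n:
  all partial derivatives with respect to the standard basis exist to that order and are
  continuous.\<close>

primrec Ck :: "nat \<Rightarrow> ('a::euclidean_space \<Rightarrow> 'b::real_normed_vector) \<Rightarrow> bool" where
  "Ck 0 f \<longleftrightarrow> continuous_on UNIV f"
| "Ck (Suc n) f \<longleftrightarrow> (\<forall>x. f differentiable (at x)) \<and>
     (\<forall>b\<in>Basis. Ck n (\<lambda>x. frechet_derivative f (at x) b))"

definition smooth :: "('a::euclidean_space \<Rightarrow> 'b::real_normed_vector) \<Rightarrow> bool" where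
  "smooth f \<longleftrightarrow> (\<forall>n. Ck n f)"

definition grad :: "(real^3 \<Rightarrow> complex) \<Rightarrow> real^3 \<Rightarrow> complex^3" where
  "grad f x = (\<chi> i. frechet_derivative f (at x) (axis i 1))"

text \<open>The dot product on complex vectors is bilinear, without conjugation.\<close>

definition cdot :: "complex^3 \<Rightarrow> complex^3 \<Rightarrow> complex" where
  "cdot a b = (\<Sum>i\<in>UNIV. a $ i * b $ i)"

definition cvec :: "real^3 \<Rightarrow> complex^3" where
  "cvec x = (\<chi> i. of_real (x $ i))"

section \<open>Domains with twice continuously differentiable boundary\<close>

text \<open>Inside the ball, the open set is the part strictly below the graph of a C2 function
  over the plane spanned by a and b, in the orthonormal frame a, b, e.\<close>

definition boundary_chart ::
  "(real^3) set \<Rightarrow> real^3 \<Rightarrow> real \<Rightarrow> real^3 \<Rightarrow> real^3 \<Rightarrow> real^3 \<Rightarrow> (real \<times> real \<Rightarrow> real) \<Rightarrow> bool" where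
  "boundary_chart \<Omega> p r a b e \<phi> \<longleftrightarrow>
     r > 0 \<and> norm a = 1 \<and> norm b = 1 \<and> norm e = 1 \<and> a \<bullet> b = 0 \<and> a \<bullet> e = 0 \<and> b \<bullet> e = 0 \<and>
     Ck 2 \<phi> \<and> \<Omega> \<inter> ball p r = {x \<in> ball p r. x \<bullet> e < \<phi> (x \<bullet> a, x \<bullet> b)}"

definition C2_boundary :: "(real^3) set \<Rightarrow> bool" where
  "C2_boundary \<Omega> \<longleftrightarrow> (\<forall>p\<in>frontier \<Omega>. \<exists>r a b e \<phi>. boundary_chart \<Omega> p r a b e \<phi>)"

definition graph_point ::
  "real^3 \<Rightarrow> real^3 \<Rightarrow> real^3 \<Rightarrow> (real \<times> real \<Rightarrow> real) \<Rightarrow> real \<times> real \<Rightarrow> real^3" where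
  "graph_point a b e \<phi> y = fst y *\<^sub>R a + snd y *\<^sub>R b + \<phi> y *\<^sub>R e"

definition area_element :: "(real \<times> real \<Rightarrow> real) \<Rightarrow> real \<times> real \<Rightarrow> real" where
  "area_element \<phi> y = sqrt (1 + (frechet_derivative \<phi> (at y) (1, 0))\<^sup>2
                              + (frechet_derivative \<phi> (at y) (0, 1))\<^sup>2)"

text \<open>The measure dS on the boundary, determined by the usual area formula for graphs.
  For a bounded open set with C2 boundary there is exactly one such measure.\<close>

definition surface_measure :: "(real^3) set \<Rightarrow> (real^3) measure \<Rightarrow> bool" where
  "surface_measure \<Omega> \<sigma> \<longleftrightarrow>
     sets \<sigma> = sets (restrict_space borel (frontier \<Omega>)) \<and>
     (\<forall>p r a b e \<phi>. boundary_chart \<Omega> p r a b e \<phi> \<longrightarrow>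
        (\<forall>A\<in>sets borel. A \<subseteq> frontier \<Omega> \<inter> ball p r \<longrightarrow>
           emeasure \<sigma> A =
             (\<integral>\<^sup>+ y. indicator A (graph_point a b e \<phi> y) * ennreal (area_element \<phi> y) \<partial>lborel)))"

text \<open>The outward unit normal field. Since the set lies below the graph, it points upwards
  in every chart.\<close>

definition outward_unit_normal :: "(real^3) set \<Rightarrow> (real^3 \<Rightarrow> real^3) \<Rightarrow> bool" where
  "outward_unit_normal \<Omega> \<nu> \<longleftrightarrow>
     (\<forall>p r a b e \<phi> y. boundary_chart \<Omega> p r a b e \<phi> \<and> graph_point a b e \<phi> y \<in> ball p r \<longrightarrow>
        \<nu> (graph_point a b e \<phi> y) =
          (1 / area_element \<phi> y) *\<^sub>R
            (e - frechet_derivative \<phi> (at y) (1, 0) *\<^sub>R a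
               - frechet_derivative \<phi> (at y) (0, 1) *\<^sub>R b))"

section \<open>Sobolev functions, traces and weak solutions\<close>

definition L2 :: "'a measure \<Rightarrow> ('a \<Rightarrow> 'b::euclidean_space) \<Rightarrow> bool" where
  "L2 M f \<longleftrightarrow> f \<in> borel_measurable M \<and> integrable M (\<lambda>x. (norm (f x))\<^sup>2)"

definition test_function :: "(real^3) set \<Rightarrow> (real^3 \<Rightarrow> complex) \<Rightarrow> bool" where
  "test_function \<Omega> \<phi> \<longleftrightarrow>
     smooth \<phi> \<and> (\<exists>K. compact K \<and> K \<subseteq> \<Omega> \<and> (\<forall>x. x \<notin> K \<longrightarrow> \<phi> x = 0))"

text \<open>u is an element of the Sobolev space of order one and Du is (a representative of) its
  weak gradient, which is unique up to null sets.\<close>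

definition H1 :: "(real^3) set \<Rightarrow> (real^3 \<Rightarrow> complex) \<Rightarrow> (real^3 \<Rightarrow> complex^3) \<Rightarrow> bool" where
  "H1 \<Omega> u Du \<longleftrightarrow> L2 (lebesgue_on \<Omega>) u \<and> L2 (lebesgue_on \<Omega>) Du \<and>
     (\<forall>\<phi>. test_function \<Omega> \<phi> \<longrightarrow>
        (\<forall>i. (LINT x|lebesgue_on \<Omega>. u x * grad \<phi> x $ i) =
             - (LINT x|lebesgue_on \<Omega>. Du x $ i * \<phi> x)))"

text \<open>f is the trace of u on the boundary: the limit in L2 of the boundary values of smooth
  functions approximating u in H1. It exists and is unique up to null sets for every u
  in H1 of a bounded domain with C2 boundary.\<close>

definition trace_of ::
  "(real^3) set \<Rightarrow> (real^3) measure \<Rightarrow> (real^3 \<Rightarrow> complex) \<Rightarrow> (real^3 \<Rightarrow> complex^3) \<Rightarrow>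
   (real^3 \<Rightarrow> complex) \<Rightarrow> bool" where
  "trace_of \<Omega> \<sigma> u Du f \<longleftrightarrow> L2 \<sigma> f \<and>
     (\<exists>w::nat \<Rightarrow> real^3 \<Rightarrow> complex. (\<forall>n. smooth (w n)) \<and>
        (\<lambda>n. LINT x|lebesgue_on \<Omega>. (norm (w n x - u x))\<^sup>2) \<longlonglongrightarrow> 0 \<and>
        (\<lambda>n. LINT x|lebesgue_on \<Omega>. (norm (grad (w n) x - Du x))\<^sup>2) \<longlonglongrightarrow> 0 \<and>
        (\<lambda>n. LINT x|\<sigma>. (norm (w n x - f x))\<^sup>2) \<longlonglongrightarrow> 0)"

definition weak_solution ::
  "(real^3) set \<Rightarrow> real \<Rightarrow> (real^3 \<Rightarrow> complex) \<Rightarrow> (real^3 \<Rightarrow> complex) \<Rightarrow> (real^3 \<Rightarrow> complex^3) \<Rightarrow> bool" where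
  "weak_solution \<Omega> k F u Du \<longleftrightarrow> H1 \<Omega> u Du \<and>
     (\<forall>\<phi>. test_function \<Omega> \<phi> \<longrightarrow>
        (LINT x|lebesgue_on \<Omega>. - cdot (Du x) (grad \<phi> x) + of_real (k\<^sup>2) * u x * \<phi> x) =
        (LINT x|lebesgue_on \<Omega>. F x * \<phi> x))"

text \<open>The normal derivative of a weak solution u as a functional on boundary traces h of H1
  functions g. The right-hand side depends on g only through h, because u is a weak
  solution.\<close>

definition weak_normal_derivative ::
  "(real^3) set \<Rightarrow> (real^3) measure \<Rightarrow> real \<Rightarrow> (real^3 \<Rightarrow> complex) \<Rightarrow>
   (real^3 \<Rightarrow> complex) \<Rightarrow> (real^3 \<Rightarrow> complex^3) \<Rightarrow> ((real^3 \<Rightarrow> complex) \<Rightarrow> complex) \<Rightarrow> bool" where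
  "weak_normal_derivative \<Omega> \<sigma> k F u Du \<Lambda> \<longleftrightarrow>
     (\<forall>g Dg h. H1 \<Omega> g Dg \<and> trace_of \<Omega> \<sigma> g Dg h \<longrightarrow>
        \<Lambda> h = (LINT x|lebesgue_on \<Omega>.
                 cdot (Du x) (Dg x) - of_real (k\<^sup>2) * u x * g x + F x * g x))"

definition cauchy_data ::
  "(real^3) set \<Rightarrow> (real^3) measure \<Rightarrow> real \<Rightarrow> (real^3 \<Rightarrow> complex) \<Rightarrow>
   (real^3 \<Rightarrow> complex) \<Rightarrow> (real^3 \<Rightarrow> complex^3) \<Rightarrow>
   (real^3 \<Rightarrow> complex) \<Rightarrow> ((real^3 \<Rightarrow> complex) \<Rightarrow> complex) \<Rightarrow> bool" where
  "cauchy_data \<Omega> \<sigma> k F u Du f \<Lambda> \<longleftrightarrow>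
     trace_of \<Omega> \<sigma> u Du f \<and> weak_normal_derivative \<Omega> \<sigma> k F u Du \<Lambda>"

section \<open>Indicator functions\<close>

definition S_perp :: "real^3 \<Rightarrow> (real^3) set" where
  "S_perp \<omega> = {\<theta> \<in> sphere 0 1. \<omega> \<bullet> \<theta> = 0}"

definition complex_direction :: "real \<Rightarrow> real \<Rightarrow> real^3 \<Rightarrow> real^3 \<Rightarrow> complex^3" where
  "complex_direction s t \<omega> \<theta> = (\<chi> i. of_real (s * \<omega> $ i) + \<i> * of_real (t * \<theta> $ i))"

definition v_sol :: "real \<Rightarrow> real^3 \<Rightarrow> real^3 \<Rightarrow> real \<Rightarrow> real^3 \<Rightarrow> complex" where
  "v_sol k \<omega> \<theta> \<tau> x = exp (cdot (cvec x) (complex_direction \<tau> (sqrt (\<tau>\<^sup>2 + k\<^sup>2)) \<omega> \<theta>))"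

definition v_sol_tau :: "real \<Rightarrow> real^3 \<Rightarrow> real^3 \<Rightarrow> real \<Rightarrow> real^3 \<Rightarrow> complex" where
  "v_sol_tau k \<omega> \<theta> \<tau> x =
     cdot (cvec x) (complex_direction 1 (\<tau> / sqrt (\<tau>\<^sup>2 + k\<^sup>2)) \<omega> \<theta>) * v_sol k \<omega> \<theta> \<tau> x"

lemma cdot_complex_direction:
  "cdot (cvec x) (complex_direction s t \<omega> \<theta>) = of_real (s * (x \<bullet> \<omega>)) + \<i> * of_real (t * (x \<bullet> \<theta>))"
  by (simp add: cdot_def cvec_def complex_direction_def inner_vec_def sum_distrib_left
      algebra_simps sum.distrib)

lemma v_sol_has_vector_derivative:
  assumes "\<tau> > 0"
  shows "((\<lambda>t. v_sol k \<omega> \<theta> t x) has_vector_derivative v_sol_tau k \<omega> \<theta> \<tau> x) (at \<tau>)"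
proof -
  have pos: "\<tau>\<^sup>2 + k\<^sup>2 > 0"
    using assms by (simp add: add_pos_nonneg)
  have a: "((\<lambda>t. t * (x \<bullet> \<omega>)) has_real_derivative (x \<bullet> \<omega>)) (at \<tau>)"
    by (auto intro!: derivative_eq_intros)
  have b: "((\<lambda>t. sqrt (t\<^sup>2 + k\<^sup>2) * (x \<bullet> \<theta>)) has_real_derivative
             (\<tau> / sqrt (\<tau>\<^sup>2 + k\<^sup>2) * (x \<bullet> \<theta>))) (at \<tau>)"
    using pos by (auto intro!: derivative_eq_intros simp: field_simps)
  have "((\<lambda>t. cdot (cvec x) (complex_direction t (sqrt (t\<^sup>2 + k\<^sup>2)) \<omega> \<theta>)) has_vector_derivative
           cdot (cvec x) (complex_direction 1 (\<tau> / sqrt (\<tau>\<^sup>2 + k\<^sup>2)) \<omega> \<theta>)) (at \<tau>)"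
    unfolding cdot_complex_direction mult_1
    by (intro has_vector_derivative_add has_vector_derivative_mult_right
        has_vector_derivative_of_real a b)
  from field_vector_diff_chain_at[OF this DERIV_exp]
  show ?thesis
    by (simp add: v_sol_def v_sol_tau_def o_def)
qed

text \<open>The boundary integral of (normal derivative of u) times w minus (normal derivative of
  w) times u, for smooth w, in terms of the Cauchy data f, L of u: the first part is the
  duality pairing, the second one an ordinary surface integral.\<close>

definition boundary_bracket ::
  "(real^3) measure \<Rightarrow> (real^3 \<Rightarrow> real^3) \<Rightarrow> (real^3 \<Rightarrow> complex) \<Rightarrow>
   ((real^3 \<Rightarrow> complex) \<Rightarrow> complex) \<Rightarrow> (real^3 \<Rightarrow> complex) \<Rightarrow> complex" where
  "boundary_bracket \<sigma> \<nu> f \<Lambda> w =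
     \<Lambda> w - (LINT x|\<sigma>. frechet_derivative w (at x) (\<nu> x) * f x)"

definition I_fun ::
  "(real^3) measure \<Rightarrow> (real^3 \<Rightarrow> real^3) \<Rightarrow> (real^3 \<Rightarrow> complex) \<Rightarrow>
   ((real^3 \<Rightarrow> complex) \<Rightarrow> complex) \<Rightarrow> real \<Rightarrow> real^3 \<Rightarrow> real^3 \<Rightarrow> real \<Rightarrow> complex" where
  "I_fun \<sigma> \<nu> f \<Lambda> k \<omega> \<theta> \<tau> = boundary_bracket \<sigma> \<nu> f \<Lambda> (v_sol k \<omega> \<theta> \<tau>)"

definition I_fun' ::
  "(real^3) measure \<Rightarrow> (real^3 \<Rightarrow> real^3) \<Rightarrow> (real^3 \<Rightarrow> complex) \<Rightarrow>
   ((real^3 \<Rightarrow> complex) \<Rightarrow> complex) \<Rightarrow> real \<Rightarrow> real^3 \<Rightarrow> real^3 \<Rightarrow> real \<Rightarrow> complex" where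
  "I_fun' \<sigma> \<nu> f \<Lambda> k \<omega> \<theta> \<tau> = boundary_bracket \<sigma> \<nu> f \<Lambda> (v_sol_tau k \<omega> \<theta> \<tau>)"

section \<open>Source domains\<close>

definition source :: "(real^3 \<Rightarrow> complex) \<Rightarrow> (real^3) set \<Rightarrow> real^3 \<Rightarrow> complex" where
  "source \<rho> D x = (if x \<in> D then \<rho> x else 0)"

definition support_fun :: "(real^3) set \<Rightarrow> real^3 \<Rightarrow> real" where
  "support_fun D \<omega> = (SUP x\<in>D. x \<bullet> \<omega>)"

definition regular_direction :: "(real^3) set \<Rightarrow> real^3 \<Rightarrow> bool" where
  "regular_direction D \<omega> \<longleftrightarrow> (\<exists>p. {x \<in> closure D. x \<bullet> \<omega> = support_fun D \<omega>} = {p})"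

definition support_point :: "(real^3) set \<Rightarrow> real^3 \<Rightarrow> real^3" where
  "support_point D \<omega> = (THE p. {x \<in> closure D. x \<bullet> \<omega> = support_fun D \<omega>} = {p})"

definition cone_at :: "real^3 \<Rightarrow> real^3 \<Rightarrow> real \<Rightarrow> (real^3) set" where
  "cone_at p m \<theta> = {x. (x - p) \<bullet> m > norm (x - p) * cos \<theta>}"

definition circular_cone_singularity :: "(real^3) set \<Rightarrow> real^3 \<Rightarrow> bool" where
  "circular_cone_singularity D p \<longleftrightarrow> p \<in> frontier D \<and>
     (\<exists>\<epsilon>>0. \<exists>n\<in>sphere 0 1. \<exists>\<theta>\<in>{0<..<pi/2}. D \<inter> ball p \<epsilon> = cone_at p (- n) \<theta> \<inter> ball p \<epsilon>)"

definition hoelder_on :: "real \<Rightarrow> (real^3) set \<Rightarrow> (real^3 \<Rightarrow> complex) \<Rightarrow> bool" where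
  "hoelder_on \<alpha> S f \<longleftrightarrow> (\<exists>C. \<forall>x\<in>S. \<forall>y\<in>S. norm (f x - f y) \<le> C * norm (x - y) powr \<alpha>)"

definition active_at :: "(real^3 \<Rightarrow> complex) \<Rightarrow> (real^3) set \<Rightarrow> real^3 \<Rightarrow> bool" where
  "active_at \<rho> D p \<longleftrightarrow> p \<in> frontier D \<and>
     (\<exists>\<eta>>0. \<exists>\<alpha>. 0 < \<alpha> \<and> \<alpha> \<le> 1 \<and>
        (\<exists>\<rho>t. hoelder_on \<alpha> (cball p \<eta>) \<rho>t \<and>
              (AE x in lebesgue. x \<in> ball p \<eta> \<inter> D \<longrightarrow> \<rho> x = \<rho>t x) \<and> \<rho>t p \<noteq> 0))"

end

theory Submission
  imports Defs
begin

text \<open>The proof has three ingredients.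

The boundary brackets are volume integrals. The functions \<open>v\<close> and \<open>v\<^sub>\<tau>\<close> are an
exponential \<open>e\<^bsup>z\<cdot>x\<^esup>\<close> with \<open>z\<cdot>z = -k\<^sup>2\<close> and an affine function times this exponential, with the
gradient of the affine function orthogonal to \<open>z\<close>. Both therefore solve the homogeneous Helmholtz
equation, and Green's formula gives \<open>I(\<tau>) = \<integral>\<^sub>D \<rho> v dx\<close> and \<open>I'(\<tau>) = \<integral>\<^sub>D \<rho> v\<^sub>\<tau> dx\<close>
(lemma \<open>boundary_bracket_affine_exp\<close>). As the boundary values of \<open>u\<close> are only given as a limit of
boundary values of smooth functions, the classical Green identity is used for these functions and
then passes to the limit in the square integrable functions on \<open>\<Omega>\<close> and on the boundary. The classical
identity comes from the divergence theorem for domains with C2 boundary, which is derived from the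
description of the surface measure by graphs (theorem \<open>divergence_theorem\<close>).

The vertex dominates. Since \<open>p\<close> is the only point of the closure of \<open>D\<close> where \<open>x\<cdot>\<omega>\<close> is maximal, the
part of \<open>D\<close> away from \<open>p\<close> contributes an exponentially smaller term. Near \<open>p\<close> the substitution
\<open>x = p + y/\<tau>\<close> leaves the cone unchanged, and by dominated convergence
\<open>\<tau>\<^sup>3 \<integral>\<^sub>D r v dx\<close>, divided by the value of \<open>v\<close> at \<open>p\<close>, tends to \<open>r(p) K\<close> for every density \<open>r\<close> that is
continuous near the vertex, where \<open>K\<close> is the integral of \<open>e\<^bsup>y\<cdot>(\<omega>+i\<theta>)\<^esup>\<close> over the cone
(lemma \<open>source_asymptotics\<close>). With \<open>r = \<rho>\<close> this gives the size of \<open>I\<close>; with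
\<open>r = \<rho> (x-p)\<cdot>\<omega>\<close> and \<open>r = \<rho> (x-p)\<cdot>\<theta>\<close>, which vanish at \<open>p\<close>, it shows that
\<open>I'\<close> differs from \<open>p\<cdot>(\<omega> + i \<tau> (\<tau>\<^sup>2+k\<^sup>2)\<^bsup>-1/2\<^esup> \<theta>) I\<close> by a term of smaller order than \<open>I\<close>, provided that \<open>K\<close> is
not zero.

The constant \<open>K\<close> is not zero. This uses the circular shape: the cone is invariant under the Lorentz
boosts along its axis and under dilations. The vector \<open>\<omega> + i\<theta>\<close> is null for the bilinear product, and
such a vector is carried by boosts in a complex direction to a complex multiple of the axis, along a
path on which the cone integral stays constant (lemma \<open>cone_integral_rotate_to_axis\<close>). For the
integral \<open>K(c)\<close> that belongs to \<open>c\<close> times the axis, dilations show that \<open>c\<^sup>3 K(c)\<close> is constant on the half plane \<open>Re c < 0\<close>, and for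
\<open>c = -1\<close> the integrand is positive.

Finally \<open>\<omega>\<close>, \<open>\<theta>\<^sub>1\<close>, \<open>\<theta>\<^sub>2\<close> form a basis, so the limits for both directions determine \<open>p\<close>.\<close>

section \<open>Continuously differentiable functions and orthonormal coordinates\<close>

text \<open>The class \<open>Ck 1\<close>, stated for derivatives in all directions because charts need directions that are
not in the standard basis.\<close>
definition C1 :: "('a::euclidean_space \<Rightarrow> 'b::real_normed_vector) \<Rightarrow> bool" where
  "C1 f \<longleftrightarrow> (\<forall>x. f differentiable (at x)) \<and>
     (\<forall>d. continuous_on UNIV (\<lambda>x. frechet_derivative f (at x) d))"

lemma C1I:
  assumes "\<And>x. (f has_derivative f' x) (at x)" "\<And>d. continuous_on UNIV (\<lambda>x. f' x d)"
  shows "C1 f"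
proof -
  have "frechet_derivative f (at x) = f' x" for x
    using frechet_derivative_at[OF assms(1)[of x]] by simp
  then show ?thesis
    using assms unfolding C1_def differentiable_def by auto
qed

lemma C1_has_derivative:
  "C1 f \<Longrightarrow> (f has_derivative frechet_derivative f (at x)) (at x)"
  by (simp add: C1_def frechet_derivative_works)

lemma C1_continuous_deriv: "C1 f \<Longrightarrow> continuous_on S (\<lambda>x. frechet_derivative f (at x) d)"
  unfolding C1_def using continuous_on_subset by blast

lemma C1_continuous: "C1 f \<Longrightarrow> continuous_on S f"
  by (meson C1_has_derivative continuous_at_imp_continuous_on has_derivative_continuous)

lemma frechet_derivative_eq_0_outside:
  assumes "closed K" "\<And>y. y \<notin> K \<Longrightarrow> f y = 0" "x \<notin> K" "f differentiable (at x)"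
  shows "frechet_derivative f (at x) d = 0"
proof -
  have "((\<lambda>_. 0) has_derivative frechet_derivative f (at x)) (at x)"
    using frechet_derivative_works[THEN iffD1, OF assms(4)]
  proof (rule has_derivative_transform_within_open)
    show "open (- K)" "x \<in> - K" using assms by auto
  qed (use assms in auto)
  then have "frechet_derivative f (at x) = (\<lambda>_. 0)"
    by (rule has_derivative_unique[OF _ has_derivative_const])
  then show ?thesis by simp
qed

text \<open>An invertible linear map scales the measure of boxes by the determinant, and boxes determine the
measure.\<close>
lemma distr_lborel_linear:
  fixes g :: "real^3 \<Rightarrow> real^3"
  assumes g: "linear g" and det: "\<bar>det (matrix g)\<bar> = 1"
  shows "distr lborel borel g = lborel"
proof (rule lborel_eqI[symmetric])
  obtain h where h: "linear h" "\<And>x. h (g x) = x" "\<And>x. g (h x) = x"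
  proof -
    have "inj g" using det det_nz_iff_inj[OF g] by auto
    then show ?thesis
      using that linear_injective_isomorphism[OF g] by blast
  qed
  have "matrix g ** matrix h = mat 1"
    using matrix_compose[OF h(1) g] h(3) by (simp add: o_def matrix_id_mat_1[unfolded id_def])
  then have "det (matrix g) * det (matrix h) = 1"
    by (metis det_I det_mul)
  then have dh: "\<bar>det (matrix h)\<bar> = 1"
    using det by (metis abs_1 abs_mult mult_1)
  have gm: "g \<in> borel \<rightarrow>\<^sub>M borel"
    using g by (intro borel_measurable_continuous_onI) (simp add: linear_continuous_on linear_linear)
  fix l u :: "real^3" assume lu: "\<And>b. b \<in> Basis \<Longrightarrow> l \<bullet> b \<le> u \<bullet> b"
  have *: "g -` box l u = h ` box l u"
    using h by (auto simp: image_iff) (metis h(2))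
  have "emeasure (distr lborel borel g) (box l u) = emeasure lborel (h ` box l u)"
    using gm by (subst emeasure_distr) (auto simp: *)
  also have "\<dots> = emeasure lebesgue (h ` box l u)"
    using measurable_sets[OF gm, of "box l u"] by (auto simp: * emeasure_completion)
  also have "\<dots> = measure lebesgue (h ` box l u)"
    using measurable_linear_image[OF h(1), of "box l u"]
    by (simp add: emeasure_eq_measure2)
  also have "\<dots> = measure lebesgue (box l u)"
    using measure_linear_image[OF h(1), of "box l u"] dh by simp
  also have "\<dots> = (\<Prod>b\<in>Basis. (u - l) \<bullet> b)"
    using lu by (simp add: measure_def)
  finally show "emeasure (distr lborel borel g) (box l u) = (\<Prod>b\<in>Basis. (u - l) \<bullet> b)" .
qed simp

text \<open>Two versions of the coordinates in a frame: \<open>frame_map\<close> takes a point of the plane and a height and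
serves the graph charts, where Fubini's theorem is applied to the height; \<open>frame_vec\<close> is an
endomorphism and serves the cone, which it moves to the third coordinate axis.\<close>
definition frame_map :: "real^3 \<Rightarrow> real^3 \<Rightarrow> real^3 \<Rightarrow> (real \<times> real) \<times> real \<Rightarrow> real^3" where
  "frame_map a b e q = fst (fst q) *\<^sub>R a + snd (fst q) *\<^sub>R b + snd q *\<^sub>R e"

lemma frame_map_borel [measurable]: "frame_map a b e \<in> borel \<rightarrow>\<^sub>M borel"
  unfolding frame_map_def by (intro borel_measurable_continuous_onI continuous_intros)

lemma prod_Basis_real3:
  "(\<Prod>b\<in>Basis. F b) = F (axis 1 1) * F (axis 2 1) * F (axis 3 1)" for F :: "real^3 \<Rightarrow> real"
proof -
  have B: "(Basis :: (real^3) set) = (\<lambda>i. axis i 1) ` UNIV"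
    by (auto simp: Basis_vec_def)
  have inj: "inj_on (\<lambda>i. axis i (1::real) :: real^3) UNIV"
    by (simp add: inj_on_def axis_eq_axis)
  have P3: "(\<Prod>i\<in>(UNIV::3 set). G i) = G 1 * G 2 * G 3" for G :: "3 \<Rightarrow> real"
    unfolding UNIV_3 by simp
  show ?thesis
    unfolding B prod.reindex[OF inj] by (simp only: P3 o_def)
qed
lemma distr_frame_map_standard:
  "distr lborel borel (frame_map (axis 1 1) (axis 2 1) (axis 3 1)) = lborel" (is "distr _ _ ?T = _")
proof (rule lborel_eqI[symmetric])
  fix l u :: "real^3" assume lu: "\<And>b. b \<in> Basis \<Longrightarrow> l \<bullet> b \<le> u \<bullet> b"
  have le: "l $ i \<le> u $ i" for i
    using lu[of "axis i 1"] by (simp add: inner_axis)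
  have T: "?T q $ 1 = fst (fst q)" "?T q $ 2 = snd (fst q)" "?T q $ 3 = snd q" for q
    by (simp_all add: frame_map_def axis_def)
  have v: "?T -` box l u = ({l$1<..<u$1} \<times> {l$2<..<u$2}) \<times> {l$3<..<u$3}"
    by (auto simp: mem_box_cart forall_3 T)
  have "emeasure (distr lborel borel ?T) (box l u) = emeasure lborel (?T -` box l u)"
    by (subst emeasure_distr) auto
  also have "\<dots> = emeasure (lborel \<Otimes>\<^sub>M lborel) (({l$1<..<u$1} \<times> {l$2<..<u$2}) \<times> {l$3<..<u$3})"
    by (simp add: v lborel_prod)
  also have "\<dots> = emeasure lborel ({l$1<..<u$1} \<times> {l$2<..<u$2}) * emeasure lborel {l$3<..<u$3}"
    by (subst lborel.emeasure_pair_measure_Times) (auto intro!: borel_open open_Times)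
  also have "emeasure lborel ({l$1<..<u$1} \<times> {l$2<..<u$2}) =
      emeasure lborel {l$1<..<u$1} * emeasure lborel {l$2<..<u$2}"
    unfolding lborel_prod[symmetric]
    by (subst lborel.emeasure_pair_measure_Times) auto
  also have "emeasure lborel {l$1<..<u$1} * emeasure lborel {l$2<..<u$2} * emeasure lborel {l$3<..<u$3}
     = ennreal ((u$1-l$1) * (u$2-l$2) * (u$3-l$3))"
    using le by (simp add: ennreal_mult)
  also have "\<dots> = (\<Prod>b\<in>Basis. (u - l) \<bullet> b)"
    by (simp add: prod_Basis_real3 inner_axis)
  finally show "emeasure (distr lborel borel ?T) (box l u) = (\<Prod>b\<in>Basis. (u - l) \<bullet> b)" .
qed simp

definition orthonormal_frame :: "real^3 \<Rightarrow> real^3 \<Rightarrow> real^3 \<Rightarrow> bool" where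
  "orthonormal_frame a b e \<longleftrightarrow>
     norm a = 1 \<and> norm b = 1 \<and> norm e = 1 \<and> a \<bullet> b = 0 \<and> a \<bullet> e = 0 \<and> b \<bullet> e = 0"

lemma orthonormal_frame_inner:
  assumes "orthonormal_frame a b e"
  shows "a \<bullet> a = 1" "b \<bullet> b = 1" "e \<bullet> e = 1" "a \<bullet> b = 0" "a \<bullet> e = 0" "b \<bullet> e = 0"
    "b \<bullet> a = 0" "e \<bullet> a = 0" "e \<bullet> b = 0"
  using assms by (auto simp: orthonormal_frame_def norm_eq_1 inner_commute)

lemma orthonormal_frame_expand:
  assumes "orthonormal_frame a b e"
  shows "x = (x \<bullet> a) *\<^sub>R a + (x \<bullet> b) *\<^sub>R b + (x \<bullet> e) *\<^sub>R e"
proof -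
  note o = orthonormal_frame_inner[OF assms]
  have ne: "a \<noteq> b" "a \<noteq> e" "b \<noteq> e" "a \<noteq> 0" "b \<noteq> 0" "e \<noteq> 0" using o by auto
  have po: "pairwise orthogonal {a,b,e}"
    using o by (auto simp: pairwise_def orthogonal_def)
  have ind: "independent {a,b,e}"
    using pairwise_orthogonal_independent[OF po] ne by auto
  have "card {a,b,e} = 3" using ne by auto
  then have sp: "UNIV \<subseteq> span {a,b,e}"
    using ind by (intro card_ge_dim_independent) auto
  define w where "w = x - ((x \<bullet> a) *\<^sub>R a + (x \<bullet> b) *\<^sub>R b + (x \<bullet> e) *\<^sub>R e)"
  have "orthogonal w y" if "y \<in> {a,b,e}" for y
    using that o unfolding orthogonal_def w_def by (auto simp: inner_simps)
  then have "orthogonal w w"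
    using sp by (intro orthogonal_to_span[of w "{a,b,e}"]) auto
  then have "w = 0" by (simp add: orthogonal_def)
  then show ?thesis by (simp add: w_def)
qed

definition frame_vec :: "real^3 \<Rightarrow> real^3 \<Rightarrow> real^3 \<Rightarrow> real^3 \<Rightarrow> real^3" where
  "frame_vec a b e x = x$1 *\<^sub>R a + x$2 *\<^sub>R b + x$3 *\<^sub>R e"

lemma linear_frame_vec: "linear (frame_vec a b e)"
  by (rule linearI) (simp_all add: frame_vec_def algebra_simps)

lemma frame_vec_inner:
  assumes "orthonormal_frame a b e"
  shows "frame_vec a b e x \<bullet> frame_vec a b e y = x \<bullet> y"
proof -
  note o = orthonormal_frame_inner[OF assms]
  have "frame_vec a b e x \<bullet> frame_vec a b e y = x$1 * y$1 + x$2 * y$2 + x$3 * y$3"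
    by (simp add: frame_vec_def inner_simps o)
  then show ?thesis by (simp add: inner_vec_def sum_3)
qed

lemma norm_frame_vec: "orthonormal_frame a b e \<Longrightarrow> norm (frame_vec a b e x) = norm x"
  by (simp add: norm_eq_sqrt_inner frame_vec_inner)

lemma distr_frame_vec:
  assumes "orthonormal_frame a b e"
  shows "distr lborel borel (frame_vec a b e) = lborel"
proof (rule distr_lborel_linear[OF linear_frame_vec])
  have "orthogonal_transformation (frame_vec a b e)"
    using linear_frame_vec frame_vec_inner[OF assms] by (simp add: orthogonal_transformation_def)
  then have "orthogonal_matrix (matrix (frame_vec a b e))"
    by (simp add: orthogonal_transformation_matrix)
  then show "\<bar>det (matrix (frame_vec a b e))\<bar> = 1"
    using det_orthogonal_matrix by fastforce
qed

lemma distr_frame_map: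
  assumes "orthonormal_frame a b e"
  shows "distr lborel borel (frame_map a b e) = lborel"
proof -
  have gm: "frame_vec a b e \<in> borel \<rightarrow>\<^sub>M borel"
    by (intro borel_measurable_continuous_onI) (simp add: linear_continuous_on linear_linear linear_frame_vec)
  have eq: "frame_map a b e = frame_vec a b e \<circ> frame_map (axis 1 1) (axis 2 1) (axis 3 1)"
    by (auto simp: frame_vec_def frame_map_def axis_def fun_eq_iff)
  have "distr lborel borel (frame_map a b e) =
     distr (distr lborel borel (frame_map (axis 1 1) (axis 2 1) (axis 3 1))) borel (frame_vec a b e)"
    unfolding eq by (rule distr_distr[symmetric]) (auto simp: gm)
  then show ?thesis by (simp add: distr_frame_map_standard distr_frame_vec[OF assms])
qed

text \<open>Integrate \<open>f(x+d) - f(x) = \<integral>\<^sub>0\<^sup>1 f'(x+td)d dt\<close> over all \<open>x\<close>. The left-hand side gives zero and the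
inner integral on the right does not depend on \<open>t\<close>, both by translation invariance.\<close>
lemma integral_directional_derivative_eq_0:
  fixes f :: "'a::euclidean_space \<Rightarrow> complex"
  assumes f: "\<And>x. (f has_derivative f' x) (at x)" and cont: "continuous_on UNIV (\<lambda>x. f' x d)"
    and K: "compact K" "\<And>x. x \<notin> K \<Longrightarrow> f x = 0"
  shows "(LINT x|lborel. f' x d) = 0"
proof -
  have f'0: "f' x d = 0" if "x \<notin> K" for x
    using frechet_derivative_eq_0_outside[of K f x d] that K f
      frechet_derivative_at[OF f, of x] compact_imp_closed
    by (metis differentiable_def)
  \<comment> \<open>a compact set outside which the integrand on the product space vanishes: the points moved back along d\<close>
  define F where "F x t = indicator {0..1::real} t *\<^sub>R f' (x + t *\<^sub>R d) d" for x t
  define L where "L = (\<lambda>(k, t). k - t *\<^sub>R d) ` (K \<times> {0..1::real}) \<times> {0..1::real}"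
  have "compact L" unfolding L_def
    by (intro compact_Times compact_continuous_image K compact_Icc)
       (auto intro!: continuous_intros simp: case_prod_unfold)
  have eqF: "case_prod F = (\<lambda>p. indicator L p *\<^sub>R f' (fst p + snd p *\<^sub>R d) d)"
  proof (rule ext, clarify)
    fix x and t :: real
    have "f' (x + t *\<^sub>R d) d = 0" if "t \<in> {0..1}" "(x, t) \<notin> L"
    proof (rule f'0, rule notI)
      assume "x + t *\<^sub>R d \<in> K"
      then have "(x + t *\<^sub>R d, t) \<in> K \<times> {0..1}" using that by auto
      then have "(\<lambda>(k, t). k - t *\<^sub>R d) (x + t *\<^sub>R d, t) \<in> (\<lambda>(k, t). k - t *\<^sub>R d) ` (K \<times> {0..1::real})"
        by (rule imageI)
      then show False using that by (auto simp: L_def)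
    qed
    then show "F x t = indicator L (x, t) *\<^sub>R f' (fst (x, t) + snd (x, t) *\<^sub>R d) d"
      by (auto simp: F_def L_def split: split_indicator)
  qed
  have "continuous_on L (\<lambda>p. f' (fst p + snd p *\<^sub>R d) d)"
    by (rule continuous_on_compose2[OF cont]) (intro continuous_intros, simp)
  then have int: "integrable (lborel \<Otimes>\<^sub>M lborel) (case_prod F)"
    unfolding eqF lborel_prod by (intro borel_integrable_compact \<open>compact L\<close>)
  have fint: "integrable lborel f"
  proof -
    have "f = (\<lambda>x. indicator K x *\<^sub>R f x)" using K by (auto split: split_indicator)
    moreover have "integrable lborel (\<lambda>x. indicator K x *\<^sub>R f x)"
      using f by (intro borel_integrable_compact K)
         (meson continuous_at_imp_continuous_on has_derivative_continuous)
    ultimately show ?thesis by simp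
  qed
  have shift: "(LINT x|lborel. g (x + c)) = (LINT x|lborel. g x)" if "g \<in> borel_measurable borel"
    for g :: "'a \<Rightarrow> complex" and c
  proof -
    have "(LINT x|lborel. g x) = (LINT x|distr lborel borel ((+) c). g x)"
      by (simp add: lborel_distr_plus)
    also have "\<dots> = (LINT x|lborel. g (c + x))"
      using that by (subst integral_distr) auto
    finally show ?thesis by (simp add: add.commute)
  qed
  have shifti: "integrable lborel (\<lambda>x. f (x + c))" for c
  proof -
    have "integrable (distr lborel borel ((+) c)) f" using fint by (simp add: lborel_distr_plus)
    then have "integrable lborel (\<lambda>x. f (c + x))"
      using fint by (subst (asm) integrable_distr_eq) auto
    then show ?thesis by (simp add: add.commute)
  qed
  have f'm: "(\<lambda>x. f' x d) \<in> borel_measurable borel"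
    using cont by (rule borel_measurable_continuous_onI)
  have inner: "(LINT t|lborel. F x t) = f (x + d) - f x" for x
  proof -
    have "(LINT t|lborel. indicator {0..1::real} t *\<^sub>R f' (x + t *\<^sub>R d) d) =
       f (x + 1 *\<^sub>R d) - f (x + 0 *\<^sub>R d)"
    proof (rule integral_FTC_Icc)
      fix t :: real
      have "((\<lambda>t. f (x + t *\<^sub>R d)) has_derivative (\<lambda>s. f' (x + t *\<^sub>R d) (s *\<^sub>R d))) (at t within {0..1})"
        by (rule has_derivative_compose[where g = f and f = "\<lambda>t. x + t *\<^sub>R d", OF _ f])
           (auto intro!: derivative_eq_intros)
      then show "((\<lambda>t. f (x + t *\<^sub>R d)) has_vector_derivative f' (x + t *\<^sub>R d) d) (at t within {0..1})"
        using has_derivative_bounded_linear[OF f, of "x + t *\<^sub>R d"]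
        unfolding has_vector_derivative_def by (simp add: linear_simps(5))
    next
      show "continuous_on {0..1} (\<lambda>t. f' (x + t *\<^sub>R d) d)"
        by (rule continuous_on_compose2[OF cont]) (intro continuous_intros, simp)
    qed auto
    then show ?thesis by (simp add: F_def)
  qed
  have outer: "(LINT x|lborel. F x t) = indicator {0..1} t *\<^sub>R (LINT x|lborel. f' x d)" for t
    unfolding F_def by (subst integral_scaleR_right) (auto simp: shift[OF f'm])
  have "0 = (LINT x|lborel. f (x + d)) - (LINT x|lborel. f x)"
    using shift[of f d] fint by auto
  also have "\<dots> = (LINT x|lborel. (LINT t|lborel. F x t))"
    unfolding inner using shifti fint by (subst Bochner_Integration.integral_diff) auto
  also have "\<dots> = (LINT t|lborel. (LINT x|lborel. F x t))"
    using lborel_pair.Fubini_integral[OF int] by simp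
  also have "\<dots> = (LINT x|lborel. f' x d)"
    unfolding outer by (subst integral_scaleR_left) auto
  finally show ?thesis by simp
qed

section \<open>Integration by parts below a graph\<close>

lemma integrable_continuous_compact_support:
  fixes f :: "'a::euclidean_space \<Rightarrow> 'b::{banach, second_countable_topology}"
  assumes "continuous_on UNIV f" "compact K" "\<And>x. x \<notin> K \<Longrightarrow> f x = 0"
  shows "integrable lborel f"
proof -
  have "(\<lambda>x. indicator K x *\<^sub>R f x) = f" using assms by (auto split: split_indicator)
  moreover have "integrable lborel (\<lambda>x. indicator K x *\<^sub>R f x)"
    using assms by (intro borel_integrable_compact) (auto intro: continuous_on_subset)
  ultimately show ?thesis by simp
qed

text \<open>On every vertical line the shear is a translation.\<close>
lemma distr_lborel_shear:
  fixes \<phi> :: "real \<times> real \<Rightarrow> real"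
  assumes "continuous_on UNIV \<phi>"
  shows "distr lborel borel (\<lambda>q. (fst q, \<phi> (fst q) + snd q)) = lborel" (is "distr _ _ ?S = _")
proof (rule measure_eqI)
  have "continuous_on UNIV ?S"
    by (intro continuous_intros continuous_on_compose2[OF assms]) auto
  then have Sm [measurable]: "?S \<in> borel \<rightarrow>\<^sub>M borel"
    by (rule borel_measurable_continuous_onI)
  fix A :: "((real \<times> real) \<times> real) set" assume "A \<in> sets (distr lborel borel ?S)"
  then have A [measurable]: "A \<in> sets borel" by simp
  have A2: "A \<in> sets (lborel \<Otimes>\<^sub>M lborel)"
    using A by (simp only: lborel_prod sets_lborel)
  have SA: "?S -` A \<in> sets (lborel \<Otimes>\<^sub>M lborel)"
    using measurable_sets[OF Sm A] by (simp only: lborel_prod sets_lborel space_borel Int_UNIV_right)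
  have "emeasure (distr lborel borel ?S) A = emeasure (lborel \<Otimes>\<^sub>M lborel) (?S -` A)"
    using A by (subst emeasure_distr) (auto simp: lborel_prod)
  also have "\<dots> = (\<integral>\<^sup>+y. emeasure lborel (Pair y -` ?S -` A) \<partial>lborel)"
    using SA by (rule lborel.emeasure_pair_measure_alt)
  also have "\<dots> = (\<integral>\<^sup>+y. emeasure lborel (Pair y -` A) \<partial>lborel)"
  proof (rule nn_integral_cong)
    fix y :: "real \<times> real"
    have "Pair y -` A \<in> sets borel"
      using sets_Pair1[OF A2] by simp
    then have "emeasure (distr lborel borel ((+) (\<phi> y))) (Pair y -` A)
        = emeasure lborel ((+) (\<phi> y) -` (Pair y -` A))"
      by (subst emeasure_distr) auto
    moreover have "Pair y -` ?S -` A = (+) (\<phi> y) -` (Pair y -` A)" by auto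
    ultimately show "emeasure lborel (Pair y -` ?S -` A) = emeasure lborel (Pair y -` A)"
      by (simp add: lborel_distr_plus)
  qed
  also have "\<dots> = emeasure (lborel \<Otimes>\<^sub>M lborel) A"
    using A2 by (rule lborel.emeasure_pair_measure_alt[symmetric])
  finally show "emeasure (distr lborel borel ?S) A = emeasure lborel A"
    by (simp add: lborel_prod)
qed simp

lemma linear_frame_map: "linear (frame_map a b e)"
  by (rule linearI) (simp_all add: frame_map_def algebra_simps)

text \<open>The divergence theorem below a graph, for functions of compact support. The shear
\<open>(y,t) \<mapsto> (y, \<phi>(y)+t)\<close> moves the region to a half space and preserves volume. The direction \<open>d\<close> is
the image of a horizontal direction plus \<open>d\<cdot>e - \<phi>'(y)d'\<close> times the vertical one. Horizontal
derivatives integrate to zero over horizontal planes; vertical ones are integrated from minus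
infinity to the graph by the fundamental theorem of calculus.\<close>
lemma integral_subgraph_derivative:
  fixes g :: "real^3 \<Rightarrow> complex"
  assumes fr: "orthonormal_frame a b e" and \<phi>: "C1 \<phi>" and g: "C1 g"
    and K: "compact K" "\<And>x. x \<notin> K \<Longrightarrow> g x = 0"
  shows "(LINT x|lborel. indicator {x. x \<bullet> e < \<phi> (x \<bullet> a, x \<bullet> b)} x *\<^sub>R frechet_derivative g (at x) d) =
    (LINT y|lborel. (d \<bullet> e - frechet_derivative \<phi> (at y) (d \<bullet> a, d \<bullet> b)) *\<^sub>R g (graph_point a b e \<phi> y))"
proof -
  define g' where "g' x = frechet_derivative g (at x)" for x
  define \<phi>' where "\<phi>' y = frechet_derivative \<phi> (at y)" for y
  let ?T = "frame_map a b e"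
  define S where "S q = (fst q, \<phi> (fst q) + snd q)" for q
  define P where "P q = ?T (S q)" for q
  define d' where "d' = (d \<bullet> a, d \<bullet> b)"
  note o = orthonormal_frame_inner[OF fr]
  have gd: "(g has_derivative g' x) (at x)" for x
    unfolding g'_def using g by (rule C1_has_derivative)
  have \<phi>d: "(\<phi> has_derivative \<phi>' y) (at y)" for y
    unfolding \<phi>'_def using \<phi> by (rule C1_has_derivative)
  have g'c: "continuous_on S (\<lambda>x. g' x v)" for S v
    unfolding g'_def using g by (rule C1_continuous_deriv)
  have \<phi>'c: "continuous_on S (\<lambda>y. \<phi>' y v)" for S v
    unfolding \<phi>'_def using \<phi> by (rule C1_continuous_deriv)
  have \<phi>c: "continuous_on S \<phi>" for S using \<phi> by (rule C1_continuous)
  have g'0: "g' x v = 0" if "x \<notin> K" for x v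
    unfolding g'_def using that K g
    by (intro frechet_derivative_eq_0_outside[of K]) (auto simp: compact_imp_closed C1_def)
  have Tc: "continuous_on S ?T" for S
    by (simp add: linear_continuous_on linear_linear linear_frame_map)
  have Sc: "continuous_on X S" for X
    unfolding S_def by (intro continuous_intros continuous_on_compose2[OF \<phi>c[of UNIV]]) auto
  have Pc: "continuous_on X P" for X
    unfolding P_def by (intro continuous_on_compose2[OF Tc[of UNIV] Sc]) auto
  have [measurable]: "\<phi> \<in> borel \<rightarrow>\<^sub>M borel" "(\<lambda>x. g' x v) \<in> borel \<rightarrow>\<^sub>M borel" for v
    using \<phi>c g'c by (auto intro!: borel_measurable_continuous_onI)
  have Sm [measurable]: "S \<in> borel \<rightarrow>\<^sub>M borel"
    using Sc by (rule borel_measurable_continuous_onI)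
  have Pm [measurable]: "P \<in> borel \<rightarrow>\<^sub>M borel"
    using Pc by (rule borel_measurable_continuous_onI)
  have Pd: "(P has_derivative (\<lambda>v. ?T (fst v, \<phi>' (fst q) (fst v) + snd v))) (at q)" for q
    unfolding P_def S_def
    by (rule has_derivative_compose[OF _ linear_imp_has_derivative[OF linear_frame_map]])
       (auto intro!: derivative_eq_intros has_derivative_compose[OF _ \<phi>d])
  \<comment> \<open>P flattens the graph: its inverse is explicit, so g \<circ> P also has compact support\<close>
  define R where "R x = ((x \<bullet> a, x \<bullet> b), x \<bullet> e - \<phi> (x \<bullet> a, x \<bullet> b))" for x
  have RP: "R (P q) = q" for q
    using o by (cases q) (auto simp: R_def P_def S_def frame_map_def inner_simps)
  have Rc: "continuous_on X R" for X
    unfolding R_def by (intro continuous_intros continuous_on_compose2[OF \<phi>c[of UNIV]]) auto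
  define L where "L = R ` K"
  have L: "compact L" unfolding L_def by (intro compact_continuous_image Rc K)
  have PL: "P q \<notin> K" if "q \<notin> L" for q
    using that RP[of q] unfolding L_def by (metis imageI)
  have inS: "indicator {x. x \<bullet> e < \<phi> (x \<bullet> a, x \<bullet> b)} (P q) = (indicator {q. snd q < 0} q :: real)" for q
    using o by (auto simp: P_def S_def frame_map_def inner_simps split: split_indicator)
  let ?I = "indicator {q::(real\<times>real)\<times>real. snd q < 0} :: _ \<Rightarrow> real"
  have Iint: "integrable lborel (\<lambda>q. ?I q *\<^sub>R F q)"
    if "continuous_on UNIV F" "\<And>q. q \<notin> L \<Longrightarrow> F q = 0" for F :: "_ \<Rightarrow> complex"
    using integrable_continuous_compact_support[OF that(1) L that(2)]
    by (intro integrable_mult_indicator) (auto intro!: borel_open open_Collect_less continuous_intros)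
  have g'Pc: "continuous_on UNIV (\<lambda>q. g' (P q) v)" for v
    by (intro continuous_on_compose2[OF g'c[of UNIV] Pc]) auto
  have coefc: "continuous_on UNIV (\<lambda>q::(real\<times>real)\<times>real. d \<bullet> e - \<phi>' (fst q) d')"
    by (intro continuous_intros continuous_on_compose2[OF \<phi>'c[of UNIV]]) auto
  define H' where "H' q v = g' (P q) (?T (fst v, \<phi>' (fst q) (fst v) + snd v))" for q v
  have Hd: "((\<lambda>q. g (P q)) has_derivative H' q) (at q)" for q
    unfolding H'_def by (rule has_derivative_compose[OF Pd gd])
  have lin: "linear (g' x)" for x
    using gd has_derivative_linear by blast
  have H'2: "H' q (0, 1) = g' (P q) e" for q
  proof -
    have "\<phi>' (fst q) 0 = 0" using \<phi>d[of "fst q"] has_derivative_linear linear_0 by blast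
    then show ?thesis by (simp add: H'_def frame_map_def zero_prod_def)
  qed
  have split: "g' (P q) d = H' q (d', 0) + (d \<bullet> e - \<phi>' (fst q) d') *\<^sub>R H' q (0, 1)" for q
  proof -
    have "d = ?T (d', \<phi>' (fst q) d' + 0) + (d \<bullet> e - \<phi>' (fst q) d') *\<^sub>R e"
      using orthonormal_frame_expand[OF fr, of d] by (simp add: frame_map_def d'_def algebra_simps)
    from arg_cong[OF this, of "g' (P q)"] show ?thesis
      by (simp add: H'2 linear_add[OF lin] linear_scale[OF lin]) (simp add: H'_def)
  qed
  have H'1: "H' q (d', 0) = g' (P q) d - (d \<bullet> e - \<phi>' (fst q) d') *\<^sub>R g' (P q) e" for q
    by (simp add: split H'2)
  have H'1c: "continuous_on UNIV (\<lambda>q. H' q (d', 0))"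
    unfolding H'1 by (intro continuous_intros g'Pc coefc)
  have H'2c: "continuous_on UNIV (\<lambda>q. H' q (0, 1))"
    unfolding H'2 by (rule g'Pc)
  have H'0: "H' q v = 0" if "q \<notin> L" for q v
    using PL[OF that] g'0 by (simp add: H'_def)
  have int1: "integrable lborel (\<lambda>q. ?I q *\<^sub>R H' q (d', 0))"
    by (intro Iint H'1c H'0)
  have int2: "integrable lborel (\<lambda>q. ?I q *\<^sub>R ((d \<bullet> e - \<phi>' (fst q) d') *\<^sub>R H' q (0, 1)))"
    by (intro Iint continuous_intros coefc H'2c) (simp add: H'0)
  \<comment> \<open>tangential derivatives integrate to zero on every horizontal plane\<close>
  have I1: "(LINT q|lborel. ?I q *\<^sub>R H' q (d', 0)) = 0"
  proof -
    have slice: "(LINT y|lborel. ?I (y, t) *\<^sub>R H' (y, t) (d', 0)) = 0" for t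
    proof -
      have "(LINT y|lborel. H' (y, t) (d', 0)) = 0"
      proof (rule integral_directional_derivative_eq_0[where f = "\<lambda>y. g (P (y, t))" and d = d'
            and f' = "\<lambda>y v. H' (y, t) (v, 0)" and K = "fst ` L"])
        show "((\<lambda>y. g (P (y, t))) has_derivative (\<lambda>v. H' (y, t) (v, 0))) (at y)" for y
          by (rule has_derivative_compose[OF _ Hd]) (auto intro!: derivative_eq_intros)
        show "continuous_on UNIV (\<lambda>y. H' (y, t) (d', 0))"
          by (rule continuous_on_compose2[OF H'1c]) (auto intro!: continuous_intros)
        show "compact (fst ` L)"
          by (intro compact_continuous_image L continuous_intros)
        show "g (P (y, t)) = 0" if "y \<notin> fst ` L" for y
          using that PL[of "(y, t)"] K(2) by force
      qed
      moreover have "(LINT y|lborel. ?I (y, t) *\<^sub>R H' (y, t) (d', 0)) =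
        indicator {..<0} t *\<^sub>R (LINT y|lborel. H' (y, t) (d', 0))"
        by (cases "t < 0") auto
      ultimately show ?thesis by simp
    qed
    have int: "integrable (lborel \<Otimes>\<^sub>M lborel) (case_prod (\<lambda>y t. ?I (y, t) *\<^sub>R H' (y, t) (d', 0)))"
      using int1 by (simp add: lborel_prod case_prod_unfold)
    have "(LINT q|lborel. ?I q *\<^sub>R H' q (d', 0)) =
       (LINT t|lborel. LINT y|lborel. ?I (y, t) *\<^sub>R H' (y, t) (d', 0))"
      unfolding lborel_pair.integral_snd[OF int] by (simp add: lborel_prod case_prod_unfold)
    then show ?thesis by (simp add: slice)
  qed
  \<comment> \<open>vertical derivatives reduce to values on the graph\<close>
  have I2: "(LINT q|lborel. ?I q *\<^sub>R ((d \<bullet> e - \<phi>' (fst q) d') *\<^sub>R H' q (0, 1))) =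
      (LINT y|lborel. (d \<bullet> e - \<phi>' y d') *\<^sub>R g (P (y, 0)))"
  proof -
    obtain M where M: "M > 0" "\<And>q. q \<in> L \<Longrightarrow> norm q \<le> M"
      using compact_imp_bounded[OF L] by (auto simp: bounded_pos)
    have far: "g (P (y, - (M + 1))) = 0" for y
    proof -
      have "norm (y, - (M + 1)) \<ge> M + 1"
        using norm_snd_le[of "- (M+1)" y] M by auto
      then have "(y, - (M + 1)) \<notin> L" using M(2)[of "(y, - (M + 1))"] by auto
      then show ?thesis using PL K(2) by blast
    qed
    have slice: "(LINT t|lborel. ?I (y, t) *\<^sub>R ((d \<bullet> e - \<phi>' y d') *\<^sub>R H' (y, t) (0, 1))) =
       (d \<bullet> e - \<phi>' y d') *\<^sub>R g (P (y, 0))" for y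
    proof -
      have ftc: "(LINT t|lborel. indicator {- (M + 1)..0} t *\<^sub>R H' (y, t) (0, 1)) =
         g (P (y, 0)) - g (P (y, - (M + 1)))"
      proof (rule integral_FTC_Icc)
        fix t
        have "((\<lambda>t. g (P (y, t))) has_derivative (\<lambda>s. H' (y, t) (0, s))) (at t within {- (M + 1)..0})"
          by (rule has_derivative_compose[OF _ Hd]) (auto intro!: derivative_eq_intros)
        moreover have "(\<lambda>s. s *\<^sub>R H' (y, t) (0, 1)) = (\<lambda>s. H' (y, t) (0, s))"
        proof
          fix s
          have "linear (H' (y, t))" using Hd has_derivative_linear by blast
          then have "H' (y, t) (s *\<^sub>R (0, 1)) = s *\<^sub>R H' (y, t) (0, 1)" by (rule linear_scale)
          moreover have "s *\<^sub>R (0, 1) = (0 :: real \<times> real, s)" by (simp add: scaleR_prod_def zero_prod_def)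
          ultimately show "s *\<^sub>R H' (y, t) (0, 1) = H' (y, t) (0, s)" by metis
        qed
        ultimately show "((\<lambda>t. g (P (y, t))) has_vector_derivative H' (y, t) (0, 1)) (at t within {- (M + 1)..0})"
          unfolding has_vector_derivative_def by metis
      next
        show "continuous_on {- (M + 1)..0} (\<lambda>t. H' (y, t) (0, 1))"
          by (rule continuous_on_compose2[OF H'2c]) (auto intro!: continuous_intros)
      qed (use M in auto)
      have zero: "H' (y, t) (0, 1) = 0" if "t < - (M + 1)" for t
      proof (rule H'0)
        have "norm (y, t) > M" using norm_snd_le[of t y] that M by auto
        then show "(y, t) \<notin> L" using M(2)[of "(y, t)"] by auto
      qed
      have "continuous_on UNIV (\<lambda>t. H' (y, t) (0, 1))"
        by (rule continuous_on_compose2[OF H'2c]) (auto intro!: continuous_intros)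
      then have meas: "(\<lambda>t. H' (y, t) (0, 1)) \<in> borel_measurable lborel"
        using borel_measurable_continuous_onI by auto
      have "(LINT t|lborel. ?I (y, t) *\<^sub>R H' (y, t) (0, 1)) =
         (LINT t|lborel. indicator {- (M + 1)..0} t *\<^sub>R H' (y, t) (0, 1))"
      proof (rule integral_cong_AE)
        show "AE t in lborel. ?I (y, t) *\<^sub>R H' (y, t) (0, 1) = indicator {- (M + 1)..0} t *\<^sub>R H' (y, t) (0, 1)"
          using AE_lborel_singleton[of "0::real"]
          by eventually_elim (auto split: split_indicator simp: zero)
        have "(\<lambda>t. indicator {..<0} t *\<^sub>R H' (y, t) (0, 1)) \<in> borel_measurable lborel"
          using meas by measurable
        moreover have "?I (y, t) = indicator {..<0} t" for t by (auto split: split_indicator)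
        ultimately show "(\<lambda>t. ?I (y, t) *\<^sub>R H' (y, t) (0, 1)) \<in> borel_measurable lborel" by simp
      qed (use meas in measurable)
      then have "(LINT t|lborel. ?I (y, t) *\<^sub>R H' (y, t) (0, 1)) = g (P (y, 0))"
        using ftc far by simp
      moreover have "(LINT t|lborel. ?I (y, t) *\<^sub>R ((d \<bullet> e - \<phi>' y d') *\<^sub>R H' (y, t) (0, 1))) =
         (LINT t|lborel. of_real (d \<bullet> e - \<phi>' y d') * (?I (y, t) *\<^sub>R H' (y, t) (0, 1)))"
        by (intro Bochner_Integration.integral_cong refl) (simp add: scaleR_conv_of_real)
      ultimately show ?thesis
        by (simp only: integral_mult_right_zero scaleR_conv_of_real)
    qed
    have int: "integrable (lborel \<Otimes>\<^sub>M lborel)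
        (case_prod (\<lambda>y t. ?I (y, t) *\<^sub>R ((d \<bullet> e - \<phi>' y d') *\<^sub>R H' (y, t) (0, 1))))"
      using int2 by (simp add: lborel_prod case_prod_unfold)
    have "(LINT q|lborel. ?I q *\<^sub>R ((d \<bullet> e - \<phi>' (fst q) d') *\<^sub>R H' q (0, 1))) =
       (LINT y|lborel. LINT t|lborel. ?I (y, t) *\<^sub>R ((d \<bullet> e - \<phi>' y d') *\<^sub>R H' (y, t) (0, 1)))"
      unfolding lborel_pair.integral_fst[OF int] by (simp add: lborel_prod case_prod_unfold)
    then show ?thesis by (simp only: slice)
  qed
  have dP: "distr lborel borel P = lborel"
  proof -
    have "distr lborel borel P = distr (distr lborel borel S) borel ?T"
      by (subst distr_distr) (auto simp: P_def[abs_def] comp_def)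
    then show ?thesis
      using distr_lborel_shear[OF \<phi>c] distr_frame_map[OF fr] by (simp add: S_def[abs_def])
  qed
  have Um: "{x. x \<bullet> e < \<phi> (x \<bullet> a, x \<bullet> b)} \<in> sets borel"
    by (intro borel_open open_Collect_less continuous_intros continuous_on_compose2[OF \<phi>c[of UNIV]]) auto
  have "(LINT x|lborel. indicator {x. x \<bullet> e < \<phi> (x \<bullet> a, x \<bullet> b)} x *\<^sub>R g' x d) =
     (LINT x|distr lborel borel P. indicator {x. x \<bullet> e < \<phi> (x \<bullet> a, x \<bullet> b)} x *\<^sub>R g' x d)"
    by (simp add: dP)
  also have "\<dots> = (LINT q|lborel. ?I q *\<^sub>R g' (P q) d)"
    using Um by (subst integral_distr) (auto simp: inS)
  also have "\<dots> = (LINT q|lborel. ?I q *\<^sub>R H' q (d', 0) +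
      ?I q *\<^sub>R ((d \<bullet> e - \<phi>' (fst q) d') *\<^sub>R H' q (0, 1)))"
    by (simp add: split scaleR_add_right)
  also have "\<dots> = (LINT y|lborel. (d \<bullet> e - \<phi>' y d') *\<^sub>R g (P (y, 0)))"
    using int1 int2 I1 I2 by (subst Bochner_Integration.integral_add) auto
  finally show ?thesis
    by (simp add: g'_def \<phi>'_def P_def S_def d'_def graph_point_def frame_map_def)
qed

section \<open>The surface measure and the normal field in charts\<close>

lemma Ck_continuous: "Ck n f \<Longrightarrow> continuous_on UNIV f"
  by (cases n) (simp_all add: continuous_at_imp_continuous_on differentiable_imp_continuous_within)

lemma Ck_Suc_imp_C1:
  fixes f :: "'a::euclidean_space \<Rightarrow> 'b::real_normed_vector"
  assumes "Ck (Suc n) f"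
  shows "C1 f"
proof -
  have d: "f differentiable (at x)" for x using assms by simp
  have c: "continuous_on UNIV (\<lambda>x. frechet_derivative f (at x) b)" if "b \<in> Basis" for b
    using assms that by (auto intro: Ck_continuous)
  have expand: "(\<Sum>b\<in>Basis. (v \<bullet> b) *\<^sub>R frechet_derivative f (at x) b) = frechet_derivative f (at x) v" for x v
  proof -
    have lin: "linear (frechet_derivative f (at x))" using d by (rule linear_frechet_derivative)
    have "frechet_derivative f (at x) v = frechet_derivative f (at x) (\<Sum>b\<in>Basis. (v \<bullet> b) *\<^sub>R b)"
      by (simp add: euclidean_representation)
    also have "\<dots> = (\<Sum>b\<in>Basis. (v \<bullet> b) *\<^sub>R frechet_derivative f (at x) b)"
      by (simp only: linear_sum[OF lin] linear_scale[OF lin])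
    finally show ?thesis ..
  qed
  have "continuous_on UNIV (\<lambda>x. \<Sum>b\<in>Basis. (v \<bullet> b) *\<^sub>R frechet_derivative f (at x) b)" for v
    by (intro continuous_intros c)
  then show ?thesis
    unfolding C1_def expand using d by blast
qed

lemma smooth_imp_C1: "smooth f \<Longrightarrow> C1 f"
  unfolding smooth_def by (rule Ck_Suc_imp_C1[of 0]) (rule spec)

lemma boundary_chartD:
  assumes "boundary_chart \<Omega> p r a b e \<phi>"
  shows "r > 0" "orthonormal_frame a b e" "C1 \<phi>"
    "\<And>x. x \<in> ball p r \<Longrightarrow> x \<in> \<Omega> \<longleftrightarrow> x \<bullet> e < \<phi> (x \<bullet> a, x \<bullet> b)"
proof -
  show "r > 0" using assms unfolding boundary_chart_def by (elim conjE)
  show "orthonormal_frame a b e"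
    using assms unfolding boundary_chart_def orthonormal_frame_def by (elim conjE) (intro conjI)
  have "Ck 2 \<phi>" using assms unfolding boundary_chart_def by (elim conjE)
  then show "C1 \<phi>" unfolding numeral_2_eq_2 by (rule Ck_Suc_imp_C1)
  have "\<Omega> \<inter> ball p r = {x \<in> ball p r. x \<bullet> e < \<phi> (x \<bullet> a, x \<bullet> b)}"
    using assms unfolding boundary_chart_def by (elim conjE)
  then have "x \<in> \<Omega> \<inter> ball p r \<longleftrightarrow> x \<in> {x \<in> ball p r. x \<bullet> e < \<phi> (x \<bullet> a, x \<bullet> b)}" for x
    by (rule arg_cong)
  then show "\<And>x. x \<in> ball p r \<Longrightarrow> x \<in> \<Omega> \<longleftrightarrow> x \<bullet> e < \<phi> (x \<bullet> a, x \<bullet> b)"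
    unfolding Int_iff mem_Collect_eq by blast
qed

lemma graph_point_inner:
  assumes "orthonormal_frame a b e"
  shows "graph_point a b e \<phi> y \<bullet> a = fst y" "graph_point a b e \<phi> y \<bullet> b = snd y"
    "graph_point a b e \<phi> y \<bullet> e = \<phi> y"
  using orthonormal_frame_inner[OF assms] by (auto simp: graph_point_def inner_simps)

lemma graph_point_in_frontier:
  assumes ch: "boundary_chart \<Omega> p r a b e \<phi>" and y: "graph_point a b e \<phi> y \<in> ball p r"
    and "open \<Omega>"
  shows "graph_point a b e \<phi> y \<in> frontier \<Omega>"
proof -
  let ?g = "graph_point a b e \<phi> y"
  note D = boundary_chartD[OF ch]
  note gi = graph_point_inner[OF D(2), of \<phi> y]
  note o = orthonormal_frame_inner[OF D(2)]
  have "?g \<notin> \<Omega>" using D(4)[OF y] gi by simp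
  moreover have "?g \<in> closure \<Omega>"
    unfolding closure_approachable
  proof (intro allI impI)
    fix \<epsilon> :: real assume "\<epsilon> > 0"
    obtain s where s: "s > 0" "ball ?g s \<subseteq> ball p r" using y by (meson open_ball open_contains_ball)
    define \<delta> where "\<delta> = min \<epsilon> s / 2"
    have \<delta>: "0 < \<delta>" "\<delta> < \<epsilon>" "\<delta> < s" using \<open>\<epsilon> > 0\<close> s by (auto simp: \<delta>_def)
    let ?x = "?g - \<delta> *\<^sub>R e"
    have dist: "dist ?x ?g = \<delta>" using D(2) \<delta> by (simp add: dist_norm orthonormal_frame_def)
    then have "?x \<in> ball ?g s" using \<delta> by (simp add: dist_commute)
    then have "?x \<in> ball p r" using s by blast
    moreover have "?x \<bullet> e < \<phi> (?x \<bullet> a, ?x \<bullet> b)"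
      using gi o \<delta> by (simp add: inner_simps)
    ultimately have "?x \<in> \<Omega>" using D(4) by blast
    moreover have "dist ?x ?g < \<epsilon>" using \<delta>(2) unfolding dist .
    ultimately show "\<exists>x\<in>\<Omega>. dist x ?g < \<epsilon>" by blast
  qed
  ultimately show ?thesis using \<open>open \<Omega>\<close> by (simp add: frontier_def interior_open)
qed

lemma frontier_in_graph:
  assumes ch: "boundary_chart \<Omega> p r a b e \<phi>" and x: "x \<in> ball p r" "x \<in> frontier \<Omega>"
    and "open \<Omega>"
  shows "graph_point a b e \<phi> (x \<bullet> a, x \<bullet> b) = x"
proof -
  note D = boundary_chartD[OF ch]
  have \<phi>c: "continuous_on S \<phi>" for S using D(3) by (rule C1_continuous)
  have "x \<notin> \<Omega>" using x \<open>open \<Omega>\<close> by (simp add: frontier_def interior_open)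
  then have ge: "x \<bullet> e \<ge> \<phi> (x \<bullet> a, x \<bullet> b)" using D(4)[OF x(1)] by simp
  have "x \<bullet> e = \<phi> (x \<bullet> a, x \<bullet> b)"
  proof (rule ccontr)
    assume "x \<bullet> e \<noteq> \<phi> (x \<bullet> a, x \<bullet> b)"
    let ?U = "{x. \<phi> (x \<bullet> a, x \<bullet> b) < x \<bullet> e} \<inter> ball p r"
    have "open ?U"
      by (intro open_Int open_Collect_less continuous_intros continuous_on_compose2[OF \<phi>c[of UNIV]]) auto
    moreover have "x \<in> ?U" using x ge \<open>x \<bullet> e \<noteq> _\<close> by auto
    moreover have "?U \<inter> \<Omega> = {}" using D(4) by force
    ultimately have "x \<notin> closure \<Omega>"
      using open_Int_closure_eq_empty[of ?U \<Omega>] by blast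
    then show False using x(2) by (simp add: frontier_def)
  qed
  then have "graph_point a b e \<phi> (x \<bullet> a, x \<bullet> b) = (x \<bullet> a) *\<^sub>R a + (x \<bullet> b) *\<^sub>R b + (x \<bullet> e) *\<^sub>R e"
    by (simp add: graph_point_def)
  then show ?thesis
    using orthonormal_frame_expand[OF D(2), of x] by (rule trans[OF _ sym])
qed

lemma area_element_pos: "area_element \<phi> y > 0"
  unfolding area_element_def by (simp add: add_pos_nonneg)

lemma continuous_on_area_element: "C1 \<phi> \<Longrightarrow> continuous_on S (area_element \<phi>)"
  unfolding area_element_def by (intro continuous_intros C1_continuous_deriv)

lemma continuous_on_graph_point: "C1 \<phi> \<Longrightarrow> continuous_on S (graph_point a b e \<phi>)"
  unfolding graph_point_def by (intro continuous_intros C1_continuous)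

context
  fixes \<Omega> :: "(real^3) set" and \<sigma> :: "(real^3) measure"
  assumes op: "open \<Omega>" and sm: "surface_measure \<Omega> \<sigma>"
begin

lemma space_surface: "space \<sigma> = frontier \<Omega>"
  using sm sets_eq_imp_space_eq[of \<sigma> "restrict_space borel (frontier \<Omega>)"]
  by (simp add: surface_measure_def space_restrict_space)

lemma borel_measurable_surface: "f \<in> borel \<rightarrow>\<^sub>M N \<Longrightarrow> f \<in> \<sigma> \<rightarrow>\<^sub>M N"
  using sm by (simp add: surface_measure_def measurable_restrict_space1 cong: measurable_cong_sets)

lemma sets_surface: "A \<in> sets borel \<Longrightarrow> A \<subseteq> frontier \<Omega> \<Longrightarrow> A \<in> sets \<sigma>"
  using sm by (auto simp: surface_measure_def sets_restrict_space)

text \<open>The defining property of the surface measure, freed from the requirement that the set lies on the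
boundary: below, the measure is compared with an image measure on the whole space.\<close>
lemma emeasure_surface_chart:
  assumes ch: "boundary_chart \<Omega> p r a b e \<phi>" and A: "A \<in> sets borel"
  shows "emeasure \<sigma> (A \<inter> frontier \<Omega> \<inter> ball p r) =
    (\<integral>\<^sup>+ y. indicator (A \<inter> ball p r) (graph_point a b e \<phi> y) * ennreal (area_element \<phi> y) \<partial>lborel)"
proof -
  have "emeasure \<sigma> (A \<inter> frontier \<Omega> \<inter> ball p r) =
    (\<integral>\<^sup>+ y. indicator (A \<inter> frontier \<Omega> \<inter> ball p r) (graph_point a b e \<phi> y) * ennreal (area_element \<phi> y) \<partial>lborel)"
  proof -
    have "A \<inter> frontier \<Omega> \<inter> ball p r \<in> sets borel"
      using A borel_closed[OF frontier_closed] borel_open[OF open_ball] by (intro sets.Int)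
    moreover have "A \<inter> frontier \<Omega> \<inter> ball p r \<subseteq> frontier \<Omega> \<inter> ball p r" by auto
    ultimately show ?thesis
      using sm ch unfolding surface_measure_def by blast
  qed
  also have "\<dots> = (\<integral>\<^sup>+ y. indicator (A \<inter> ball p r) (graph_point a b e \<phi> y) * ennreal (area_element \<phi> y) \<partial>lborel)"
    using graph_point_in_frontier[OF ch _ op]
    by (intro nn_integral_cong) (auto split: split_indicator)
  finally show ?thesis .
qed

text \<open>Inside a chart ball the surface measure is the image under the graph map of the measure with density
\<open>area_element\<close> on the plane.\<close>
lemma integral_surface_chart:
  fixes h :: "real^3 \<Rightarrow> complex"
  assumes ch: "boundary_chart \<Omega> p r a b e \<phi>" and hm: "h \<in> borel_measurable borel"
    and h0: "\<And>x. x \<notin> ball p r \<Longrightarrow> h x = 0"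
  shows "(LINT x|\<sigma>. h x) = (LINT y|lborel. area_element \<phi> y *\<^sub>R h (graph_point a b e \<phi> y))"
proof -
  note D = boundary_chartD[OF ch]
  let ?g = "graph_point a b e \<phi>"
  have [measurable]: "?g \<in> borel \<rightarrow>\<^sub>M borel" "area_element \<phi> \<in> borel \<rightarrow>\<^sub>M borel"
    by (auto intro!: borel_measurable_continuous_onI continuous_on_graph_point continuous_on_area_element D)
  note hm [measurable]
  have id [measurable]: "(\<lambda>x. x) \<in> \<sigma> \<rightarrow>\<^sub>M borel" by (rule borel_measurable_surface) simp
  let ?B = "ball p r"
  have [measurable]: "?B \<in> sets borel" by simp
  have eq: "density (distr \<sigma> borel (\<lambda>x. x)) (indicator ?B) =
     distr (density lborel (\<lambda>y. indicator ?B (?g y) * ennreal (area_element \<phi> y))) borel ?g"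
  proof (rule measure_eqI)
    fix A assume "A \<in> sets (density (distr \<sigma> borel (\<lambda>x. x)) (indicator ?B))"
    then have A [measurable]: "A \<in> sets borel" by simp
    have "emeasure (density (distr \<sigma> borel (\<lambda>x. x)) (indicator ?B)) A =
       emeasure (distr \<sigma> borel (\<lambda>x. x)) (A \<inter> ?B)"
      by (subst emeasure_density) (auto simp: nn_integral_indicator' indicator_inter_arith[symmetric] Int_commute)
    also have "\<dots> = emeasure \<sigma> (A \<inter> frontier \<Omega> \<inter> ?B)"
      by (subst emeasure_distr) (auto simp: space_surface Int_ac intro!: arg_cong[where f = "emeasure \<sigma>"])
    also have "\<dots> = (\<integral>\<^sup>+ y. indicator (A \<inter> ?B) (?g y) * ennreal (area_element \<phi> y) \<partial>lborel)"
      by (rule emeasure_surface_chart[OF ch A])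
    also have "\<dots> = (\<integral>\<^sup>+ y. (indicator ?B (?g y) * ennreal (area_element \<phi> y)) * indicator (?g -` A) y \<partial>lborel)"
      by (intro nn_integral_cong) (auto split: split_indicator)
    also have "\<dots> = emeasure (density lborel (\<lambda>y. indicator ?B (?g y) * ennreal (area_element \<phi> y))) (?g -` A)"
      using measurable_sets[of ?g borel borel A] by (subst emeasure_density) auto
    also have "\<dots> = emeasure (distr (density lborel (\<lambda>y. indicator ?B (?g y) * ennreal (area_element \<phi> y))) borel ?g) A"
      by (subst emeasure_distr) auto
    finally show "emeasure (density (distr \<sigma> borel (\<lambda>x. x)) (indicator ?B)) A = \<dots>" .
  qed simp
  have "(LINT x|\<sigma>. h x) = (LINT x|distr \<sigma> borel (\<lambda>x. x). h x)"
    by (subst integral_distr) auto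
  also have "\<dots> = (LINT x|distr \<sigma> borel (\<lambda>x. x). indicator ?B x *\<^sub>R h x)"
    by (intro Bochner_Integration.integral_cong refl) (auto split: split_indicator simp: h0)
  also have "\<dots> = (LINT x|density (distr \<sigma> borel (\<lambda>x. x)) (indicator ?B). h x)"
  proof -
    have "(LINT x|density (distr \<sigma> borel (\<lambda>x. x)) (\<lambda>x. ennreal (indicator ?B x)). h x) =
       (LINT x|distr \<sigma> borel (\<lambda>x. x). indicator ?B x *\<^sub>R h x)"
      by (rule integral_density) (auto simp: measurable_distr_eq1)
    then show ?thesis by (simp add: ennreal_indicator)
  qed
  also have "\<dots> = (LINT y|density lborel (\<lambda>y. indicator ?B (?g y) * ennreal (area_element \<phi> y)). h (?g y))"
    unfolding eq by (subst integral_distr) auto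
  also have "\<dots> = (LINT y|density lborel (\<lambda>y. ennreal (indicator ?B (?g y) * area_element \<phi> y)). h (?g y))"
    by (simp add: ennreal_mult'' area_element_pos less_imp_le ennreal_indicator)
  also have "\<dots> = (LINT y|lborel. (indicator ?B (?g y) * area_element \<phi> y) *\<^sub>R h (?g y))"
    by (subst integral_density) (auto simp: area_element_pos less_imp_le)
  also have "\<dots> = (LINT y|lborel. area_element \<phi> y *\<^sub>R h (?g y))"
    by (intro Bochner_Integration.integral_cong refl) (auto split: split_indicator simp: h0)
  finally show ?thesis .
qed

lemma emeasure_surface_chart_finite:
  assumes ch: "boundary_chart \<Omega> p r a b e \<phi>" and "s < r"
  shows "emeasure \<sigma> (frontier \<Omega> \<inter> cball p s) < \<infinity>"
proof -
  note D = boundary_chartD[OF ch]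
  define B where "B = (\<lambda>x. (x \<bullet> a, x \<bullet> b)) ` cball p s"
  have B: "compact B" unfolding B_def
    by (rule compact_continuous_image[OF _ compact_cball]) (intro continuous_intros)
  have Bm [measurable]: "B \<in> sets borel" using B by (auto intro: borel_compact)
  have "cball p s \<subseteq> ball p r" using \<open>s < r\<close> by auto
  then have eq: "frontier \<Omega> \<inter> cball p s = cball p s \<inter> frontier \<Omega> \<inter> ball p r" by blast
  have "emeasure \<sigma> (frontier \<Omega> \<inter> cball p s) =
     (\<integral>\<^sup>+ y. indicator (cball p s \<inter> ball p r) (graph_point a b e \<phi> y) * ennreal (area_element \<phi> y) \<partial>lborel)"
    unfolding eq by (rule emeasure_surface_chart[OF ch]) simp
  also have "\<dots> \<le> (\<integral>\<^sup>+ y. ennreal (norm (indicator B y *\<^sub>R area_element \<phi> y)) \<partial>lborel)"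
  proof (rule nn_integral_mono)
    fix y
    have "y \<in> B" if "graph_point a b e \<phi> y \<in> cball p s"
      unfolding B_def using that graph_point_inner[OF D(2), of \<phi> y]
      by (intro image_eqI[of _ _ "graph_point a b e \<phi> y"]) auto
    then show "indicator (cball p s \<inter> ball p r) (graph_point a b e \<phi> y) * ennreal (area_element \<phi> y)
        \<le> ennreal (norm (indicator B y *\<^sub>R area_element \<phi> y))"
      using area_element_pos[of \<phi> y] by (auto split: split_indicator)
  qed
  also have "\<dots> < \<infinity>"
    using borel_integrable_compact[OF B continuous_on_area_element[OF D(3)]]
    by (simp add: integrable_iff_bounded)
  finally show ?thesis .
qed

lemma surface_finite_measure:
  assumes bd: "bounded \<Omega>" and C2: "C2_boundary \<Omega>"
  shows "finite_measure \<sigma>"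
proof
  have "\<exists>s>0. emeasure \<sigma> (frontier \<Omega> \<inter> cball p s) < \<infinity>" if p: "p \<in> frontier \<Omega>" for p
  proof -
    from C2 p obtain r a b e \<phi> where ch: "boundary_chart \<Omega> p r a b e \<phi>"
      unfolding C2_boundary_def by blast
    show ?thesis
      using emeasure_surface_chart_finite[OF ch, of "r / 2"] boundary_chartD(1)[OF ch]
      by (intro exI[of _ "r/2"]) auto
  qed
  then obtain s where s: "\<And>p. p \<in> frontier \<Omega> \<Longrightarrow> s p > 0"
      "\<And>p. p \<in> frontier \<Omega> \<Longrightarrow> emeasure \<sigma> (frontier \<Omega> \<inter> cball p (s p)) < \<infinity>"
    by metis
  have "compact (frontier \<Omega>)" using bd by (rule compact_frontier_bounded)
  then obtain C where C: "C \<subseteq> frontier \<Omega>" "finite C" "frontier \<Omega> \<subseteq> (\<Union>p\<in>C. ball p (s p))"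
    by (rule compactE_image[of _ "frontier \<Omega>" "\<lambda>p. ball p (s p)"]) (use s in auto)
  have sets: "frontier \<Omega> \<inter> cball p (s p) \<in> sets \<sigma>" for p
    by (intro sets_surface sets.Int borel_closed) auto
  have "emeasure \<sigma> (space \<sigma>) \<le> emeasure \<sigma> (\<Union>p\<in>C. frontier \<Omega> \<inter> cball p (s p))"
    unfolding space_surface using C(3) sets C(2)
    by (intro emeasure_mono) (fastforce intro: less_imp_le simp: subset_iff)+
  also have "\<dots> \<le> (\<Sum>p\<in>C. emeasure \<sigma> (frontier \<Omega> \<inter> cball p (s p)))"
    using C(2) sets by (intro emeasure_subadditive_finite) auto
  also have "\<dots> < \<infinity>"
    using C(1,2) s(2) by (auto simp: subset_iff)
  finally show "emeasure \<sigma> (space \<sigma>) \<noteq> \<infinity>" by simp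
qed

text \<open>Charts prescribe the normal field completely, since every boundary point in a chart ball lies on the
graph.\<close>
lemma continuous_on_normal:
  assumes C2: "C2_boundary \<Omega>" and \<nu>: "outward_unit_normal \<Omega> \<nu>"
  shows "continuous_on (frontier \<Omega>) \<nu>"
  unfolding continuous_on_eq_continuous_within
proof
  fix p assume p: "p \<in> frontier \<Omega>"
  from C2 p obtain r a b e \<phi> where ch: "boundary_chart \<Omega> p r a b e \<phi>"
    unfolding C2_boundary_def by blast
  note D = boundary_chartD[OF ch]
  define N where "N y = (1 / area_element \<phi> y) *\<^sub>R
            (e - frechet_derivative \<phi> (at y) (1, 0) *\<^sub>R a - frechet_derivative \<phi> (at y) (0, 1) *\<^sub>R b)" for y
  have "continuous_on UNIV N"
    unfolding N_def using area_element_pos[of \<phi>]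
    by (intro continuous_intros continuous_on_area_element C1_continuous_deriv D)
       (simp add: less_imp_neq[THEN not_sym])
  then have "continuous_on UNIV (\<lambda>x. N (x \<bullet> a, x \<bullet> b))"
    by (rule continuous_on_compose2) (auto intro!: continuous_intros)
  then have "continuous (at p within frontier \<Omega>) (\<lambda>x. N (x \<bullet> a, x \<bullet> b))"
    by (meson UNIV_I continuous_on_eq_continuous_within continuous_within_subset subset_UNIV)
  then show "continuous (at p within frontier \<Omega>) \<nu>"
  proof (rule continuous_transform_within[OF _ D(1) p])
    fix x assume x: "x \<in> frontier \<Omega>" "dist x p < r"
    then have xb: "x \<in> ball p r" by (simp add: dist_commute)
    note gx = frontier_in_graph[OF ch xb x(1) op]
    show "N (x \<bullet> a, x \<bullet> b) = \<nu> x"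
      using \<nu> ch gx xb unfolding outward_unit_normal_def N_def by metis
  qed
qed

text \<open>In a chart the normal is \<open>(e - \<nabla>\<phi>)\<close> divided by the area element, so that the density of the surface
measure cancels the normalization and the right-hand side of \<open>integral_subgraph_derivative\<close> appears.\<close>
lemma local_divergence_theorem:
  assumes \<nu>: "outward_unit_normal \<Omega> \<nu>" and C2: "C2_boundary \<Omega>"
    and ch: "boundary_chart \<Omega> p r a b e \<phi>" and sr: "s < r"
    and g: "C1 g" "\<And>x. x \<notin> cball p s \<Longrightarrow> g x = 0"
  shows "(LINT x|lborel. indicator \<Omega> x *\<^sub>R frechet_derivative g (at x) d) =
    (LINT x|\<sigma>. of_real (\<nu> x \<bullet> d) * (g x :: complex))"
proof -
  note D = boundary_chartD[OF ch]
  define h where "h x = (indicator (frontier \<Omega>) x *\<^sub>R of_real (\<nu> x \<bullet> d)) * g x" for x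
  have hm: "h \<in> borel_measurable borel"
    unfolding h_def
    by (intro borel_measurable_times borel_measurable_continuous_on_indicator borel_measurable_continuous_onI
         continuous_intros continuous_on_normal[OF C2 \<nu>] C1_continuous[OF g(1)]) (auto intro: borel_closed)
  have g'0: "frechet_derivative g (at x) d = 0" if "x \<notin> cball p s" for x
    using that g by (intro frechet_derivative_eq_0_outside[of "cball p s"]) (auto simp: C1_def)
  have "(LINT x|lborel. indicator \<Omega> x *\<^sub>R frechet_derivative g (at x) d) =
     (LINT x|lborel. indicator {x. x \<bullet> e < \<phi> (x \<bullet> a, x \<bullet> b)} x *\<^sub>R frechet_derivative g (at x) d)"
  proof (intro Bochner_Integration.integral_cong refl)
    fix x
    show "indicator \<Omega> x *\<^sub>R frechet_derivative g (at x) d =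
      indicator {x. x \<bullet> e < \<phi> (x \<bullet> a, x \<bullet> b)} x *\<^sub>R frechet_derivative g (at x) d"
    proof (cases "x \<in> cball p s")
      case True
      then have "x \<in> ball p r" using sr by auto
      then show ?thesis using D(4) by (auto split: split_indicator)
    qed (simp add: g'0)
  qed
  also have "\<dots> = (LINT y|lborel. (d \<bullet> e - frechet_derivative \<phi> (at y) (d \<bullet> a, d \<bullet> b)) *\<^sub>R g (graph_point a b e \<phi> y))"
    by (rule integral_subgraph_derivative[OF D(2,3) g(1) compact_cball g(2)])
  also have "\<dots> = (LINT y|lborel. area_element \<phi> y *\<^sub>R h (graph_point a b e \<phi> y))"
  proof (intro Bochner_Integration.integral_cong refl)
    fix y
    let ?x = "graph_point a b e \<phi> y"
    show "(d \<bullet> e - frechet_derivative \<phi> (at y) (d \<bullet> a, d \<bullet> b)) *\<^sub>R g ?x = area_element \<phi> y *\<^sub>R h ?x"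
    proof (cases "?x \<in> cball p s")
      case True
      then have xb: "?x \<in> ball p r" using sr by auto
      have lin: "linear (frechet_derivative \<phi> (at y))"
        using D(3) linear_frechet_derivative unfolding C1_def by blast
      have "(d \<bullet> a, d \<bullet> b) = (d \<bullet> a) *\<^sub>R (1, 0) + (d \<bullet> b) *\<^sub>R (0, 1)" by simp
      from arg_cong[OF this, of "frechet_derivative \<phi> (at y)"]
      have "frechet_derivative \<phi> (at y) (d \<bullet> a, d \<bullet> b) =
         (d \<bullet> a) * frechet_derivative \<phi> (at y) (1, 0) + (d \<bullet> b) * frechet_derivative \<phi> (at y) (0, 1)"
        by (simp only: linear_add[OF lin] linear_scale[OF lin]) simp
      moreover have "\<nu> ?x = (1 / area_element \<phi> y) *\<^sub>R
            (e - frechet_derivative \<phi> (at y) (1, 0) *\<^sub>R a - frechet_derivative \<phi> (at y) (0, 1) *\<^sub>R b)"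
        using \<nu> ch xb unfolding outward_unit_normal_def by blast
      then have "area_element \<phi> y * (\<nu> ?x \<bullet> d) =
            (e - frechet_derivative \<phi> (at y) (1, 0) *\<^sub>R a - frechet_derivative \<phi> (at y) (0, 1) *\<^sub>R b) \<bullet> d"
        using area_element_pos[of \<phi> y] by simp
      ultimately have "d \<bullet> e - frechet_derivative \<phi> (at y) (d \<bullet> a, d \<bullet> b) = area_element \<phi> y * (\<nu> ?x \<bullet> d)"
        by (simp add: inner_simps inner_commute mult.commute)
      moreover have "?x \<in> frontier \<Omega>" by (rule graph_point_in_frontier[OF ch xb op])
      ultimately show ?thesis by (simp add: h_def scaleR_conv_of_real)
    qed (simp add: g h_def)
  qed
  also have "\<dots> = (LINT x|\<sigma>. h x)"
    using g(2) sr by (intro integral_surface_chart[OF ch hm, symmetric]) (simp add: h_def)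
  also have "\<dots> = (LINT x|\<sigma>. of_real (\<nu> x \<bullet> d) * g x)"
    by (intro Bochner_Integration.integral_cong refl) (simp add: h_def space_surface)
  finally show ?thesis .
qed

end

section \<open>The divergence theorem for domains with C2 boundary\<close>

lemma C1_mult:
  fixes f g :: "'a::euclidean_space \<Rightarrow> 'b::real_normed_algebra"
  assumes "C1 f" "C1 g"
  shows "C1 (\<lambda>x. f x * g x)"
proof (rule C1I)
  show "((\<lambda>x. f x * g x) has_derivative
      (\<lambda>v. f x * frechet_derivative g (at x) v + frechet_derivative f (at x) v * g x)) (at x)" for x
    by (rule has_derivative_mult[OF assms[THEN C1_has_derivative]])
qed (intro continuous_intros C1_continuous[OF assms(1)] C1_continuous[OF assms(2)]
       C1_continuous_deriv[OF assms(1)] C1_continuous_deriv[OF assms(2)])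

lemma frechet_derivative_mult_C1:
  fixes f g :: "'a::euclidean_space \<Rightarrow> 'b::real_normed_algebra"
  assumes "C1 f" "C1 g"
  shows "frechet_derivative (\<lambda>x. f x * g x) (at x) v =
     f x * frechet_derivative g (at x) v + frechet_derivative f (at x) v * g x"
  using frechet_derivative_at[OF has_derivative_mult[OF assms[THEN C1_has_derivative]], of x] by metis

lemma C1_add:
  assumes "C1 f" "C1 g"
  shows "C1 (\<lambda>x. f x + g x)"
proof (rule C1I)
  show "((\<lambda>x. f x + g x) has_derivative
      (\<lambda>v. frechet_derivative f (at x) v + frechet_derivative g (at x) v)) (at x)" for x
    by (rule has_derivative_add[OF assms[THEN C1_has_derivative]])
qed (intro continuous_intros C1_continuous_deriv[OF assms(1)] C1_continuous_deriv[OF assms(2)])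

lemma C1_const: "C1 (\<lambda>x. c)"
  by (rule C1I[of _ "\<lambda>_ _. 0"]) auto

lemma C1_sum:
  assumes "\<And>i. i \<in> I \<Longrightarrow> C1 (f i)"
  shows "C1 (\<lambda>x. \<Sum>i\<in>I. f i x)"
  using assms by (induction I rule: infinite_finite_induct) (auto intro: C1_const C1_add)

lemma C1_of_real:
  fixes f :: "'a::euclidean_space \<Rightarrow> real"
  assumes "C1 f"
  shows "C1 (\<lambda>x. of_real (f x) :: 'b::real_normed_algebra_1)"
proof (rule C1I)
  show "((\<lambda>x. of_real (f x) :: 'b) has_derivative (\<lambda>v. of_real (frechet_derivative f (at x) v))) (at x)" for x
    by (rule has_derivative_of_real[OF C1_has_derivative[OF assms]])
qed (intro continuous_intros C1_continuous_deriv[OF assms])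

lemma C1_compose_real:
  fixes f :: "'a::euclidean_space \<Rightarrow> real"
  assumes f: "C1 f" and h: "\<And>x. (h has_real_derivative h' (f x)) (at (f x))"
    and h': "continuous_on UNIV (\<lambda>x. h' (f x))"
  shows "C1 (\<lambda>x. h (f x))"
proof (rule C1I)
  show "((\<lambda>x. h (f x)) has_derivative (\<lambda>v. h' (f x) * frechet_derivative f (at x) v)) (at x)" for x
    by (rule has_derivative_compose[OF C1_has_derivative[OF f] h[unfolded has_field_derivative_def]])
qed (intro continuous_intros C1_continuous_deriv[OF f] h')

text \<open>The cut-off functions of the partition of unity are built from this function; one continuous
derivative is all that the divergence theorem asks for.\<close>
lemma has_real_derivative_max_0_square:
  "((\<lambda>t. (max 0 t)\<^sup>2) has_real_derivative 2 * max 0 t) (at (t::real))"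
proof -
  consider "t < 0" | "t = 0" | "t > 0" by linarith
  then show ?thesis
  proof cases
    case 1
    have "((\<lambda>_. 0) has_real_derivative 0) (at t)" by simp
    then have "((\<lambda>t. (max 0 t)\<^sup>2) has_real_derivative 0) (at t)"
      by (rule has_field_derivative_transform_within_open[of _ _ _ "{..<0}"]) (use 1 in auto)
    then show ?thesis using 1 by simp
  next
    case 3
    have "((\<lambda>t. t\<^sup>2) has_real_derivative 2 * t) (at t)" by (auto intro!: derivative_eq_intros)
    then have "((\<lambda>t. (max 0 t)\<^sup>2) has_real_derivative 2 * t) (at t)"
      by (rule has_field_derivative_transform_within_open[of _ _ _ "{0<..}"]) (use 3 in auto)
    then show ?thesis using 3 by simp
  next
    case 2
    have "((\<lambda>h. ((max 0 (0 + h))\<^sup>2 - (max 0 0)\<^sup>2) / h) \<longlongrightarrow> 0) (at (0::real))"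
    proof (rule tendsto_sandwich[of "\<lambda>h. - \<bar>h\<bar>" _ _ "\<lambda>h. \<bar>h\<bar>"])
      show "\<forall>\<^sub>F h in at (0::real). - \<bar>h\<bar> \<le> ((max 0 (0 + h))\<^sup>2 - (max 0 0)\<^sup>2) / h"
        by (rule always_eventually) (auto simp: max_def power2_eq_square)
      show "\<forall>\<^sub>F h in at (0::real). ((max 0 (0 + h))\<^sup>2 - (max 0 0)\<^sup>2) / h \<le> \<bar>h\<bar>"
        by (rule always_eventually) (auto simp: max_def power2_eq_square)
    qed (auto intro!: tendsto_eq_intros)
    then show ?thesis using 2 by (simp add: DERIV_def)
  qed
qed

lemma C1_max_0_square:
  fixes f :: "'a::euclidean_space \<Rightarrow> real"
  assumes "C1 f"
  shows "C1 (\<lambda>x. (max 0 (f x))\<^sup>2)"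
  by (rule C1_compose_real[OF assms has_real_derivative_max_0_square])
     (intro continuous_intros C1_continuous[OF assms])

lemma C1_quadratic: "C1 (\<lambda>x. s - (x - p) \<bullet> (x - p) :: real)" for p :: "'a::euclidean_space"
proof (rule C1I)
  show "((\<lambda>x. s - (x - p) \<bullet> (x - p)) has_derivative (\<lambda>v. - 2 * ((x - p) \<bullet> v))) (at x)" for x
    by (auto intro!: derivative_eq_intros simp: inner_commute fun_eq_iff)
qed (intro continuous_intros)

lemma C1_inverse:
  fixes f :: "'a::euclidean_space \<Rightarrow> real"
  assumes "C1 f" "\<And>x. f x \<noteq> 0"
  shows "C1 (\<lambda>x. inverse (f x))"
  by (rule C1_compose_real[OF assms(1) DERIV_inverse[OF assms(2)]])
     (intro continuous_intros C1_continuous[OF assms(1)], use assms(2) in auto)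

lemma integral_lebesgue_on_eq_lborel:
  fixes f :: "'a::euclidean_space \<Rightarrow> 'b::{banach, second_countable_topology}"
  assumes "S \<in> sets borel" "f \<in> borel_measurable borel"
  shows "(LINT x|lebesgue_on S. f x) = (LINT x|lborel. indicator S x *\<^sub>R f x)"
  using assms by (subst integral_restrict_space) (auto intro!: integral_completion)

lemma integrable_lebesgue_on_iff_lborel:
  fixes f :: "'a::euclidean_space \<Rightarrow> 'b::{banach, second_countable_topology}"
  assumes "S \<in> sets borel" "f \<in> borel_measurable borel"
  shows "integrable (lebesgue_on S) f \<longleftrightarrow> integrable lborel (\<lambda>x. indicator S x *\<^sub>R f x)"
  using assms by (subst integrable_restrict_space) (auto intro!: integrable_completion)

lemma integrable_lebesgue_on_continuous:
  fixes f :: "'a::euclidean_space \<Rightarrow> 'b::{banach, second_countable_topology}"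
  assumes "S \<in> sets borel" "bounded S" "continuous_on UNIV f"
  shows "integrable (lebesgue_on S) f"
proof -
  have fm: "f \<in> borel_measurable borel" using assms by (intro borel_measurable_continuous_onI)
  have "integrable lborel (\<lambda>x. indicator S x *\<^sub>R (indicator (closure S) x *\<^sub>R f x))"
    using assms by (intro integrable_mult_indicator borel_integrable_compact)
       (auto simp: compact_closure intro: continuous_on_subset)
  moreover have "indicator S x *\<^sub>R (indicator (closure S) x *\<^sub>R f x) = indicator S x *\<^sub>R f x" for x
    using closure_subset by (auto split: split_indicator)
  ultimately have "integrable lborel (\<lambda>x. indicator S x *\<^sub>R f x)" by (simp only:)
  then show ?thesis using assms fm by (simp add: integrable_lebesgue_on_iff_lborel)
qed

context
  fixes \<Omega> :: "(real^3) set" and \<sigma> :: "(real^3) measure"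
  assumes op: "open \<Omega>" and sm: "surface_measure \<Omega> \<sigma>"
    and bd: "bounded \<Omega>" and C2: "C2_boundary \<Omega>"
begin

lemma borel_measurable_surface_continuous:
  assumes "continuous_on (frontier \<Omega>) h"
  shows "h \<in> borel_measurable \<sigma>"
  using borel_measurable_continuous_on_restrict[OF assms] sm
  by (simp add: surface_measure_def cong: measurable_cong_sets)

lemma integrable_surface_continuous:
  fixes h :: "real^3 \<Rightarrow> 'b::{banach, second_countable_topology}"
  assumes h: "continuous_on (frontier \<Omega>) h"
  shows "integrable \<sigma> h"
proof -
  interpret finite_measure \<sigma> by (rule surface_finite_measure[OF op sm bd C2])
  have "compact (h ` frontier \<Omega>)"
    using compact_continuous_image[OF h compact_frontier_bounded[OF bd]] .
  then obtain B where "\<And>x. x \<in> frontier \<Omega> \<Longrightarrow> norm (h x) \<le> B"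
    using compact_imp_bounded bounded_iff by (metis imageI)
  then show ?thesis
    using borel_measurable_surface_continuous[OF h]
    by (intro integrable_const_bound[of _ B]) (auto simp: space_surface[OF op sm])
qed

text \<open>Partition of unity: finitely many balls cover the closure of the domain, each of them either inside
the domain or a chart ball. Functions supported in a ball of the first kind contribute zero on both
sides, for the second kind the local theorem applies. To have a C1 partition on the whole space, the
sum \<open>\<Psi>\<close> of the cut-offs is replaced by a positive function \<open>\<Psi>'\<close> that coincides with it near the
closure of the domain.\<close>
theorem divergence_theorem:
  fixes g :: "real^3 \<Rightarrow> complex"
  assumes \<nu>: "outward_unit_normal \<Omega> \<nu>" and g: "C1 g"
  shows "(LINT x|lebesgue_on \<Omega>. frechet_derivative g (at x) d) =
    (LINT x|\<sigma>. of_real (\<nu> x \<bullet> d) * g x)"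
proof -
  define good where "good p R \<longleftrightarrow> 0 < R \<and> (ball p R \<subseteq> \<Omega> \<or> (\<exists>a b e \<phi>. boundary_chart \<Omega> p R a b e \<phi>))" for p R
  have "\<exists>R. good p R" if "p \<in> closure \<Omega>" for p
  proof (cases "p \<in> \<Omega>")
    case True
    then show ?thesis using op unfolding good_def open_contains_ball by blast
  next
    case False
    then have "p \<in> frontier \<Omega>" using that op by (simp add: frontier_def interior_open)
    then obtain r a b e \<phi> where ch: "boundary_chart \<Omega> p r a b e \<phi>"
      using C2 unfolding C2_boundary_def by metis
    then show ?thesis unfolding good_def using boundary_chartD(1)[OF ch] by metis
  qed
  then obtain R where R: "\<And>p. p \<in> closure \<Omega> \<Longrightarrow> good p (R p)" by metis
  have Rpos: "R p > 0" if "p \<in> closure \<Omega>" for p using R[OF that] by (simp add: good_def)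
  have comp: "compact (closure \<Omega>)" using bd by (simp add: compact_closure)
  obtain C where C: "C \<subseteq> closure \<Omega>" "finite C" "closure \<Omega> \<subseteq> (\<Union>p\<in>C. ball p (R p / 2))"
    by (rule compactE_image[OF comp, of "closure \<Omega>" "\<lambda>p. ball p (R p / 2)"]) (use Rpos in auto)
  define \<psi> where "\<psi> p x = (max 0 ((R p / 2)\<^sup>2 - (x - p) \<bullet> (x - p)))\<^sup>2" for p x
  define \<Psi> where "\<Psi> x = (\<Sum>p\<in>C. \<psi> p x)" for x
  have \<psi>C1: "C1 (\<psi> p)" for p unfolding \<psi>_def by (intro C1_max_0_square C1_quadratic)
  have \<Psi>C1: "C1 \<Psi>" unfolding \<Psi>_def by (intro C1_sum \<psi>C1)
  have \<psi>0: "\<psi> p x = 0" if "x \<notin> cball p (R p / 2)" "p \<in> C" for p x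
  proof -
    have "R p / 2 < norm (x - p)" using that by (simp add: dist_norm norm_minus_commute)
    moreover have "0 < R p" using that C Rpos by auto
    ultimately have "(R p / 2)\<^sup>2 < (norm (x - p))\<^sup>2" by (intro power_strict_mono) auto
    then show ?thesis by (simp add: \<psi>_def dot_square_norm)
  qed
  have \<psi>pos: "\<psi> p x > 0" if "x \<in> ball p (R p / 2)" for p x
  proof -
    have "norm (x - p) < R p / 2" using that by (simp add: dist_norm norm_minus_commute)
    then have "(norm (x - p))\<^sup>2 < (R p / 2)\<^sup>2" by (intro power_strict_mono) auto
    then show ?thesis by (simp add: \<psi>_def dot_square_norm)
  qed
  have \<psi>ge: "\<psi> p x \<ge> 0" for p x by (simp add: \<psi>_def)
  have \<Psi>ge: "\<Psi> x \<ge> 0" for x by (simp add: \<Psi>_def \<psi>ge sum_nonneg)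
  have \<Psi>pos: "\<Psi> x > 0" if "x \<in> closure \<Omega>" for x
  proof -
    have "x \<in> (\<Union>p\<in>C. ball p (R p / 2))" using C(3) that by (rule subsetD)
    then obtain p where "p \<in> C" "x \<in> ball p (R p / 2)" by (rule UN_E)
    then show ?thesis
      unfolding \<Psi>_def using C(2) \<psi>ge \<psi>pos by (intro sum_pos2[of _ p]) auto
  qed
  obtain m where m: "m > 0" "\<And>x. x \<in> closure \<Omega> \<Longrightarrow> m \<le> \<Psi> x"
  proof (cases "closure \<Omega> = {}")
    case True
    then show ?thesis using that[of 1] by auto
  next
    case False
    obtain x where "x \<in> closure \<Omega>" "\<And>y. y \<in> closure \<Omega> \<Longrightarrow> \<Psi> x \<le> \<Psi> y"
      using continuous_attains_inf[OF comp False C1_continuous[OF \<Psi>C1]] by blast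
    then show ?thesis using that[of "\<Psi> x"] \<Psi>pos by blast
  qed
  \<comment> \<open>m / 2, half the minimum on the closure, leaves a neighbourhood where the correction vanishes\<close>
  define \<Psi>' where "\<Psi>' x = \<Psi> x + (max 0 (m / 2 + (- 1) * \<Psi> x))\<^sup>2" for x
  have \<Psi>'pos: "\<Psi>' x > 0" for x
  proof (cases "\<Psi> x = 0")
    case True
    then show ?thesis using m by (simp add: \<Psi>'_def)
  next
    case False
    then show ?thesis using \<Psi>ge[of x] by (simp add: \<Psi>'_def add_pos_nonneg)
  qed
  have \<Psi>'C1: "C1 \<Psi>'"
    unfolding \<Psi>'_def by (intro C1_add C1_max_0_square C1_mult C1_const \<Psi>C1)
  define w where "w x = g x * of_real (inverse (\<Psi>' x))" for x
  have wC1: "C1 w" unfolding w_def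
    by (intro C1_mult g C1_of_real C1_inverse \<Psi>'C1) (use \<Psi>'pos less_irrefl in metis)
  define G where "G p x = w x * of_real (\<psi> p x)" for p x
  have GC1: "C1 (G p)" for p unfolding G_def by (intro C1_mult wC1 C1_of_real \<psi>C1)
  have G0: "G p x = 0" if "x \<notin> cball p (R p / 2)" "p \<in> C" for p x
    using \<psi>0[OF that] by (simp add: G_def)
  have G'0: "frechet_derivative (G p) (at x) d = 0" if "x \<notin> cball p (R p / 2)" "p \<in> C" for p x
    using that GC1[of p] G0
    by (intro frechet_derivative_eq_0_outside[of "cball p (R p / 2)"]) (auto simp: C1_def)
  have near: "(\<Sum>p\<in>C. G p x) = g x" if "m / 2 < \<Psi> x" for x
  proof -
    have "\<Psi>' x = \<Psi> x" using that by (simp add: \<Psi>'_def)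
    then have "(\<Sum>p\<in>C. G p x) = w x * of_real (\<Psi>' x)"
      by (simp add: G_def \<Psi>_def sum_distrib_left)
    then show ?thesis using \<Psi>'pos[of x] by (simp add: w_def)
  qed
  have loc: "(LINT x|lborel. indicator \<Omega> x *\<^sub>R frechet_derivative (G p) (at x) d) =
      (LINT x|\<sigma>. of_real (\<nu> x \<bullet> d) * G p x)" if p: "p \<in> C" for p
  proof -
    have pc: "p \<in> closure \<Omega>" using p C by auto
    consider "ball p (R p) \<subseteq> \<Omega>" | a b e \<phi> where "boundary_chart \<Omega> p (R p) a b e \<phi>"
      using R[OF pc] by (auto simp: good_def)
    then show ?thesis
    proof cases
      case 1
      have sub: "cball p (R p / 2) \<subseteq> \<Omega>" using 1 Rpos[OF pc] by (intro subset_trans[OF _ 1]) auto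
      have "(LINT x|lborel. indicator \<Omega> x *\<^sub>R frechet_derivative (G p) (at x) d) =
        (LINT x|lborel. frechet_derivative (G p) (at x) d)"
      proof (intro Bochner_Integration.integral_cong refl)
        fix x
        show "indicator \<Omega> x *\<^sub>R frechet_derivative (G p) (at x) d = frechet_derivative (G p) (at x) d"
        proof (cases "x \<in> \<Omega>")
          case False
          then have "x \<notin> cball p (R p / 2)" using sub by blast
          from G'0[OF this p] show ?thesis by simp
        qed simp
      qed
      also have "\<dots> = 0"
        by (rule integral_directional_derivative_eq_0[OF C1_has_derivative[OF GC1] C1_continuous_deriv[OF GC1]
              compact_cball G0[OF _ p]])
      also have "0 = (LINT x|\<sigma>. of_real (\<nu> x \<bullet> d) * G p x)"
      proof -
        have "G p x = 0" if "x \<in> frontier \<Omega>" for x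
        proof (rule G0[OF _ p])
          show "x \<notin> cball p (R p / 2)" using that sub op by (auto simp: frontier_def interior_open)
        qed
        then have "(LINT x|\<sigma>. of_real (\<nu> x \<bullet> d) * G p x) = (LINT x|\<sigma>. 0)"
          by (intro Bochner_Integration.integral_cong refl) (simp add: space_surface[OF op sm])
        then show ?thesis by simp
      qed
      finally show ?thesis .
    next
      case 2
      show ?thesis
        using G0[OF _ p] Rpos[OF pc]
        by (intro local_divergence_theorem[OF op sm \<nu> C2 2 _ GC1, of "R p / 2"]) auto
    qed
  qed
  have omb: "\<Omega> \<in> sets borel" using op by simp
  have deriv: "frechet_derivative g (at x) d = (\<Sum>p\<in>C. frechet_derivative (G p) (at x) d)" if "x \<in> \<Omega>" for x
  proof -
    have "((\<lambda>x. \<Sum>p\<in>C. G p x) has_derivative (\<lambda>v. \<Sum>p\<in>C. frechet_derivative (G p) (at x) v)) (at x)"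
      by (intro has_derivative_sum C1_has_derivative GC1)
    then have "(g has_derivative (\<lambda>v. \<Sum>p\<in>C. frechet_derivative (G p) (at x) v)) (at x)"
    proof (rule has_derivative_transform_within_open)
      show "open {x. m / 2 < \<Psi> x}"
        by (intro open_Collect_less continuous_intros C1_continuous \<Psi>C1)
      show "x \<in> {x. m / 2 < \<Psi> x}"
        using m(1) m(2)[of x] that closure_subset by fastforce
    qed (use near in auto)
    from fun_cong[OF frechet_derivative_at[OF this], of d] show ?thesis by (rule sym)
  qed
  have intG: "integrable lborel (\<lambda>x. indicator \<Omega> x *\<^sub>R frechet_derivative (G p) (at x) d)" if "p \<in> C" for p
  proof (rule integrable_mult_indicator)
    show "integrable lborel (\<lambda>x. frechet_derivative (G p) (at x) d)"
      by (rule integrable_continuous_compact_support[OF C1_continuous_deriv[OF GC1] compact_cball G'0[OF _ that]])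
  qed (use omb in simp)
  have intS: "integrable \<sigma> (\<lambda>x. of_real (\<nu> x \<bullet> d) * G p x)" for p
    by (intro integrable_surface_continuous continuous_intros continuous_on_normal[OF op sm C2 \<nu>] C1_continuous[OF GC1])
  have "(LINT x|lebesgue_on \<Omega>. frechet_derivative g (at x) d) =
      (LINT x|lborel. indicator \<Omega> x *\<^sub>R frechet_derivative g (at x) d)"
    by (intro integral_lebesgue_on_eq_lborel omb borel_measurable_continuous_onI C1_continuous_deriv g)
  also have "\<dots> = (LINT x|lborel. (\<Sum>p\<in>C. indicator \<Omega> x *\<^sub>R frechet_derivative (G p) (at x) d))"
    by (intro Bochner_Integration.integral_cong refl) (auto split: split_indicator simp: deriv)
  also have "\<dots> = (\<Sum>p\<in>C. (LINT x|lborel. indicator \<Omega> x *\<^sub>R frechet_derivative (G p) (at x) d))"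
    by (rule Bochner_Integration.integral_sum) (rule intG)
  also have "\<dots> = (\<Sum>p\<in>C. (LINT x|\<sigma>. of_real (\<nu> x \<bullet> d) * G p x))"
    by (intro sum.cong refl loc)
  also have "\<dots> = (LINT x|\<sigma>. (\<Sum>p\<in>C. of_real (\<nu> x \<bullet> d) * G p x))"
    by (rule Bochner_Integration.integral_sum[symmetric]) (rule intS)
  also have "\<dots> = (LINT x|\<sigma>. of_real (\<nu> x \<bullet> d) * g x)"
  proof (intro Bochner_Integration.integral_cong refl)
    fix x assume "x \<in> space \<sigma>"
    then have "x \<in> closure \<Omega>" by (simp add: space_surface[OF op sm] frontier_def)
    then have "m / 2 < \<Psi> x" using m(1) m(2)[of x] by simp
    from near[OF this] show "(\<Sum>p\<in>C. of_real (\<nu> x \<bullet> d) * G p x) = of_real (\<nu> x \<bullet> d) * g x"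
      by (simp add: sum_distrib_left[symmetric])
  qed
  finally show ?thesis .
qed

end

section \<open>From Cauchy data to volume integrals\<close>

lemma L2_measurable: "L2 M f \<Longrightarrow> f \<in> borel_measurable M"
  by (simp add: L2_def)

lemma L2_mult_integrable:
  fixes f g :: "'a \<Rightarrow> complex"
  assumes "L2 M f" "L2 M g"
  shows "integrable M (\<lambda>x. f x * g x)"
proof (rule Bochner_Integration.integrable_bound)
  show "integrable M (\<lambda>x. (norm (f x))\<^sup>2 + (norm (g x))\<^sup>2)"
    using assms by (simp add: L2_def)
  show "(\<lambda>x. f x * g x) \<in> borel_measurable M"
    using assms by (intro borel_measurable_times L2_measurable)
  show "AE x in M. norm (f x * g x) \<le> norm ((norm (f x))\<^sup>2 + (norm (g x))\<^sup>2)"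
  proof (rule AE_I2)
    fix x
    have "norm (f x) * norm (g x) \<le> (norm (f x))\<^sup>2 + (norm (g x))\<^sup>2"
      using sum_squares_bound[of "norm (f x)" "norm (g x)"]
        mult_nonneg_nonneg[OF norm_ge_zero[of "f x"] norm_ge_zero[of "g x"]] by linarith
    then show "norm (f x * g x) \<le> norm ((norm (f x))\<^sup>2 + (norm (g x))\<^sup>2)"
      by (simp add: norm_mult)
  qed
qed

lemma L2_diff:
  fixes f g :: "'a \<Rightarrow> 'b::euclidean_space"
  assumes "L2 M f" "L2 M g"
  shows "L2 M (\<lambda>x. f x - g x)"
  unfolding L2_def
proof
  show m: "(\<lambda>x. f x - g x) \<in> borel_measurable M"
    using assms by (intro borel_measurable_diff L2_measurable)
  show "integrable M (\<lambda>x. (norm (f x - g x))\<^sup>2)"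
  proof (rule Bochner_Integration.integrable_bound)
    show "integrable M (\<lambda>x. 2 * (norm (f x))\<^sup>2 + 2 * (norm (g x))\<^sup>2)"
      using assms by (simp add: L2_def)
    show "(\<lambda>x. (norm (f x - g x))\<^sup>2) \<in> borel_measurable M" using m by measurable
    show "AE x in M. norm ((norm (f x - g x))\<^sup>2) \<le> norm (2 * (norm (f x))\<^sup>2 + 2 * (norm (g x))\<^sup>2)"
    proof (rule AE_I2)
      fix x
      have "(norm (f x - g x))\<^sup>2 \<le> (norm (f x) + norm (g x))\<^sup>2"
        by (intro power_mono norm_triangle_ineq4) auto
      also have "\<dots> \<le> 2 * (norm (f x))\<^sup>2 + 2 * (norm (g x))\<^sup>2"
        using sum_squares_bound[of "norm (f x)" "norm (g x)"] by (simp add: power2_sum)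
      finally show "norm ((norm (f x - g x))\<^sup>2) \<le> norm (2 * (norm (f x))\<^sup>2 + 2 * (norm (g x))\<^sup>2)"
        by simp
    qed
  qed
qed

lemma L2_nth:
  fixes F :: "'a \<Rightarrow> complex^3"
  assumes "L2 M F"
  shows "L2 M (\<lambda>x. F x $ i)"
  unfolding L2_def
proof
  have "(\<lambda>v::complex^3. v $ i) \<in> borel_measurable borel"
    by (intro borel_measurable_continuous_onI continuous_intros)
  then show m: "(\<lambda>x. F x $ i) \<in> borel_measurable M"
    by (rule measurable_compose[OF L2_measurable[OF assms]])
  show "integrable M (\<lambda>x. (norm (F x $ i))\<^sup>2)"
  proof (rule Bochner_Integration.integrable_bound)
    show "integrable M (\<lambda>x. (norm (F x))\<^sup>2)" using assms by (simp add: L2_def)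
    show "(\<lambda>x. (norm (F x $ i))\<^sup>2) \<in> borel_measurable M" using m by measurable
    show "AE x in M. norm ((norm (F x $ i))\<^sup>2) \<le> norm ((norm (F x))\<^sup>2)"
      by (intro AE_I2) (simp add: Finite_Cartesian_Product.norm_nth_le power_mono)
  qed
qed

text \<open>Convergence in L2 implies weak convergence.\<close>
lemma tendsto_integral_mult_L2:
  fixes f h :: "'a \<Rightarrow> complex"
  assumes h: "L2 M h" and fn: "\<And>n. L2 M (fn n)" and f: "L2 M f"
    and lim: "(\<lambda>n. LINT x|M. (norm (fn n x - f x))\<^sup>2) \<longlonglongrightarrow> 0"
  shows "(\<lambda>n. LINT x|M. h x * fn n x) \<longlonglongrightarrow> (LINT x|M. h x * f x)"
proof -
  define c where "c = (LINT x|M. (norm (h x))\<^sup>2)"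
  define a where "a n = (LINT x|M. (norm (fn n x - f x))\<^sup>2)" for n
  have c: "c \<ge> 0" unfolding c_def by simp
  \<comment> \<open>Cauchy--Schwarz, in the additive form that needs no square roots\<close>
  have bound: "norm ((LINT x|M. h x * fn n x) - (LINT x|M. h x * f x)) \<le> \<delta> * c + a n / \<delta>"
    if \<delta>: "\<delta> > 0" for n \<delta>
  proof -
    note df = L2_diff[OF fn[of n] f]
    have "(LINT x|M. h x * fn n x) - (LINT x|M. h x * f x) = (LINT x|M. h x * (fn n x - f x))"
      using L2_mult_integrable[OF h fn] L2_mult_integrable[OF h f] by (simp add: right_diff_distrib)
    also have "norm \<dots> \<le> (LINT x|M. norm (h x * (fn n x - f x)))"
      by (rule integral_norm_bound)
    also have "\<dots> \<le> (LINT x|M. \<delta> * (norm (h x))\<^sup>2 + (norm (fn n x - f x))\<^sup>2 / \<delta>)"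
    proof (rule integral_mono)
      show "integrable M (\<lambda>x. norm (h x * (fn n x - f x)))"
        using L2_mult_integrable[OF h df] by simp
      show "integrable M (\<lambda>x. \<delta> * (norm (h x))\<^sup>2 + (norm (fn n x - f x))\<^sup>2 / \<delta>)"
        using h df by (simp add: L2_def)
      fix x
      let ?p = "norm (h x)" and ?q = "norm (fn n x - f x)"
      have "2 * (\<delta> * ?p) * ?q \<le> (\<delta> * ?p)\<^sup>2 + ?q\<^sup>2" by (rule sum_squares_bound)
      moreover have "0 \<le> (\<delta> * ?p) * ?q" using \<delta> by simp
      ultimately have "(\<delta> * ?p) * ?q \<le> (\<delta> * ?p)\<^sup>2 + ?q\<^sup>2" by linarith
      moreover have "(\<delta> * ?p) * ?q = \<delta> * (?p * ?q)" by simp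
      moreover have "(\<delta> * ?p)\<^sup>2 + ?q\<^sup>2 = \<delta> * (\<delta> * ?p\<^sup>2 + ?q\<^sup>2 / \<delta>)"
        using \<delta> by (simp add: power_mult_distrib distrib_left power2_eq_square)
      ultimately have "\<delta> * (?p * ?q) \<le> \<delta> * (\<delta> * ?p\<^sup>2 + ?q\<^sup>2 / \<delta>)" by simp
      then show "norm (h x * (fn n x - f x)) \<le> \<delta> * ?p\<^sup>2 + ?q\<^sup>2 / \<delta>"
        using \<delta> by (simp add: norm_mult)
    qed
    also have "\<dots> = \<delta> * c + a n / \<delta>"
      using h df by (simp add: L2_def c_def a_def)
    finally show ?thesis .
  qed
  have "(\<lambda>n. (LINT x|M. h x * fn n x) - (LINT x|M. h x * f x)) \<longlonglongrightarrow> 0"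
  proof (rule LIMSEQ_I)
    fix e :: real assume e: "e > 0"
    define \<delta> where "\<delta> = e / (2 * (c + 1))"
    have \<delta>: "\<delta> > 0" using e c by (simp add: \<delta>_def)
    have dc: "\<delta> * c < e / 2" using e c by (simp add: \<delta>_def field_simps)
    have "\<exists>N. \<forall>n\<ge>N. norm (a n - 0) < \<delta> * (e / 2)"
      using lim \<delta> e unfolding a_def by (intro LIMSEQ_D) auto
    then obtain N where N: "\<And>n. n \<ge> N \<Longrightarrow> \<bar>a n\<bar> < \<delta> * (e / 2)" by auto
    have "norm ((LINT x|M. h x * fn n x) - (LINT x|M. h x * f x) - 0) < e" if "n \<ge> N" for n
    proof -
      have "a n / \<delta> < e / 2" using N[OF that] \<delta> by (simp add: field_simps)
      then have "\<delta> * c + a n / \<delta> < e" using dc by linarith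
      from le_less_trans[OF bound[OF \<delta>] this] show ?thesis by simp
    qed
    then show "\<exists>N. \<forall>n\<ge>N. norm ((LINT x|M. h x * fn n x) - (LINT x|M. h x * f x) - 0) < e" by blast
  qed
  then show ?thesis by (rule LIM_zero_cancel)
qed

lemma borel_measurable_lebesgue_on:
  "f \<in> borel_measurable borel \<Longrightarrow> f \<in> borel_measurable (lebesgue_on S)"
  by (intro measurable_restrict_space1 measurable_completion) simp

lemma L2_lebesgue_on_continuous:
  fixes f :: "'a::euclidean_space \<Rightarrow> 'b::euclidean_space"
  assumes "S \<in> sets borel" "bounded S" "continuous_on UNIV f"
  shows "L2 (lebesgue_on S) f"
  unfolding L2_def using assms
  by (intro conjI borel_measurable_lebesgue_on borel_measurable_continuous_onI
       integrable_lebesgue_on_continuous continuous_intros)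

lemma continuous_on_grad: "C1 f \<Longrightarrow> continuous_on S (grad f)"
  unfolding grad_def by (intro continuous_intros C1_continuous_deriv)

text \<open>A test function times \<open>V\<close> has compact support in \<open>\<Omega>\<close>, so its derivatives integrate to zero.\<close>
lemma H1_C1:
  assumes "open \<Omega>" "bounded \<Omega>" and V: "C1 V"
  shows "H1 \<Omega> V (grad V)"
  unfolding H1_def
proof (intro conjI allI impI)
  have \<Omega>: "\<Omega> \<in> sets borel" using assms by simp
  show "L2 (lebesgue_on \<Omega>) V" "L2 (lebesgue_on \<Omega>) (grad V)"
    using assms by (auto intro!: L2_lebesgue_on_continuous \<Omega> C1_continuous continuous_on_grad)
  fix \<phi> i assume \<phi>: "test_function \<Omega> \<phi>"
  then obtain K where K: "compact K" "K \<subseteq> \<Omega>" "\<And>x. x \<notin> K \<Longrightarrow> \<phi> x = 0"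
    by (auto simp: test_function_def)
  have \<phi>C: "C1 \<phi>" using \<phi> by (auto simp: test_function_def smooth_imp_C1)
  let ?g = "\<lambda>x. V x * \<phi> x"
  have gC: "C1 ?g" by (intro C1_mult V \<phi>C)
  have g0: "?g x = 0" if "x \<notin> K" for x using K(3)[OF that] by simp
  have g'0: "frechet_derivative ?g (at x) (axis i 1) = 0" if "x \<notin> K" for x
    using gC K(1) that g0 by (intro frechet_derivative_eq_0_outside[of K]) (auto simp: C1_def compact_imp_closed)
  have "0 = (LINT x|lborel. frechet_derivative ?g (at x) (axis i 1))"
    by (rule integral_directional_derivative_eq_0[OF C1_has_derivative[OF gC] C1_continuous_deriv[OF gC] K(1) g0, symmetric])
  also have "\<dots> = (LINT x|lborel. indicator \<Omega> x *\<^sub>R frechet_derivative ?g (at x) (axis i 1))"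
  proof (intro Bochner_Integration.integral_cong refl)
    fix x
    show "frechet_derivative ?g (at x) (axis i 1) = indicator \<Omega> x *\<^sub>R frechet_derivative ?g (at x) (axis i 1)"
      using g'0[of x] K(2) by (cases "x \<in> \<Omega>") auto
  qed
  also have "\<dots> = (LINT x|lebesgue_on \<Omega>. frechet_derivative ?g (at x) (axis i 1))"
    by (intro integral_lebesgue_on_eq_lborel[symmetric] \<Omega> borel_measurable_continuous_onI C1_continuous_deriv gC)
  also have "\<dots> = (LINT x|lebesgue_on \<Omega>. V x * grad \<phi> x $ i + grad V x $ i * \<phi> x)"
    by (simp add: frechet_derivative_mult_C1[OF V \<phi>C] grad_def)
  also have "\<dots> = (LINT x|lebesgue_on \<Omega>. V x * grad \<phi> x $ i) + (LINT x|lebesgue_on \<Omega>. grad V x $ i * \<phi> x)"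
    by (intro Bochner_Integration.integral_add integrable_lebesgue_on_continuous \<Omega> assms
        continuous_intros C1_continuous V \<phi>C continuous_on_grad)
  finally show "(LINT x|lebesgue_on \<Omega>. V x * grad \<phi> x $ i) = - (LINT x|lebesgue_on \<Omega>. grad V x $ i * \<phi> x)"
    by (simp add: eq_neg_iff_add_eq_0)
qed

text \<open>A class that contains both \<open>v\<close> and its derivative with respect to \<open>\<tau>\<close>, and that is closed under
directional derivatives; smoothness is then a trivial induction.\<close>
definition affine_exp :: "complex \<Rightarrow> complex^3 \<Rightarrow> complex^3 \<Rightarrow> real^3 \<Rightarrow> complex" where
  "affine_exp A B z x = (A + cdot B (cvec x)) * exp (cdot z (cvec x))"

lemma has_derivative_cdot_cvec:
  "((\<lambda>x. cdot z (cvec x)) has_derivative (\<lambda>v. cdot z (cvec v))) (at x within S)"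
  by (intro linear_imp_has_derivative linearI)
     (simp_all add: cdot_def cvec_def sum_3 algebra_simps scaleR_conv_of_real[where 'a = complex])

lemma affine_exp_has_derivative:
  "(affine_exp A B z has_derivative
     (\<lambda>v. affine_exp (cdot B (cvec v) + A * cdot z (cvec v)) (cdot z (cvec v) *s B) z x)) (at x)"
proof -
  have "cdot (c *s B) w = c * cdot B w" for c w
    by (simp add: cdot_def sum_distrib_left mult_ac)
  then have "affine_exp (cdot B (cvec v) + A * cdot z (cvec v)) (cdot z (cvec v) *s B) z x =
     (A + cdot B (cvec x)) * (exp (cdot z (cvec x)) * cdot z (cvec v)) + cdot B (cvec v) * exp (cdot z (cvec x))" for v
    by (simp add: affine_exp_def algebra_simps)
  moreover have "((\<lambda>x. exp (cdot z (cvec x))) has_derivative (\<lambda>v. exp (cdot z (cvec x)) * cdot z (cvec v))) (at x)"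
    by (rule has_derivative_compose[OF has_derivative_cdot_cvec]) (use DERIV_exp in \<open>simp add: has_field_derivative_def\<close>)
  ultimately show ?thesis
    unfolding affine_exp_def[abs_def]
    by (auto intro!: has_derivative_cdot_cvec derivative_eq_intros simp: affine_exp_def fun_eq_iff)
qed

lemma frechet_derivative_affine_exp:
  "frechet_derivative (affine_exp A B z) (at x) v =
     affine_exp (cdot B (cvec v) + A * cdot z (cvec v)) (cdot z (cvec v) *s B) z x"
  using fun_cong[OF frechet_derivative_at[OF affine_exp_has_derivative[where A = A and B = B and z = z and x = x]], of v] by simp

lemma smooth_affine_exp: "smooth (affine_exp A B z)"
proof -
  have "Ck n (affine_exp A B z)" for n
  proof (induction n arbitrary: A B)
    case 0
    show ?case
      using has_derivative_continuous[OF affine_exp_has_derivative]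
      by (auto intro!: continuous_at_imp_continuous_on)
  next
    case (Suc n)
    have "affine_exp A B z differentiable (at x)" for x
      using affine_exp_has_derivative differentiable_def by blast
    then show ?case
      unfolding Ck.simps frechet_derivative_affine_exp by (intro conjI allI ballI Suc.IH)
  qed
  then show ?thesis by (simp add: smooth_def)
qed

lemma frechet_derivative_eq_grad:
  assumes "f differentiable (at x)"
  shows "frechet_derivative f (at x) v = (\<Sum>i\<in>UNIV. of_real (v $ i) * grad f x $ i)"
proof -
  have lin: "linear (frechet_derivative f (at x))" using assms by (rule linear_frechet_derivative)
  have "v = (\<Sum>i\<in>UNIV. v $ i *\<^sub>R axis i 1)"
    by (simp add: vec_eq_iff axis_def if_distrib cong: if_cong)
  then have "frechet_derivative f (at x) v = frechet_derivative f (at x) (\<Sum>i\<in>UNIV. v $ i *\<^sub>R axis i 1)"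
    by (rule arg_cong)
  also have "\<dots> = (\<Sum>i\<in>UNIV. of_real (v $ i) * grad f x $ i)"
    by (simp only: linear_sum[OF lin] linear_scale[OF lin]) (simp add: grad_def scaleR_conv_of_real)
  finally show ?thesis .
qed

text \<open>The Laplacian is \<open>2 B\<cdot>z e\<^bsup>z\<cdot>x\<^esup> + (z\<cdot>z)(A + B\<cdot>x) e\<^bsup>z\<cdot>x\<^esup>\<close>.\<close>
lemma affine_exp_laplacian:
  assumes "cdot B z = 0"
  shows "(\<Sum>i\<in>UNIV. frechet_derivative (\<lambda>x. grad (affine_exp A B z) x $ i) (at x) (axis i 1))
     = cdot z z * affine_exp A B z x"
proof -
  have ax: "cdot w (cvec (axis i 1)) = w $ i" for w i
    by (simp add: cdot_def cvec_def axis_def if_distrib cong: if_cong)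
  have g: "(\<lambda>x. grad (affine_exp A B z) x $ i) = affine_exp (B $ i + A * z $ i) (z $ i *s B) z" for i
    by (simp add: grad_def frechet_derivative_affine_exp ax)
  have c: "cdot (c *s B) w = c * cdot B w" for c w
    by (simp add: cdot_def sum_distrib_left mult_ac)
  have Bz: "B $ 1 * z $ 1 + B $ 2 * z $ 2 + B $ 3 * z $ 3 = 0"
    using assms by (simp add: cdot_def sum_3)
  have "(\<Sum>i\<in>UNIV. frechet_derivative (\<lambda>x. grad (affine_exp A B z) x $ i) (at x) (axis i 1)) =
     (\<Sum>i\<in>UNIV. (2 * (B $ i * z $ i) + (z $ i * z $ i) * (A + cdot B (cvec x))) * exp (cdot z (cvec x)))"
    unfolding g frechet_derivative_affine_exp ax
    by (intro sum.cong refl) (simp add: affine_exp_def c algebra_simps)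
  also have "\<dots> = (2 * (\<Sum>i\<in>UNIV. B $ i * z $ i) + cdot z z * (A + cdot B (cvec x))) * exp (cdot z (cvec x))"
    by (simp add: cdot_def sum_distrib_left sum_distrib_right sum.distrib distrib_right)
  also have "\<dots> = cdot z z * affine_exp A B z x"
    using Bz by (simp add: sum_3 affine_exp_def)
  finally show ?thesis .
qed

context
  fixes \<Omega> :: "(real^3) set" and \<sigma> :: "(real^3) measure" and \<nu> :: "real^3 \<Rightarrow> real^3"
  assumes op: "open \<Omega>" and sm: "surface_measure \<Omega> \<sigma>"
    and bd: "bounded \<Omega>" and C2: "C2_boundary \<Omega>" and \<nu>: "outward_unit_normal \<Omega> \<nu>"
begin

text \<open>The divergence theorem for the vector field \<open>w \<nabla>V\<close>, one component at a time.\<close>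
lemma Green_identity_C1:
  assumes w: "C1 w" and V: "C1 V" "\<And>i. C1 (\<lambda>x. grad V x $ i)"
  shows "(LINT x|\<sigma>. frechet_derivative V (at x) (\<nu> x) * w x) =
    (LINT x|lebesgue_on \<Omega>. cdot (grad w x) (grad V x) +
       (\<Sum>i\<in>UNIV. frechet_derivative (\<lambda>x. grad V x $ i) (at x) (axis i 1)) * w x)"
proof -
  have omb: "\<Omega> \<in> sets borel" using op by simp
  have C: "C1 (\<lambda>x. w x * grad V x $ i)" for i by (intro C1_mult w V)
  have "(LINT x|\<sigma>. frechet_derivative V (at x) (\<nu> x) * w x) =
     (LINT x|\<sigma>. (\<Sum>i\<in>UNIV. of_real (\<nu> x \<bullet> axis i 1) * (w x * grad V x $ i)))"
    using V(1) by (intro Bochner_Integration.integral_cong refl)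
      (simp add: frechet_derivative_eq_grad C1_def inner_axis sum_distrib_left mult_ac)
  also have "\<dots> = (\<Sum>i\<in>UNIV. (LINT x|\<sigma>. of_real (\<nu> x \<bullet> axis i 1) * (w x * grad V x $ i)))"
    by (intro Bochner_Integration.integral_sum integrable_surface_continuous[OF op sm bd C2] continuous_intros
        continuous_on_normal[OF op sm C2 \<nu>] C1_continuous[OF w] C1_continuous[OF V(2)])
  also have "\<dots> = (\<Sum>i\<in>UNIV. (LINT x|lebesgue_on \<Omega>. frechet_derivative (\<lambda>x. w x * grad V x $ i) (at x) (axis i 1)))"
    by (intro sum.cong refl divergence_theorem[OF op sm bd C2 \<nu> C, symmetric])
  also have "\<dots> = (LINT x|lebesgue_on \<Omega>. (\<Sum>i\<in>UNIV. frechet_derivative (\<lambda>x. w x * grad V x $ i) (at x) (axis i 1)))"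
    by (intro Bochner_Integration.integral_sum[symmetric] integrable_lebesgue_on_continuous omb bd
        C1_continuous_deriv C)
  also have "\<dots> = (LINT x|lebesgue_on \<Omega>. cdot (grad w x) (grad V x) +
       (\<Sum>i\<in>UNIV. frechet_derivative (\<lambda>x. grad V x $ i) (at x) (axis i 1)) * w x)"
    by (intro Bochner_Integration.integral_cong refl)
       (simp add: frechet_derivative_mult_C1[OF w V(2)] cdot_def sum.distrib sum_distrib_left
          grad_def[of w] mult_ac add_ac)
  finally show ?thesis .
qed

text \<open>The smooth functions that define the trace satisfy the identity, and all three terms are continuous
under the convergence that the definition of the trace provides.\<close>
lemma Green_identity_trace:
  assumes u: "L2 (lebesgue_on \<Omega>) u" "L2 (lebesgue_on \<Omega>) Du" and tr: "trace_of \<Omega> \<sigma> u Du f"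
    and V: "C1 V" "\<And>i. C1 (\<lambda>x. grad V x $ i)"
    and lap: "\<And>x. (\<Sum>i\<in>UNIV. frechet_derivative (\<lambda>x. grad V x $ i) (at x) (axis i 1)) = c * V x"
  shows "(LINT x|\<sigma>. frechet_derivative V (at x) (\<nu> x) * f x) =
    (LINT x|lebesgue_on \<Omega>. cdot (Du x) (grad V x) + c * V x * u x)"
proof -
  have omb: "\<Omega> \<in> sets borel" using op by simp
  interpret \<sigma>: finite_measure \<sigma> by (rule surface_finite_measure[OF op sm bd C2])
  obtain w where w: "\<And>n. smooth (w n)"
    and lim: "(\<lambda>n. LINT x|lebesgue_on \<Omega>. (norm (w n x - u x))\<^sup>2) \<longlonglongrightarrow> 0"
      "(\<lambda>n. LINT x|lebesgue_on \<Omega>. (norm (grad (w n) x - Du x))\<^sup>2) \<longlonglongrightarrow> 0"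
      "(\<lambda>n. LINT x|\<sigma>. (norm (w n x - f x))\<^sup>2) \<longlonglongrightarrow> 0" and f: "L2 \<sigma> f"
    using tr by (auto simp: trace_of_def)
  have wC: "C1 (w n)" for n using w by (rule smooth_imp_C1)
  have L2c: "L2 (lebesgue_on \<Omega>) h" if "continuous_on UNIV h" for h :: "real^3 \<Rightarrow> 'b::euclidean_space"
    by (rule L2_lebesgue_on_continuous[OF omb bd that])
  have L2\<sigma>: "L2 \<sigma> h" if "continuous_on (frontier \<Omega>) h" for h :: "real^3 \<Rightarrow> 'b::euclidean_space"
    unfolding L2_def using that
    by (intro conjI borel_measurable_surface_continuous[OF op sm bd C2]
        integrable_surface_continuous[OF op sm bd C2] continuous_intros)
  have hc: "continuous_on (frontier \<Omega>) (\<lambda>x. frechet_derivative V (at x) (\<nu> x))"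
  proof -
    have "continuous_on (frontier \<Omega>) (\<lambda>x. \<Sum>i\<in>UNIV. of_real (\<nu> x $ i) * grad V x $ i)"
      by (intro continuous_intros continuous_on_normal[OF op sm C2 \<nu>] continuous_on_grad V)
    then show ?thesis using V(1) by (simp add: frechet_derivative_eq_grad C1_def)
  qed
  have "(\<lambda>n. LINT x|\<sigma>. frechet_derivative V (at x) (\<nu> x) * w n x) \<longlonglongrightarrow>
      (LINT x|\<sigma>. frechet_derivative V (at x) (\<nu> x) * f x)"
    by (intro tendsto_integral_mult_L2 L2\<sigma> hc f lim C1_continuous wC)
  moreover have "(\<lambda>n. LINT x|\<sigma>. frechet_derivative V (at x) (\<nu> x) * w n x) \<longlonglongrightarrow>
      (LINT x|lebesgue_on \<Omega>. cdot (Du x) (grad V x) + c * V x * u x)"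
  proof -
    have gl: "(\<lambda>n. LINT x|lebesgue_on \<Omega>. grad V x $ i * grad (w n) x $ i) \<longlonglongrightarrow>
       (LINT x|lebesgue_on \<Omega>. grad V x $ i * Du x $ i)" for i
    proof (rule tendsto_integral_mult_L2)
      have d: "L2 (lebesgue_on \<Omega>) (\<lambda>x. grad (w n) x - Du x)" for n
        by (intro L2_diff L2c u continuous_on_grad wC)
      have "(LINT x|lebesgue_on \<Omega>. (norm (grad (w n) x $ i - Du x $ i))\<^sup>2) \<le>
         (LINT x|lebesgue_on \<Omega>. (norm (grad (w n) x - Du x))\<^sup>2)" for n
      proof (rule integral_mono)
        show "integrable (lebesgue_on \<Omega>) (\<lambda>x. (norm (grad (w n) x $ i - Du x $ i))\<^sup>2)"
          using L2_nth[OF d, of n i] by (simp add: L2_def)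
        show "integrable (lebesgue_on \<Omega>) (\<lambda>x. (norm (grad (w n) x - Du x))\<^sup>2)"
          using d by (simp add: L2_def)
        fix x
        show "(norm (grad (w n) x $ i - Du x $ i))\<^sup>2 \<le> (norm (grad (w n) x - Du x))\<^sup>2"
          using Finite_Cartesian_Product.norm_nth_le[of "grad (w n) x - Du x" i] by (intro power_mono) auto
      qed
      then show "(\<lambda>n. LINT x|lebesgue_on \<Omega>. (norm (grad (w n) x $ i - Du x $ i))\<^sup>2) \<longlonglongrightarrow> 0"
        by (intro tendsto_sandwich[OF _ _ tendsto_const lim(2)] always_eventually allI) auto
    qed (intro L2_nth L2c u continuous_on_grad wC V)+
    have vl: "(\<lambda>n. LINT x|lebesgue_on \<Omega>. c * V x * w n x) \<longlonglongrightarrow> (LINT x|lebesgue_on \<Omega>. c * V x * u x)"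
      by (intro tendsto_integral_mult_L2 L2c u lim continuous_intros C1_continuous V wC)
    have split: "(LINT x|lebesgue_on \<Omega>. cdot (G x) (grad V x) + c * V x * g x) =
        (\<Sum>i\<in>UNIV. (LINT x|lebesgue_on \<Omega>. grad V x $ i * G x $ i)) + (LINT x|lebesgue_on \<Omega>. c * V x * g x)"
      if G: "L2 (lebesgue_on \<Omega>) G" and g: "L2 (lebesgue_on \<Omega>) g" for G g
    proof -
      have 1: "integrable (lebesgue_on \<Omega>) (\<lambda>x. grad V x $ i * G x $ i)" for i
        by (intro L2_mult_integrable L2_nth L2c G continuous_on_grad V)
      have 2: "integrable (lebesgue_on \<Omega>) (\<lambda>x. c * V x * g x)"
        by (intro L2_mult_integrable L2c g continuous_intros C1_continuous V)
      show ?thesis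
        using 1 2 by (simp add: cdot_def mult.commute[of "G _ $ _"])
    qed
    have "(LINT x|\<sigma>. frechet_derivative V (at x) (\<nu> x) * w n x) =
        (\<Sum>i\<in>UNIV. (LINT x|lebesgue_on \<Omega>. grad V x $ i * grad (w n) x $ i)) + (LINT x|lebesgue_on \<Omega>. c * V x * w n x)" for n
      unfolding Green_identity_C1[OF wC V] lap
      by (intro split L2c continuous_on_grad C1_continuous wC)
    then show ?thesis
      unfolding split[OF u(2,1)] by (simp only:) (intro tendsto_intros gl vl)
  qed
  ultimately show ?thesis by (rule LIMSEQ_unique)
qed

text \<open>The pairing with the weak normal derivative equals \<open>\<integral>\<^sub>\<Omega> (\<nabla>u\<cdot>\<nabla>V - k\<^sup>2uV + FV)\<close>, and the Green identity
for \<open>V\<close>, whose Laplacian is \<open>-k\<^sup>2V\<close>, removes everything except the source term.\<close>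
lemma boundary_bracket_affine_exp:
  assumes u: "H1 \<Omega> u Du" and cd: "cauchy_data \<Omega> \<sigma> k F u Du f \<Lambda>"
    and F: "integrable (lebesgue_on \<Omega>) (\<lambda>x. F x * affine_exp A B z x)"
    and zz: "cdot z z = - of_real (k\<^sup>2)" and Bz: "cdot B z = 0"
  shows "boundary_bracket \<sigma> \<nu> f \<Lambda> (affine_exp A B z) = (LINT x|lebesgue_on \<Omega>. F x * affine_exp A B z x)"
proof -
  let ?V = "affine_exp A B z"
  have omb: "\<Omega> \<in> sets borel" using op by simp
  have VC: "C1 ?V" by (intro smooth_imp_C1 smooth_affine_exp)
  have gC: "C1 (\<lambda>x. grad ?V x $ i)" for i
    unfolding grad_def by (simp add: frechet_derivative_affine_exp smooth_imp_C1 smooth_affine_exp)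
  have uL: "L2 (lebesgue_on \<Omega>) u" "L2 (lebesgue_on \<Omega>) Du" using u by (auto simp: H1_def)
  have tr: "trace_of \<Omega> \<sigma> u Du f" and nd: "weak_normal_derivative \<Omega> \<sigma> k F u Du \<Lambda>"
    using cd by (auto simp: cauchy_data_def)
  have "L2 \<sigma> ?V"
    unfolding L2_def
    by (intro conjI borel_measurable_surface_continuous[OF op sm bd C2]
        integrable_surface_continuous[OF op sm bd C2] continuous_intros C1_continuous VC)
  then have "trace_of \<Omega> \<sigma> ?V (grad ?V) ?V"
    unfolding trace_of_def by (intro conjI exI[of _ "\<lambda>_. ?V"]) (simp_all add: smooth_affine_exp)
  then have "\<Lambda> ?V = (LINT x|lebesgue_on \<Omega>. cdot (Du x) (grad ?V x) - of_real (k\<^sup>2) * u x * ?V x + F x * ?V x)"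
    using nd H1_C1[OF op bd VC] unfolding weak_normal_derivative_def by blast
  also have "\<dots> = (LINT x|lebesgue_on \<Omega>. (cdot (Du x) (grad ?V x) + cdot z z * ?V x * u x) + F x * ?V x)"
    by (simp add: zz mult_ac)
  also have "\<dots> = (LINT x|lebesgue_on \<Omega>. cdot (Du x) (grad ?V x) + cdot z z * ?V x * u x) + (LINT x|lebesgue_on \<Omega>. F x * ?V x)"
  proof (rule Bochner_Integration.integral_add[OF _ F])
    have "integrable (lebesgue_on \<Omega>) (\<lambda>x. Du x $ i * grad ?V x $ i)" for i
      by (intro L2_mult_integrable L2_nth L2_lebesgue_on_continuous uL omb bd continuous_on_grad VC)
    moreover have "integrable (lebesgue_on \<Omega>) (\<lambda>x. cdot z z * ?V x * u x)"
      by (intro L2_mult_integrable L2_lebesgue_on_continuous uL omb bd continuous_intros C1_continuous VC)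
    ultimately show "integrable (lebesgue_on \<Omega>) (\<lambda>x. cdot (Du x) (grad ?V x) + cdot z z * ?V x * u x)"
      unfolding cdot_def[of "Du _"] by (intro Bochner_Integration.integrable_add Bochner_Integration.integrable_sum)
  qed
  also have "(LINT x|lebesgue_on \<Omega>. cdot (Du x) (grad ?V x) + cdot z z * ?V x * u x) =
     (LINT x|\<sigma>. frechet_derivative ?V (at x) (\<nu> x) * f x)"
    by (rule Green_identity_trace[OF uL tr VC gC affine_exp_laplacian[OF Bz], symmetric])
  finally show ?thesis by (simp add: boundary_bracket_def)
qed

end

section \<open>Exponential integrals over a circular cone\<close>

text \<open>The open circular cone around the third axis with vertex 0; \<open>\<kappa>\<close> is the tangent of the
angle between the axis and the boundary.\<close>
definition std_cone :: "real \<Rightarrow> (real^3) set" where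
  "std_cone \<kappa> = {x. 0 < x $ 3 \<and> (x $ 1)\<^sup>2 + (x $ 2)\<^sup>2 < (\<kappa> * x $ 3)\<^sup>2}"

lemma open_std_cone: "open (std_cone \<kappa>)"
  unfolding std_cone_def
  by (intro open_Collect_conj open_Collect_less continuous_intros)

lemma borel_std_cone [measurable]: "std_cone \<kappa> \<in> sets borel"
  by (rule borel_open[OF open_std_cone])

lemma std_cone_bounds:
  assumes "x \<in> std_cone \<kappa>" "\<kappa> > 0"
  shows "0 < x $ 3" "\<bar>x $ 1\<bar> < \<kappa> * x $ 3" "\<bar>x $ 2\<bar> < \<kappa> * x $ 3"
proof -
  show p: "0 < x $ 3" using assms by (simp add: std_cone_def)
  have s: "(x $ 1)\<^sup>2 + (x $ 2)\<^sup>2 < (\<kappa> * x $ 3)\<^sup>2" using assms by (simp add: std_cone_def)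
  have "0 \<le> \<kappa> * x $ 3" using p assms by simp
  moreover have "\<bar>x $ 1\<bar>\<^sup>2 < (\<kappa> * x $ 3)\<^sup>2" "\<bar>x $ 2\<bar>\<^sup>2 < (\<kappa> * x $ 3)\<^sup>2"
    using s zero_le_power2[of "x $ 1"] zero_le_power2[of "x $ 2"] unfolding power2_abs by linarith+
  ultimately show "\<bar>x $ 1\<bar> < \<kappa> * x $ 3" "\<bar>x $ 2\<bar> < \<kappa> * x $ 3"
    by (auto intro: power2_less_imp_less)
qed

lemma integrable_exp_abs:
  assumes "c > 0"
  shows "integrable lborel (\<lambda>t::real. exp (- c * \<bar>t\<bar>))"
proof (rule Bochner_Integration.integrable_bound)
  have "(\<lambda>t::real. exp (- c * t)) absolutely_integrable_on {0..}"
    by (rule nonnegative_absolutely_integrable_1[OF integrable_on_exp_minus_to_infinity[OF assms]]) simp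
  then have 1: "integrable lborel (\<lambda>t::real. indicator {0..} t *\<^sub>R exp (- c * t))"
    unfolding set_integrable_def by (subst (asm) integrable_completion) auto
  have "integrable lborel (\<lambda>t::real. indicator {0..} (0 + (-1) * t) *\<^sub>R exp (- c * (0 + (-1) * t)))"
    by (rule lborel_integrable_real_affine[OF 1]) simp
  with 1 show "integrable lborel (\<lambda>t::real. indicator {0..} t *\<^sub>R exp (- c * t) +
      indicator {0..} (0 + (-1) * t) *\<^sub>R exp (- c * (0 + (-1) * t)))"
    by (rule Bochner_Integration.integrable_add)
  show "AE t in lborel. norm (exp (- c * \<bar>t\<bar>)) \<le> norm (indicator {0..} t *\<^sub>R exp (- c * t) +
      indicator {0..} (0 + (-1) * t) *\<^sub>R exp (- c * (0 + (-1) * t)))"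
    by (rule AE_I2) (auto split: split_indicator)
qed simp

lemma integrable_prod_exp_abs:
  assumes "c > 0"
  shows "integrable lborel (\<lambda>x::real^3. exp (- c * (\<bar>x$1\<bar> + \<bar>x$2\<bar> + \<bar>x$3\<bar>)))"
proof -
  have eq: "exp (- c * (\<bar>x$1\<bar> + \<bar>x$2\<bar> + \<bar>x$3\<bar>)) = (\<Prod>b\<in>Basis. exp (- c * \<bar>x \<bullet> b\<bar>))" for x :: "real^3"
    unfolding prod_Basis_real3 by (simp add: inner_axis algebra_simps exp_diff exp_minus exp_add field_simps)
  have "(\<integral>\<^sup>+x. (\<Prod>b\<in>(Basis::(real^3) set). ennreal (exp (- c * \<bar>x \<bullet> b\<bar>))) \<partial>lborel) =
     (\<Prod>b\<in>(Basis::(real^3) set). (\<integral>\<^sup>+t. ennreal (exp (- c * \<bar>t\<bar>)) \<partial>lborel))"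
    by (rule nn_integral_lborel_prod) auto
  also have "\<dots> < \<infinity>"
    using integrable_exp_abs[OF assms]
    by (auto simp: integrable_iff_bounded less_top[symmetric] ennreal_prod_eq_top power_eq_top_ennreal)
  finally have "(\<integral>\<^sup>+x. ennreal (norm (\<Prod>b\<in>(Basis::(real^3) set). exp (- c * \<bar>x \<bullet> b\<bar>))) \<partial>lborel) < \<infinity>"
    by (simp add: prod_ennreal abs_prod)
  then show ?thesis
    unfolding eq by (simp add: integrable_iff_bounded)
qed

text \<open>On the cone the third coordinate controls the other two, so decay in the third coordinate is decay in
all directions.\<close>
lemma integrable_std_cone:
  fixes g :: "real^3 \<Rightarrow> 'b::{banach, second_countable_topology}"
  assumes \<kappa>: "\<kappa> > 0" and \<mu>: "\<mu> > 0" and g: "g \<in> borel_measurable borel"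
    and le: "\<And>x. x \<in> std_cone \<kappa> \<Longrightarrow> norm (g x) \<le> C * exp (- \<mu> * x $ 3)"
  shows "integrable lborel (\<lambda>x. indicator (std_cone \<kappa>) x *\<^sub>R g x)"
proof (rule Bochner_Integration.integrable_bound)
  define c where "c = \<mu> / (1 + 2 * \<kappa>)"
  have c: "c > 0" using \<kappa> \<mu> by (simp add: c_def)
  show "integrable lborel (\<lambda>x::real^3. \<bar>C\<bar> * exp (- c * (\<bar>x$1\<bar> + \<bar>x$2\<bar> + \<bar>x$3\<bar>)))"
    by (intro integrable_mult_right integrable_prod_exp_abs c)
  show "(\<lambda>x. indicator (std_cone \<kappa>) x *\<^sub>R g x) \<in> borel_measurable lborel"
    using g by measurable
  show "AE x in lborel. norm (indicator (std_cone \<kappa>) x *\<^sub>R g x) \<le>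
      norm (\<bar>C\<bar> * exp (- c * (\<bar>x$1\<bar> + \<bar>x$2\<bar> + \<bar>x$3\<bar>)))"
  proof (rule AE_I2)
    fix x :: "real^3"
    show "norm (indicator (std_cone \<kappa>) x *\<^sub>R g x) \<le> norm (\<bar>C\<bar> * exp (- c * (\<bar>x$1\<bar> + \<bar>x$2\<bar> + \<bar>x$3\<bar>)))"
    proof (cases "x \<in> std_cone \<kappa>")
      case True
      note b = std_cone_bounds[OF True \<kappa>]
      have "c * (\<bar>x$1\<bar> + \<bar>x$2\<bar> + \<bar>x$3\<bar>) \<le> c * ((1 + 2 * \<kappa>) * x $ 3)"
        using b c by (intro mult_left_mono) (auto simp: distrib_right)
      also have "\<dots> = \<mu> * x $ 3" using \<kappa> by (simp add: c_def)
      finally have "exp (- \<mu> * x $ 3) \<le> exp (- c * (\<bar>x$1\<bar> + \<bar>x$2\<bar> + \<bar>x$3\<bar>))" by simp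
      then have "\<bar>C\<bar> * exp (- \<mu> * x $ 3) \<le> \<bar>C\<bar> * exp (- c * (\<bar>x$1\<bar> + \<bar>x$2\<bar> + \<bar>x$3\<bar>))"
        by (intro mult_left_mono) auto
      moreover have "norm (g x) \<le> \<bar>C\<bar> * exp (- \<mu> * x $ 3)"
        using le[OF True] by (rule order_trans) (intro mult_right_mono, auto)
      ultimately show ?thesis using True by (simp add: abs_mult)
    qed simp
  qed
qed

definition cone_integral :: "real \<Rightarrow> (real^3 \<Rightarrow> complex) \<Rightarrow> complex" where
  "cone_integral \<kappa> g = (LINT x|lborel. indicator (std_cone \<kappa>) x *\<^sub>R g x)"

text \<open>The fundamental theorem of calculus for integrals over the cone that depend on a parameter, through
Fubini's theorem. It is used in two ways: if the integral of \<open>E\<close> is known to be constant for reasons of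
symmetry, it shows that the integral \<open>K\<close> of the derivative is zero; and from \<open>K = 0\<close> it concludes
that the integral of \<open>E\<close> is constant.\<close>
lemma cone_integral_flow:
  fixes E E' :: "real^3 \<Rightarrow> real \<Rightarrow> complex"
  assumes \<kappa>: "\<kappa> > 0" and \<mu>: "\<mu> > 0" and b: "b \<ge> 0"
    and E: "\<And>x s. (E x has_vector_derivative E' x s) (at s)"
    and cE: "\<And>s. continuous_on UNIV (\<lambda>x. E x s)"
    and cE': "continuous_on UNIV (\<lambda>q. E' (fst q) (snd q))"
    and bE: "\<And>x s. x \<in> std_cone \<kappa> \<Longrightarrow> 0 \<le> s \<Longrightarrow> s \<le> b \<Longrightarrow> norm (E x s) \<le> C * exp (- \<mu> * x $ 3)"
    and bE': "\<And>x s. x \<in> std_cone \<kappa> \<Longrightarrow> 0 \<le> s \<Longrightarrow> s \<le> b \<Longrightarrow> norm (E' x s) \<le> C * exp (- \<mu> * x $ 3)"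
    and K: "\<And>s. 0 \<le> s \<Longrightarrow> s \<le> b \<Longrightarrow> cone_integral \<kappa> (\<lambda>x. E' x s) = K"
  shows "cone_integral \<kappa> (\<lambda>x. E x b) - cone_integral \<kappa> (\<lambda>x. E x 0) = of_real b * K"
proof -
  let ?V = "indicator (std_cone \<kappa>) :: real^3 \<Rightarrow> real"
  define F where "F x s = ?V x *\<^sub>R (indicator {0..b} s *\<^sub>R E' x s)" for x s
  have int: "integrable (lborel \<Otimes>\<^sub>M lborel) (case_prod F)"
  proof (rule Bochner_Integration.integrable_bound)
    have i1: "integrable lborel (\<lambda>x. ?V x *\<^sub>R (\<bar>C\<bar> * exp (- \<mu> * x $ 3)))"
      by (rule integrable_std_cone[OF \<kappa> \<mu>, of _ "\<bar>C\<bar>"])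
         (auto intro!: borel_measurable_continuous_onI continuous_intros)
    have i2: "integrable lborel (indicator {0..b} :: real \<Rightarrow> real)"
      using b by (simp add: integrable_indicator_iff)
    show "integrable (lborel \<Otimes>\<^sub>M lborel)
        (\<lambda>(x, s). (?V x *\<^sub>R (\<bar>C\<bar> * exp (- \<mu> * x $ 3))) * indicator {0..b} s)"
    proof (rule lborel_pair.Fubini_integrable)
      show "integrable lborel (\<lambda>x. LINT s|lborel. norm (case (x, s) of (x, s) \<Rightarrow>
          (?V x *\<^sub>R (\<bar>C\<bar> * exp (- \<mu> * x $ 3))) * indicator {0..b} s))"
        using integrable_mult_left[OF i1, of "LINT s|lborel. indicator {0..b} s"] i2
        by (simp add: abs_mult)
      have "(\<lambda>x::real^3. exp (- \<mu> * x $ 3)) \<in> borel_measurable borel"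
        by (intro borel_measurable_continuous_onI continuous_intros)
      then show "(\<lambda>(x, s). (?V x *\<^sub>R (\<bar>C\<bar> * exp (- \<mu> * x $ 3))) * indicator {0..b} s)
          \<in> borel_measurable (lborel \<Otimes>\<^sub>M lborel)"
        by measurable
    qed (use i2 in auto)
    have "(\<lambda>q. E' (fst q) (snd q)) \<in> borel_measurable (lborel \<Otimes>\<^sub>M lborel)"
      using borel_measurable_continuous_onI[OF cE'] by (simp add: lborel_prod)
    then show "case_prod F \<in> borel_measurable (lborel \<Otimes>\<^sub>M lborel)"
      unfolding F_def case_prod_unfold by measurable
    show "AE q in lborel \<Otimes>\<^sub>M lborel. norm (case_prod F q) \<le>
        norm (case q of (x, s) \<Rightarrow> (?V x *\<^sub>R (\<bar>C\<bar> * exp (- \<mu> * x $ 3))) * indicator {0..b} s)"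
    proof (rule AE_I2, clarify)
      fix x :: "real^3" and s :: real
      have "norm (E' x s) \<le> \<bar>C\<bar> * exp (- \<mu> * x $ 3)" if "x \<in> std_cone \<kappa>" "s \<in> {0..b}"
        using bE'[OF that(1)] that(2)
        by (auto intro: order_trans[of _ "C * exp (- \<mu> * x $ 3)"] mult_right_mono)
      then show "norm (F x s) \<le> norm ((?V x *\<^sub>R (\<bar>C\<bar> * exp (- \<mu> * x $ 3))) * indicator {0..b} s)"
        by (auto simp: F_def abs_mult split: split_indicator)
    qed
  qed
  have inner: "(LINT s|lborel. F x s) = ?V x *\<^sub>R (E x b - E x 0)" for x
  proof -
    have "continuous_on {0..b} (\<lambda>s. E' (fst (x, s)) (snd (x, s)))"
      by (rule continuous_on_compose2[OF cE']) (auto intro!: continuous_intros)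
    then have c: "continuous_on {0..b} (E' x)" by simp
    have "(LINT s|lborel. indicator {0..b} s *\<^sub>R E' x s) = E x b - E x 0"
      by (rule integral_FTC_Icc[OF b has_vector_derivative_at_within[OF E] c])
    then show ?thesis
      by (cases "x \<in> std_cone \<kappa>") (auto simp: F_def)
  qed
  have outer: "(LINT x|lborel. F x s) = indicator {0..b} s *\<^sub>R K" for s
    using K[of s] by (auto simp: F_def cone_integral_def split: split_indicator)
  have i0: "integrable lborel (\<lambda>x. ?V x *\<^sub>R E x 0)" and ib: "integrable lborel (\<lambda>x. ?V x *\<^sub>R E x b)"
    using bE cE b by (auto intro!: integrable_std_cone[OF \<kappa> \<mu>, of _ C] borel_measurable_continuous_onI)
  have "cone_integral \<kappa> (\<lambda>x. E x b) - cone_integral \<kappa> (\<lambda>x. E x 0) = (LINT x|lborel. (LINT s|lborel. F x s))"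
    unfolding inner cone_integral_def scaleR_diff_right
    by (rule Bochner_Integration.integral_diff[symmetric, OF ib i0])
  also have "\<dots> = (LINT s|lborel. (LINT x|lborel. F x s))"
    using lborel_pair.Fubini_integral[OF int] by simp
  also have "\<dots> = of_real b * K"
    unfolding outer using b by (subst integral_scaleR_left) (auto simp: integrable_indicator_iff scaleR_conv_of_real)
  finally show ?thesis .
qed

section \<open>Boosts of the cone\<close>

lemma cone_integral_linear:
  assumes g: "linear g" "\<bar>det (matrix g)\<bar> = 1" and V: "\<And>x. g x \<in> std_cone \<kappa> \<longleftrightarrow> x \<in> std_cone \<kappa>"
    and f: "f \<in> borel_measurable borel"
  shows "cone_integral \<kappa> (\<lambda>x. f (g x)) = cone_integral \<kappa> f"
proof -
  have gm: "g \<in> borel \<rightarrow>\<^sub>M borel"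
    using g by (intro borel_measurable_continuous_onI) (simp add: linear_continuous_on linear_linear)
  have "cone_integral \<kappa> f = (LINT x|distr lborel borel g. indicator (std_cone \<kappa>) x *\<^sub>R f x)"
    by (simp add: cone_integral_def distr_lborel_linear[OF g])
  also have "\<dots> = (LINT x|lborel. indicator (std_cone \<kappa>) (g x) *\<^sub>R f (g x))"
    using gm f by (subst integral_distr) auto
  also have "\<dots> = cone_integral \<kappa> (\<lambda>x. f (g x))"
    by (simp add: cone_integral_def indicator_def V)
  finally show ?thesis ..
qed

definition swap12 :: "real^3 \<Rightarrow> real^3" where
  "swap12 x = vector [x $ 2, x $ 1, x $ 3]"

lemma cone_integral_swap12:
  assumes "f \<in> borel_measurable borel"
  shows "cone_integral \<kappa> (\<lambda>x. f (swap12 x)) = cone_integral \<kappa> f"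
proof (rule cone_integral_linear[OF _ _ _ assms])
  show "linear swap12"
    by (rule linearI) (simp_all add: swap12_def vec_eq_iff forall_3)
  show "\<bar>det (matrix swap12)\<bar> = 1"
    by (simp add: det_3 matrix_def swap12_def axis_def)
  show "swap12 x \<in> std_cone \<kappa> \<longleftrightarrow> x \<in> std_cone \<kappa>" for x
    by (simp add: std_cone_def swap12_def add.commute)
qed

text \<open>The linear maps that preserve the quadratic form \<open>(\<kappa>x\<^sub>3)\<^sup>2 - x\<^sub>1\<^sup>2 - x\<^sub>2\<^sup>2\<close> and act in the plane of the
first and the third coordinate. They form a group with parameter \<open>s\<close>.\<close>
definition boost :: "real \<Rightarrow> real \<Rightarrow> real^3 \<Rightarrow> real^3" where
  "boost \<kappa> s x = vector [cosh s * x $ 1 + \<kappa> * sinh s * x $ 3, x $ 2, cosh s * x $ 3 + sinh s / \<kappa> * x $ 1]"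

lemma boost_nth [simp]:
  "boost \<kappa> s x $ 1 = cosh s * x $ 1 + \<kappa> * sinh s * x $ 3" "boost \<kappa> s x $ 2 = x $ 2"
  "boost \<kappa> s x $ 3 = cosh s * x $ 3 + sinh s / \<kappa> * x $ 1"
  by (simp_all add: boost_def)

lemma boost_boost_minus:
  assumes "\<kappa> > 0"
  shows "boost \<kappa> (- s) (boost \<kappa> s x) = x"
proof -
  have c: "(cosh s)\<^sup>2 = (sinh s)\<^sup>2 + 1" by (rule cosh_square_eq)
  have "boost \<kappa> (- s) (boost \<kappa> s x) $ 1 = ((cosh s)\<^sup>2 - (sinh s)\<^sup>2) * x $ 1"
    "boost \<kappa> (- s) (boost \<kappa> s x) $ 3 = ((cosh s)\<^sup>2 - (sinh s)\<^sup>2) * x $ 3"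
    using assms by (simp_all add: field_simps power2_eq_square)
  then show ?thesis by (simp add: vec_eq_iff forall_3 c)
qed

text \<open>This keeps exponential decay uniform along the boosts with bounded parameter.\<close>
lemma boost_third_ge:
  assumes "\<kappa> > 0" "x \<in> std_cone \<kappa>"
  shows "boost \<kappa> s x $ 3 \<ge> exp (- \<bar>s\<bar>) * x $ 3"
proof -
  note b = std_cone_bounds[OF assms(2,1)]
  have "\<bar>sinh s / \<kappa> * x $ 1\<bar> \<le> \<bar>sinh s\<bar> / \<kappa> * (\<kappa> * x $ 3)"
    unfolding abs_mult using b assms by (intro mult_mono) auto
  also have "\<dots> = \<bar>sinh s\<bar> * x $ 3" using assms by simp
  finally have "- (sinh s / \<kappa> * x $ 1) \<le> \<bar>sinh s\<bar> * x $ 3" by (rule abs_le_D2)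
  then have "boost \<kappa> s x $ 3 \<ge> (cosh s - \<bar>sinh s\<bar>) * x $ 3"
    unfolding boost_nth left_diff_distrib by linarith
  moreover have "cosh s - \<bar>sinh s\<bar> = exp (- \<bar>s\<bar>)"
    using cosh_minus_sinh[of "\<bar>s\<bar>"] by (cases "s \<ge> 0") (auto simp: abs_if)
  ultimately show ?thesis by simp
qed

lemma boost_std_cone_imp:
  assumes \<kappa>: "\<kappa> > 0" and x: "x \<in> std_cone \<kappa>"
  shows "boost \<kappa> s x \<in> std_cone \<kappa>"
proof -
  have "0 < exp (- \<bar>s\<bar>) * x $ 3" using std_cone_bounds[OF x \<kappa>] by simp
  then have "0 < boost \<kappa> s x $ 3" using boost_third_ge[OF \<kappa> x, of s] by linarith
  moreover have "(\<kappa> * boost \<kappa> s x $ 3)\<^sup>2 - (boost \<kappa> s x $ 1)\<^sup>2 = ((cosh s)\<^sup>2 - (sinh s)\<^sup>2) * ((\<kappa> * x $ 3)\<^sup>2 - (x $ 1)\<^sup>2)"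
    using \<kappa> by (simp add: field_simps power2_eq_square)
  then have "(\<kappa> * boost \<kappa> s x $ 3)\<^sup>2 - (boost \<kappa> s x $ 1)\<^sup>2 = (\<kappa> * x $ 3)\<^sup>2 - (x $ 1)\<^sup>2"
    by (simp add: cosh_square_eq)
  then have "(boost \<kappa> s x $ 1)\<^sup>2 + (boost \<kappa> s x $ 2)\<^sup>2 < (\<kappa> * boost \<kappa> s x $ 3)\<^sup>2"
    using x unfolding std_cone_def mem_Collect_eq boost_nth(2) by linarith
  ultimately show ?thesis unfolding std_cone_def by blast
qed

lemma boost_std_cone_iff: "\<kappa> > 0 \<Longrightarrow> boost \<kappa> s x \<in> std_cone \<kappa> \<longleftrightarrow> x \<in> std_cone \<kappa>"
  using boost_std_cone_imp boost_boost_minus by metis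

lemma linear_boost: "linear (boost \<kappa> s)"
  by (rule linearI) (simp_all add: vec_eq_iff forall_3 algebra_simps)

lemma cone_integral_boost:
  assumes \<kappa>: "\<kappa> > 0" and f: "f \<in> borel_measurable borel"
  shows "cone_integral \<kappa> (\<lambda>x. f (boost \<kappa> s x)) = cone_integral \<kappa> f"
proof (rule cone_integral_linear[OF linear_boost _ boost_std_cone_iff[OF \<kappa>] f])
  have "det (matrix (boost \<kappa> s)) = (cosh s)\<^sup>2 - (sinh s)\<^sup>2"
    using \<kappa> by (simp add: det_3 matrix_def axis_def power2_eq_square)
  then show "\<bar>det (matrix (boost \<kappa> s))\<bar> = 1" by (simp add: cosh_square_eq)
qed

text \<open>For positive \<open>\<mu>\<close> this makes \<open>e\<^bsup>z\<cdot>x\<^esup>\<close> integrable over the cone.\<close>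
definition cone_decay :: "real \<Rightarrow> real \<Rightarrow> complex^3 \<Rightarrow> bool" where
  "cone_decay \<kappa> \<mu> z \<longleftrightarrow> (\<forall>x\<in>std_cone \<kappa>. Re (cdot z (cvec x)) \<le> - \<mu> * x $ 3)"

lemma cdot_cvec_3: "cdot z (cvec x) = z $ 1 * of_real (x $ 1) + z $ 2 * of_real (x $ 2) + z $ 3 * of_real (x $ 3)"
  by (simp add: cdot_def cvec_def sum_3)

lemma continuous_on_cdot_cvec [continuous_intros]:
  "continuous_on S f \<Longrightarrow> continuous_on S (\<lambda>x. cdot z (cvec (f x)))"
  unfolding cdot_cvec_3 by (intro continuous_intros)

text \<open>Half of the decay rate absorbs the affine factor.\<close>
lemma affine_times_exp_bound:
  assumes "\<mu> > 0" "t \<ge> 0" "q \<ge> 0" "p \<ge> (0::real)"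
  shows "(p + q * t) * exp (- \<mu> * t) \<le> (p + 2 * q / \<mu>) * exp (- (\<mu> / 2) * t)"
proof -
  have "p + q * t \<le> (p + 2 * q / \<mu>) * exp (\<mu> / 2 * t)"
  proof -
    have e: "\<mu> / 2 * t \<le> exp (\<mu> / 2 * t)"
      using exp_ge_add_one_self[of "\<mu> / 2 * t"] by linarith
    have "p * 1 \<le> p * exp (\<mu> / 2 * t)" using assms by (intro mult_left_mono) auto
    moreover have "(2 * q / \<mu>) * (\<mu> / 2 * t) \<le> (2 * q / \<mu>) * exp (\<mu> / 2 * t)"
      by (rule mult_left_mono[OF e]) (use assms in simp)
    moreover have "(2 * q / \<mu>) * (\<mu> / 2 * t) = q * t" using assms by simp
    ultimately show ?thesis by (simp add: distrib_right)
  qed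
  then have "(p + q * t) * exp (- \<mu> * t) \<le> ((p + 2 * q / \<mu>) * exp (\<mu> / 2 * t)) * exp (- \<mu> * t)"
    by (intro mult_right_mono) auto
  also have "\<dots> = (p + 2 * q / \<mu>) * exp (- (\<mu> / 2) * t)"
    by (simp add: mult.assoc exp_add[symmetric])
  finally show ?thesis .
qed

lemma linear_times_exp_bound:
  assumes "cone_decay \<kappa> \<mu> z" "\<mu> > 0" "x \<in> std_cone \<kappa>" "\<kappa> > 0" "norm Y \<le> M * x $ 3"
  shows "norm (Y * exp (cdot z (cvec x))) \<le> (2 * M / \<mu>) * exp (- (\<mu> / 2) * x $ 3)"
proof -
  let ?t = "x $ 3"
  have t: "?t > 0" using std_cone_bounds[OF assms(3,4)] by simp
  have M: "M \<ge> 0" using assms(5) norm_ge_zero[of Y] t by (meson order_trans zero_le_mult_iff not_le)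
  have "norm (exp (cdot z (cvec x))) \<le> exp (- \<mu> * ?t)"
    using assms(1,3) by (simp add: cone_decay_def)
  then have "norm (Y * exp (cdot z (cvec x))) \<le> (M * ?t) * exp (- \<mu> * ?t)"
    unfolding norm_mult using assms(5) M t by (intro mult_mono) auto
  also have "\<dots> \<le> (2 * M / \<mu>) * exp (- (\<mu> / 2) * ?t)"
    using affine_times_exp_bound[OF assms(2) less_imp_le[OF t] M, of 0] by simp
  finally show ?thesis .
qed

lemma exp_cdot_bound:
  assumes "cone_decay \<kappa> \<mu> z" "x \<in> std_cone \<kappa>"
  shows "norm (exp (cdot z (cvec x))) \<le> exp (- \<mu> * x $ 3)"
  using assms by (simp add: cone_decay_def)

lemma integrable_linear_times_exp:
  assumes \<kappa>: "\<kappa> > 0" and \<mu>: "\<mu> > 0" and dec: "cone_decay \<kappa> \<mu> z"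
  shows "integrable lborel (\<lambda>x. indicator (std_cone \<kappa>) x *\<^sub>R
     ((p * of_real (x $ 3) + q * of_real (x $ 1) + r * of_real (x $ 2)) * exp (cdot z (cvec x))))"
proof (rule integrable_std_cone[OF \<kappa>, of "\<mu> / 2"])
  show "(\<lambda>x. (p * of_real (x $ 3) + q * of_real (x $ 1) + r * of_real (x $ 2)) * exp (cdot z (cvec x)))
     \<in> borel_measurable borel"
    by (intro borel_measurable_continuous_onI continuous_intros)
  fix x assume x: "x \<in> std_cone \<kappa>"
  note b = std_cone_bounds[OF x \<kappa>]
  show "norm ((p * of_real (x $ 3) + q * of_real (x $ 1) + r * of_real (x $ 2)) * exp (cdot z (cvec x)))
     \<le> (2 * (norm p + norm q * \<kappa> + norm r * \<kappa>) / \<mu>) * exp (- (\<mu> / 2) * x $ 3)"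
  proof (rule linear_times_exp_bound[OF dec \<mu> x \<kappa>])
    have "norm (p * of_real (x $ 3) + q * of_real (x $ 1) + r * of_real (x $ 2)) \<le>
       norm p * x $ 3 + norm q * \<bar>x $ 1\<bar> + norm r * \<bar>x $ 2\<bar>"
      using b by (intro norm_triangle_le add_mono) (simp_all add: norm_mult)
    also have "\<dots> \<le> norm p * x $ 3 + norm q * (\<kappa> * x $ 3) + norm r * (\<kappa> * x $ 3)"
      using b by (intro add_mono mult_left_mono) auto
    finally show "norm (p * of_real (x $ 3) + q * of_real (x $ 1) + r * of_real (x $ 2)) \<le>
       (norm p + norm q * \<kappa> + norm r * \<kappa>) * x $ 3"
      by (simp add: distrib_right mult.assoc)
  qed
qed (use \<mu> in simp)

text \<open>The integral of \<open>e\<^bsup>z\<cdot>x\<^esup>\<close> over the cone does not change when \<open>x\<close> is replaced by its image under a boost.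
The factor in front of the exponential is the derivative of \<open>z\<cdot>x\<close> along the boosts.\<close>
lemma boost_identity_1:
  assumes \<kappa>: "\<kappa> > 0" and \<mu>: "\<mu> > 0" and dec: "cone_decay \<kappa> \<mu> z"
  shows "cone_integral \<kappa> (\<lambda>x. (of_real \<kappa> * z $ 1 * of_real (x $ 3) + z $ 3 / of_real \<kappa> * of_real (x $ 1))
     * exp (cdot z (cvec x))) = 0"
proof -
  define Y where "Y x = of_real \<kappa> * z $ 1 * of_real (x $ 3) + z $ 3 / of_real \<kappa> * of_real (x $ 1)" for x :: "real^3"
  define g where "g x = Y x * exp (cdot z (cvec x))" for x
  define M where "M = \<kappa> * norm (z $ 1) + norm (z $ 3)"
  define C where "C = max 1 (2 * M / \<mu>)"
  \<comment> \<open>boosts with parameter between 0 and 1 shrink the third coordinate at most by the factor 1/e\<close>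
  define \<mu>' where "\<mu>' = (\<mu> / 2) * exp (- 1)"
  have \<mu>': "\<mu>' > 0" using \<mu> by (simp add: \<mu>'_def)
  have YM: "norm (Y x) \<le> M * x $ 3" if x: "x \<in> std_cone \<kappa>" for x
  proof -
    note b = std_cone_bounds[OF x \<kappa>]
    have "norm (Y x) \<le> \<kappa> * norm (z $ 1) * x $ 3 + norm (z $ 3) / \<kappa> * \<bar>x $ 1\<bar>"
      unfolding Y_def using b \<kappa> by (intro norm_triangle_le add_mono) (simp_all add: norm_mult norm_divide)
    also have "\<dots> \<le> \<kappa> * norm (z $ 1) * x $ 3 + norm (z $ 3) / \<kappa> * (\<kappa> * x $ 3)"
      using b \<kappa> by (intro add_mono mult_left_mono) auto
    finally show ?thesis using \<kappa> by (simp add: M_def distrib_right)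
  qed
  have gm: "g \<in> borel_measurable borel"
    unfolding g_def Y_def by (intro borel_measurable_continuous_onI continuous_intros)
  have em: "(\<lambda>x. exp (cdot z (cvec x))) \<in> borel_measurable borel"
    by (intro borel_measurable_continuous_onI continuous_intros)
  have mono: "exp (- \<mu> * t) \<le> exp (- (\<mu> / 2) * t)" if "t > 0" for t
    using \<mu> that by simp
  have le: "exp (- (\<mu> / 2) * boost \<kappa> s x $ 3) \<le> exp (- \<mu>' * x $ 3)"
    if x: "x \<in> std_cone \<kappa>" and s: "0 \<le> s" "s \<le> 1" for x s
  proof -
    have "exp (- 1) * x $ 3 \<le> exp (- \<bar>s\<bar>) * x $ 3"
      using s std_cone_bounds[OF x \<kappa>] by (intro mult_right_mono) auto
    also have "\<dots> \<le> boost \<kappa> s x $ 3" by (rule boost_third_ge[OF \<kappa> x])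
    finally have "(\<mu> / 2) * (exp (- 1) * x $ 3) \<le> (\<mu> / 2) * boost \<kappa> s x $ 3"
      using \<mu> by (intro mult_left_mono) auto
    then show ?thesis by (simp add: \<mu>'_def mult.assoc)
  qed
  have Ele: "norm (exp (cdot z (cvec (boost \<kappa> s x)))) \<le> C * exp (- \<mu>' * x $ 3)"
    if x: "x \<in> std_cone \<kappa>" and s: "0 \<le> s" "s \<le> 1" for x s
  proof -
    have bx: "boost \<kappa> s x \<in> std_cone \<kappa>" by (rule boost_std_cone_imp[OF \<kappa> x])
    have "norm (exp (cdot z (cvec (boost \<kappa> s x)))) \<le> exp (- \<mu> * boost \<kappa> s x $ 3)"
      by (rule exp_cdot_bound[OF dec bx])
    also have "\<dots> \<le> exp (- (\<mu> / 2) * boost \<kappa> s x $ 3)"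
      by (rule mono[OF std_cone_bounds(1)[OF bx \<kappa>]])
    also have "\<dots> \<le> exp (- \<mu>' * x $ 3)" by (rule le[OF x s])
    also have "\<dots> \<le> C * exp (- \<mu>' * x $ 3)"
      using mult_right_mono[of 1 C "exp (- \<mu>' * x $ 3)"] by (simp add: C_def)
    finally show ?thesis .
  qed
  have "cone_integral \<kappa> (\<lambda>x. exp (cdot z (cvec (boost \<kappa> 1 x)))) - cone_integral \<kappa> (\<lambda>x. exp (cdot z (cvec (boost \<kappa> 0 x))))
      = of_real 1 * cone_integral \<kappa> g"
  proof (rule cone_integral_flow[OF \<kappa> \<mu>', where E' = "\<lambda>x s. g (boost \<kappa> s x)" and C = C])
    show "((\<lambda>s. exp (cdot z (cvec (boost \<kappa> s x)))) has_vector_derivative g (boost \<kappa> s x)) (at s)" for x s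
    proof -
      have 1: "((\<lambda>s. boost \<kappa> s x $ 1) has_real_derivative \<kappa> * boost \<kappa> s x $ 3) (at s)"
        using \<kappa> by (auto intro!: derivative_eq_intros simp: field_simps)
      have 2: "((\<lambda>s. boost \<kappa> s x $ 2) has_real_derivative 0) (at s)" by simp
      have 3: "((\<lambda>s. boost \<kappa> s x $ 3) has_real_derivative boost \<kappa> s x $ 1 / \<kappa>) (at s)"
        using \<kappa> by (auto intro!: derivative_eq_intros simp: field_simps)
      have "((\<lambda>s. cdot z (cvec (boost \<kappa> s x))) has_vector_derivative
          (z $ 1 * of_real (\<kappa> * boost \<kappa> s x $ 3) + z $ 2 * of_real 0 + z $ 3 * of_real (boost \<kappa> s x $ 1 / \<kappa>))) (at s)"
        unfolding cdot_cvec_3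
        by (intro has_vector_derivative_add has_vector_derivative_mult_right has_vector_derivative_of_real 1 2 3)
      from field_vector_diff_chain_at[OF this DERIV_exp]
      have "((\<lambda>s. exp (cdot z (cvec (boost \<kappa> s x)))) has_vector_derivative
        (z $ 1 * of_real (\<kappa> * boost \<kappa> s x $ 3) + z $ 2 * of_real 0 + z $ 3 * of_real (boost \<kappa> s x $ 1 / \<kappa>)) * exp (cdot z (cvec (boost \<kappa> s x)))) (at s)"
        by (simp only: o_def)
      moreover have "(z $ 1 * of_real (\<kappa> * boost \<kappa> s x $ 3) + z $ 2 * of_real 0 + z $ 3 * of_real (boost \<kappa> s x $ 1 / \<kappa>)) * exp (cdot z (cvec (boost \<kappa> s x))) = g (boost \<kappa> s x)"
        unfolding g_def Y_def of_real_mult of_real_divide by (simp only: of_real_0 mult_zero_right mult_zero_left add_0_right mult_ac times_divide_eq_left times_divide_eq_right)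
      ultimately show ?thesis by (simp only:)
    qed
    show "continuous_on UNIV (\<lambda>x. exp (cdot z (cvec (boost \<kappa> t x))))" for t
      by (intro continuous_intros linear_continuous_on) (simp add: linear_linear linear_boost)
    show "continuous_on UNIV (\<lambda>q. g (boost \<kappa> (snd q) (fst q)))"
      unfolding g_def Y_def cdot_cvec_3 boost_nth using \<kappa>
      by (intro continuous_intros) auto
    show "norm (exp (cdot z (cvec (boost \<kappa> s x)))) \<le> C * exp (- \<mu>' * x $ 3)"
      if "x \<in> std_cone \<kappa>" "0 \<le> s" "s \<le> 1" for x s
      by (rule Ele[OF that])
    show "norm (g (boost \<kappa> s x)) \<le> C * exp (- \<mu>' * x $ 3)"
      if x: "x \<in> std_cone \<kappa>" and s: "0 \<le> s" "s \<le> 1" for x s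
    proof -
      have bx: "boost \<kappa> s x \<in> std_cone \<kappa>" by (rule boost_std_cone_imp[OF \<kappa> x])
      have "norm (g (boost \<kappa> s x)) \<le> (2 * M / \<mu>) * exp (- (\<mu> / 2) * boost \<kappa> s x $ 3)"
        unfolding g_def by (rule linear_times_exp_bound[OF dec \<mu> bx \<kappa> YM[OF bx]])
      also have "\<dots> \<le> C * exp (- \<mu>' * x $ 3)"
        by (intro mult_mono le[OF x s]) (auto simp: C_def)
      finally show ?thesis .
    qed
    show "cone_integral \<kappa> (\<lambda>x. g (boost \<kappa> s x)) = cone_integral \<kappa> g" for s
      by (rule cone_integral_boost[OF \<kappa> gm])
  qed simp
  then have "cone_integral \<kappa> g = 0"
    unfolding cone_integral_boost[OF \<kappa> em] by simp
  then show ?thesis by (simp add: g_def[abs_def] Y_def)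
qed

lemma boost_identity_2:
  assumes \<kappa>: "\<kappa> > 0" and \<mu>: "\<mu> > 0" and dec: "cone_decay \<kappa> \<mu> z"
  shows "cone_integral \<kappa> (\<lambda>x. (of_real \<kappa> * z $ 2 * of_real (x $ 3) + z $ 3 / of_real \<kappa> * of_real (x $ 2))
     * exp (cdot z (cvec x))) = 0"
proof -
  define z' :: "complex^3" where "z' = vector [z $ 2, z $ 1, z $ 3]"
  have zs: "cdot z' (cvec x) = cdot z (cvec (swap12 x))" for x
    by (simp add: cdot_cvec_3 z'_def swap12_def)
  have sw: "swap12 x \<in> std_cone \<kappa> \<longleftrightarrow> x \<in> std_cone \<kappa>" for x
    by (simp add: std_cone_def swap12_def add.commute)
  have "cone_decay \<kappa> \<mu> z'"
    unfolding cone_decay_def zs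
  proof
    fix x assume "x \<in> std_cone \<kappa>"
    then have "swap12 x \<in> std_cone \<kappa>" by (simp add: sw)
    then have "Re (cdot z (cvec (swap12 x))) \<le> - \<mu> * swap12 x $ 3" using dec by (simp add: cone_decay_def)
    then show "Re (cdot z (cvec (swap12 x))) \<le> - \<mu> * x $ 3" by (simp add: swap12_def)
  qed
  from boost_identity_1[OF \<kappa> \<mu> this]
  have eq: "cone_integral \<kappa> (\<lambda>x. (\<lambda>x. (of_real \<kappa> * z $ 2 * of_real (x $ 3) + z $ 3 / of_real \<kappa> * of_real (x $ 2))
     * exp (cdot z (cvec x))) (swap12 x)) = 0"
    by (simp add: zs) (simp add: z'_def swap12_def)
  have m: "(\<lambda>x. (of_real \<kappa> * z $ 2 * of_real (x $ 3) + z $ 3 / of_real \<kappa> * of_real (x $ 2))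
     * exp (cdot z (cvec x))) \<in> borel_measurable borel"
    using \<kappa> by (intro borel_measurable_continuous_onI continuous_intros) auto
  show ?thesis by (rule trans[OF cone_integral_swap12[OF m, symmetric] eq])
qed

lemma cone_integral_cmult: "cone_integral \<kappa> (\<lambda>x. c * g x) = c * cone_integral \<kappa> g"
proof -
  have "cone_integral \<kappa> (\<lambda>x. c * g x) = (LINT x|lborel. c * (indicator (std_cone \<kappa>) x *\<^sub>R g x))"
    unfolding cone_integral_def by (intro Bochner_Integration.integral_cong refl) simp
  then show ?thesis by (simp only: integral_mult_right_zero cone_integral_def)
qed

text \<open>Boosts in the complex direction \<open>(z\<^sub>1, z\<^sub>2)\<close> would rotate \<open>z\<close> within the vectors with the same value of
the dual quadratic form. Written in terms of the angle, this path is \<open>Z a\<close> below; it starts on the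
axis at \<open>a = 0\<close> and reaches \<open>z\<close> at \<open>a = \<theta>\<close>. No complex boost of the cone is needed: along the path the
derivative of the exponential is the combination of the two boost identities with the complex
coefficients \<open>z\<^sub>1\<close> and \<open>z\<^sub>2\<close>, because \<open>z\<^sub>1\<^sup>2 + z\<^sub>2\<^sup>2 = -z\<^sub>3\<^sup>2\<close>. The decay condition holds along the path
since the first two components only grow towards those of \<open>z\<close>, while the third one, whose real part
is negative, shrinks towards that of \<open>z\<close>.\<close>
lemma cone_integral_rotate_to_axis:
  assumes th: "0 < \<theta>" "\<theta> < pi / 2" and \<mu>: "\<mu> > 0"
    and dec: "cone_decay (tan \<theta>) \<mu> z" and null: "cdot z z = 0"
  shows "cone_integral (tan \<theta>) (\<lambda>x. exp (cdot z (cvec x))) =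
    cone_integral (tan \<theta>) (\<lambda>x. exp (z $ 3 / of_real (cos \<theta>) * of_real (x $ 3)))"
proof -
  define \<kappa> where "\<kappa> = tan \<theta>"
  have s0: "sin \<theta> > 0" and c0: "cos \<theta> > 0"
    using th by (auto intro: sin_gt_zero cos_gt_zero)
  have \<kappa>: "\<kappa> > 0" using th by (simp add: \<kappa>_def tan_gt_zero)
  have \<kappa>sc: "\<kappa> = sin \<theta> / cos \<theta>" by (simp add: \<kappa>_def tan_def)
  define Z :: "real \<Rightarrow> complex^3" where
    "Z a = vector [of_real (sin a / sin \<theta>) * z $ 1, of_real (sin a / sin \<theta>) * z $ 2, of_real (cos a / cos \<theta>) * z $ 3]" for a
  have Z [simp]: "Z a $ 1 = of_real (sin a / sin \<theta>) * z $ 1" "Z a $ 2 = of_real (sin a / sin \<theta>) * z $ 2"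
    "Z a $ 3 = of_real (cos a / cos \<theta>) * z $ 3" for a by (simp_all add: Z_def)
  have axis_in: "axis 3 t \<in> std_cone \<kappa>" if "t > 0" for t
    using that \<kappa> by (simp add: std_cone_def axis_def)
  have z3: "t * Re (z $ 3) \<le> - \<mu> * t" if "t > 0" for t
    using dec axis_in[OF that] by (auto simp: cone_decay_def \<kappa>_def[symmetric] cdot_cvec_3 axis_def mult.commute dest!: bspec)
  have z3n: "z $ 3 \<noteq> 0" using z3[of 1] \<mu> by auto
  have Zdec: "cone_decay \<kappa> \<mu> (Z a)" if a: "0 \<le> a" "a \<le> \<theta>" for a
    unfolding cone_decay_def
  proof
    fix x assume x: "x \<in> std_cone \<kappa>"
    have t: "x $ 3 > 0" using std_cone_bounds[OF x \<kappa>] by simp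
    define r q where "r = sin a / sin \<theta>" and "q = cos a / cos \<theta>"
    have "0 \<le> sin a" by (rule sin_ge_zero) (use a th in linarith)+
    moreover have "sin a \<le> sin \<theta>" by (rule sin_monotone_2pi_le) (use a th in linarith)+
    moreover have "cos \<theta> \<le> cos a" by (rule cos_monotone_0_pi_le) (use a th in linarith)+
    ultimately have r: "0 \<le> r" "r \<le> 1" and q: "1 \<le> q"
      using s0 c0 by (simp_all add: r_def q_def)
    define A where "A = Re (z $ 1 * of_real (x $ 1) + z $ 2 * of_real (x $ 2))"
    have 1: "A + x $ 3 * Re (z $ 3) \<le> - \<mu> * x $ 3"
      using dec x by (auto simp: cone_decay_def \<kappa>_def[symmetric] cdot_cvec_3 A_def mult.commute dest!: bspec)
    have "Re (cdot (Z a) (cvec x)) = r * A + q * (x $ 3 * Re (z $ 3))"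
      by (simp add: cdot_cvec_3 A_def r_def[symmetric] q_def[symmetric] algebra_simps)
    also have "\<dots> = r * (A + x $ 3 * Re (z $ 3)) + (q - r) * (x $ 3 * Re (z $ 3))"
      by (simp add: algebra_simps)
    also have "\<dots> \<le> r * (- \<mu> * x $ 3) + (q - r) * (- \<mu> * x $ 3)"
      using r q 1 z3[OF t] by (intro add_mono mult_left_mono) auto
    also have "\<dots> = q * (- \<mu> * x $ 3)" by (simp add: algebra_simps)
    also have "\<dots> \<le> 1 * (- \<mu> * x $ 3)" using q \<mu> t by (intro mult_right_mono_neg) auto
    finally show "Re (cdot (Z a) (cvec x)) \<le> - \<mu> * x $ 3" by simp
  qed
  define Y where "Y a x = of_real (cos a / sin \<theta>) * (z $ 1 * of_real (x $ 1) + z $ 2 * of_real (x $ 2))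
     - of_real (sin a / cos \<theta>) * z $ 3 * of_real (x $ 3)" for a and x :: "real^3"
  have K: "cone_integral \<kappa> (\<lambda>x. Y a x * exp (cdot (Z a) (cvec x))) = 0" if a: "0 \<le> a" "a \<le> \<theta>" for a
  proof -
    define e where "e x = exp (cdot (Z a) (cvec x))" for x
    let ?g1 = "\<lambda>x. (of_real \<kappa> * Z a $ 1 * of_real (x $ 3) + Z a $ 3 / of_real \<kappa> * of_real (x $ 1)) * e x"
    let ?g2 = "\<lambda>x. (of_real \<kappa> * Z a $ 2 * of_real (x $ 3) + Z a $ 3 / of_real \<kappa> * of_real (x $ 2)) * e x"
    let ?V = "indicator (std_cone \<kappa>) :: real^3 \<Rightarrow> real"
    note int = integrable_linear_times_exp[OF \<kappa> \<mu> Zdec[OF a], folded e_def]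
    have i1: "integrable lborel (\<lambda>x. ?V x *\<^sub>R ?g1 x)"
      using int[of "of_real \<kappa> * Z a $ 1" "Z a $ 3 / of_real \<kappa>" 0] by simp
    have i2: "integrable lborel (\<lambda>x. ?V x *\<^sub>R ?g2 x)"
      using int[of "of_real \<kappa> * Z a $ 2" 0 "Z a $ 3 / of_real \<kappa>"] by simp
    have zz: "z $ 1 * z $ 1 + z $ 2 * z $ 2 = - (z $ 3 * z $ 3)"
      using null by (simp add: cdot_def sum_3 eq_neg_iff_add_eq_0)
    \<comment> \<open>the derivative along the path is the boost in the complex direction of the first two components\<close>
    have comb: "z $ 3 * (Y a x * e x) = z $ 1 * ?g1 x + z $ 2 * ?g2 x" for x
    proof -
      have k1: "complex_of_real \<kappa> * of_real (sin a / sin \<theta>) = of_real (sin a / cos \<theta>)"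
        unfolding of_real_mult[symmetric] \<kappa>sc using s0 by simp
      have k2: "complex_of_real (cos a / cos \<theta>) / of_real \<kappa> = of_real (cos a / sin \<theta>)"
        unfolding of_real_divide[symmetric] \<kappa>sc using c0 by simp
      have "z $ 1 * ?g1 x + z $ 2 * ?g2 x =
        ((complex_of_real \<kappa> * of_real (sin a / sin \<theta>)) * (z $ 1 * z $ 1 + z $ 2 * z $ 2) * of_real (x $ 3)
          + (complex_of_real (cos a / cos \<theta>) / of_real \<kappa>) * z $ 3 * (z $ 1 * of_real (x $ 1) + z $ 2 * of_real (x $ 2))) * e x"
        unfolding Z by (simp only: ring_distribs mult_ac times_divide_eq_left times_divide_eq_right add_ac)
      also have "\<dots> = z $ 3 * (Y a x * e x)"
        unfolding k1 k2 zz Y_def by (simp add: algebra_simps)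
      finally show ?thesis ..
    qed
    have "z $ 3 * cone_integral \<kappa> (\<lambda>x. Y a x * e x) = cone_integral \<kappa> (\<lambda>x. z $ 1 * ?g1 x + z $ 2 * ?g2 x)"
      unfolding cone_integral_cmult[symmetric] comb ..
    also have "\<dots> = (LINT x|lborel. z $ 1 * (?V x *\<^sub>R ?g1 x) + z $ 2 * (?V x *\<^sub>R ?g2 x))"
      unfolding cone_integral_def
      by (intro Bochner_Integration.integral_cong refl) (simp only: scaleR_add_right mult_scaleR_right)
    also have "\<dots> = z $ 1 * cone_integral \<kappa> ?g1 + z $ 2 * cone_integral \<kappa> ?g2"
      unfolding cone_integral_def
      by (subst Bochner_Integration.integral_add)
         (intro integrable_mult_right i1 i2, intro integrable_mult_right i1 i2, simp only: integral_mult_right_zero)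
    also have "\<dots> = 0"
      using boost_identity_1[OF \<kappa> \<mu> Zdec[OF a]] boost_identity_2[OF \<kappa> \<mu> Zdec[OF a]]
      by (simp only: e_def mult_zero_right add_0_right)
    finally show ?thesis using z3n by (simp add: e_def)
  qed
  define M where "M = (norm (z $ 1) * \<kappa> + norm (z $ 2) * \<kappa>) / sin \<theta> + norm (z $ 3) / cos \<theta>"
  define C where "C = max 1 (2 * M / \<mu>)"
  have Ele: "norm (exp (cdot (Z a) (cvec x))) \<le> C * exp (- (\<mu> / 2) * x $ 3)"
    if x: "x \<in> std_cone \<kappa>" and a: "0 \<le> a" "a \<le> \<theta>" for x a
  proof -
    have "norm (exp (cdot (Z a) (cvec x))) \<le> exp (- \<mu> * x $ 3)"
      by (rule exp_cdot_bound[OF Zdec[OF a] x])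
    also have "\<dots> \<le> exp (- (\<mu> / 2) * x $ 3)" using \<mu> std_cone_bounds(1)[OF x \<kappa>] by simp
    also have "\<dots> \<le> C * exp (- (\<mu> / 2) * x $ 3)"
      using mult_right_mono[of 1 C "exp (- (\<mu> / 2) * x $ 3)"] by (simp add: C_def)
    finally show ?thesis .
  qed
  have "cone_integral \<kappa> (\<lambda>x. exp (cdot (Z \<theta>) (cvec x))) - cone_integral \<kappa> (\<lambda>x. exp (cdot (Z 0) (cvec x))) = of_real \<theta> * 0"
  proof (rule cone_integral_flow[OF \<kappa>, where E' = "\<lambda>x a. Y a x * exp (cdot (Z a) (cvec x))" and C = C and \<mu> = "\<mu> / 2"])
    show "((\<lambda>a. exp (cdot (Z a) (cvec x))) has_vector_derivative Y a x * exp (cdot (Z a) (cvec x))) (at a)" for x a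
    proof -
      have 1: "((\<lambda>a. sin a / sin \<theta>) has_real_derivative cos a / sin \<theta>) (at a)"
        using s0 by (auto intro!: derivative_eq_intros)
      have 2: "((\<lambda>a. cos a / cos \<theta>) has_real_derivative - (sin a / cos \<theta>)) (at a)"
        using c0 by (auto intro!: derivative_eq_intros)
      have "((\<lambda>a. of_real (sin a / sin \<theta>) * (z $ 1 * of_real (x $ 1) + z $ 2 * of_real (x $ 2)) + of_real (cos a / cos \<theta>) * (z $ 3 * of_real (x $ 3))) has_vector_derivative
         of_real (cos a / sin \<theta>) * (z $ 1 * of_real (x $ 1) + z $ 2 * of_real (x $ 2)) + of_real (- (sin a / cos \<theta>)) * (z $ 3 * of_real (x $ 3))) (at a)"
        by (intro has_vector_derivative_add has_vector_derivative_mult_left has_vector_derivative_of_real 1 2)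
      moreover have "of_real (sin a / sin \<theta>) * (z $ 1 * of_real (x $ 1) + z $ 2 * of_real (x $ 2)) + of_real (cos a / cos \<theta>) * (z $ 3 * of_real (x $ 3)) = cdot (Z a) (cvec x)" for a
        unfolding cdot_cvec_3 Z by (simp only: ring_distribs mult.assoc)
      moreover have "of_real (cos a / sin \<theta>) * (z $ 1 * of_real (x $ 1) + z $ 2 * of_real (x $ 2)) + of_real (- (sin a / cos \<theta>)) * (z $ 3 * of_real (x $ 3)) = Y a x"
        unfolding Y_def by (simp only: of_real_minus mult_minus_left diff_conv_add_uminus mult.assoc)
      ultimately have "((\<lambda>a. cdot (Z a) (cvec x)) has_vector_derivative Y a x) (at a)" by (simp only:)
      from field_vector_diff_chain_at[OF this DERIV_exp] show ?thesis by (simp only: o_def)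
    qed
    show "continuous_on UNIV (\<lambda>x. exp (cdot (Z a) (cvec x)))" for a
      by (intro continuous_intros)
    show "continuous_on UNIV (\<lambda>q. Y (snd q) (fst q) * exp (cdot (Z (snd q)) (cvec (fst q))))"
      unfolding Y_def cdot_cvec_3 Z using s0 c0 by (intro continuous_intros) auto
    show "norm (exp (cdot (Z a) (cvec x))) \<le> C * exp (- (\<mu> / 2) * x $ 3)"
      if "x \<in> std_cone \<kappa>" "0 \<le> a" "a \<le> \<theta>" for x a
      by (rule Ele[OF that])
    show "norm (Y a x * exp (cdot (Z a) (cvec x))) \<le> C * exp (- (\<mu> / 2) * x $ 3)"
      if x: "x \<in> std_cone \<kappa>" and a: "0 \<le> a" "a \<le> \<theta>" for x a
    proof -
      note b = std_cone_bounds[OF x \<kappa>]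
      have na: "norm (of_real (cos a / sin \<theta>) :: complex) \<le> 1 / sin \<theta>"
        unfolding norm_of_real using s0 by (simp add: divide_right_mono)
      have nb: "norm (of_real (sin a / cos \<theta>) :: complex) \<le> 1 / cos \<theta>"
        unfolding norm_of_real using c0 by (simp add: divide_right_mono)
      have "norm (z $ 1 * of_real (x $ 1) + z $ 2 * of_real (x $ 2)) \<le> norm (z $ 1) * (\<kappa> * x $ 3) + norm (z $ 2) * (\<kappa> * x $ 3)"
        using b by (intro norm_triangle_le add_mono) (simp_all add: norm_mult mult_left_mono)
      then have "norm (of_real (cos a / sin \<theta>) * (z $ 1 * of_real (x $ 1) + z $ 2 * of_real (x $ 2))) \<le>
         (1 / sin \<theta>) * (norm (z $ 1) * (\<kappa> * x $ 3) + norm (z $ 2) * (\<kappa> * x $ 3))"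
        unfolding norm_mult using s0 by (intro mult_mono na) simp_all
      moreover have "norm (of_real (sin a / cos \<theta>) * z $ 3 * of_real (x $ 3)) \<le> (1 / cos \<theta>) * norm (z $ 3) * x $ 3"
        unfolding norm_mult using c0 b by (intro mult_mono nb) simp_all
      ultimately have "norm (Y a x) \<le> (1 / sin \<theta>) * (norm (z $ 1) * (\<kappa> * x $ 3) + norm (z $ 2) * (\<kappa> * x $ 3)) + (1 / cos \<theta>) * norm (z $ 3) * x $ 3"
        unfolding Y_def by (intro order_trans[OF norm_triangle_ineq4] add_mono)
      also have "\<dots> = M * x $ 3" by (simp add: M_def field_simps)
      finally have YM: "norm (Y a x) \<le> M * x $ 3" .
      have "norm (Y a x * exp (cdot (Z a) (cvec x))) \<le> (2 * M / \<mu>) * exp (- (\<mu> / 2) * x $ 3)"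
        by (rule linear_times_exp_bound[OF Zdec[OF a] \<mu> x \<kappa> YM])
      also have "\<dots> \<le> C * exp (- (\<mu> / 2) * x $ 3)"
        by (intro mult_right_mono) (auto simp: C_def)
      finally show ?thesis .
    qed
  qed (use \<mu> th K in auto)
  moreover have "cdot (Z \<theta>) (cvec x) = cdot z (cvec x)" for x
    using s0 c0 by (simp add: cdot_cvec_3)
  moreover have "cdot (Z 0) (cvec x) = z $ 3 / of_real (cos \<theta>) * of_real (x $ 3)" for x
    by (simp add: cdot_cvec_3)
  ultimately show ?thesis by (simp add: \<kappa>_def)
qed

section \<open>Dilations and nonvanishing of the cone integral\<close>

lemma cone_integral_dilate:
  assumes c: "c > 0" and f: "f \<in> borel_measurable borel"
  shows "of_real (c ^ 3) * cone_integral \<kappa> (\<lambda>x. f (c *\<^sub>R x)) = cone_integral \<kappa> f"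
proof -
  let ?V = "indicator (std_cone \<kappa>) :: real^3 \<Rightarrow> real"
  have [measurable]: "f \<in> borel_measurable borel" by (rule f)
  have Vc: "?V (c *\<^sub>R x) = ?V x" for x
  proof -
    have "(c * x $ 1)\<^sup>2 + (c * x $ 2)\<^sup>2 < (\<kappa> * (c * x $ 3))\<^sup>2 \<longleftrightarrow> c\<^sup>2 * ((x $ 1)\<^sup>2 + (x $ 2)\<^sup>2) < c\<^sup>2 * (\<kappa> * x $ 3)\<^sup>2"
      by (simp add: power_mult_distrib distrib_left mult_ac)
    also have "\<dots> \<longleftrightarrow> (x $ 1)\<^sup>2 + (x $ 2)\<^sup>2 < (\<kappa> * x $ 3)\<^sup>2" using c by simp
    finally show ?thesis using c by (simp add: std_cone_def indicator_def zero_less_mult_iff)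
  qed
  have "cone_integral \<kappa> f = (LINT x|density (distr lborel borel (\<lambda>x. 0 + c *\<^sub>R x)) (\<lambda>_. ennreal (\<bar>c\<bar> ^ DIM(real^3))). ?V x *\<^sub>R f x)"
    unfolding cone_integral_def using lborel_affine[of c "0 :: real^3"] c by simp
  also have "\<dots> = (LINT x|distr lborel borel (\<lambda>x. 0 + c *\<^sub>R x). (\<bar>c\<bar> ^ DIM(real^3)) *\<^sub>R (?V x *\<^sub>R f x))"
    by (subst integral_density) auto
  also have "\<dots> = (LINT x|lborel. (\<bar>c\<bar> ^ DIM(real^3)) *\<^sub>R (?V (c *\<^sub>R x) *\<^sub>R f (c *\<^sub>R x)))"
    by (subst integral_distr) auto
  also have "\<dots> = (LINT x|lborel. of_real (c ^ 3) * (?V x *\<^sub>R f (c *\<^sub>R x)))"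
    unfolding Vc using c by (intro Bochner_Integration.integral_cong refl) (simp add: scaleR_conv_of_real)
  also have "\<dots> = of_real (c ^ 3) * cone_integral \<kappa> (\<lambda>x. f (c *\<^sub>R x))"
    by (simp only: integral_mult_right_zero cone_integral_def)
  finally show ?thesis ..
qed

text \<open>The integral of \<open>e\<^bsup>3s\<^esup> f(e\<^sup>s x)\<close> over the cone does not depend on \<open>s\<close>; differentiate at \<open>s = 0\<close> for
\<open>f(x) = e\<^bsup>c x3\<^esup>\<close>.\<close>
lemma dilation_identity:
  assumes \<kappa>: "\<kappa> > 0" and c: "Re c < 0"
  shows "cone_integral \<kappa> (\<lambda>x. (3 + c * of_real (x $ 3)) * exp (c * of_real (x $ 3))) = 0"
proof -
  define \<mu> where "\<mu> = - Re c"
  have \<mu>: "\<mu> > 0" using c by (simp add: \<mu>_def)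
  define g where "g x = (3 + c * of_real (x $ 3)) * exp (c * of_real (x $ 3))" for x :: "real^3"
  define f where "f x = exp (c * of_real (x $ 3))" for x :: "real^3"
  have gm: "g \<in> borel_measurable borel" and fm: "f \<in> borel_measurable borel"
    unfolding g_def f_def by (intro borel_measurable_continuous_onI continuous_intros)+
  have nf: "norm (f x) = exp (- \<mu> * x $ 3)" for x by (simp add: f_def \<mu>_def)
  have e3: "exp (3 * s) = (exp s) ^ 3" for s :: real using exp_of_nat_mult[of 3 s] by simp
  have inv: "cone_integral \<kappa> (\<lambda>x. of_real (exp (3 * s)) * h (exp s *\<^sub>R x)) = cone_integral \<kappa> h"
    if "h \<in> borel_measurable borel" for h s
    unfolding cone_integral_cmult e3 by (rule cone_integral_dilate[OF _ that]) simp
  define C where "C = exp 3 * (3 + 2 * (norm c * exp 1) / \<mu>)"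
  have C: "C \<ge> exp 3" using mult_left_mono[of 1 "3 + 2 * (norm c * exp 1) / \<mu>" "exp 3"] \<mu> by (simp add: C_def)
  have C0: "C \<ge> 0" by (rule order_trans[OF _ C]) simp
  have decay: "exp (- \<mu> * (exp s * t)) \<le> exp (- \<mu> * t)" if "0 \<le> s" "t > 0" for s t
    using that \<mu> by (simp add: mult_left_mono)
  have Ele: "norm (of_real (exp (3 * s)) * f (exp s *\<^sub>R x)) \<le> C * exp (- (\<mu> / 2) * x $ 3)"
    if x: "x \<in> std_cone \<kappa>" and s: "0 \<le> s" "s \<le> 1" for x s
  proof -
    have t: "x $ 3 > 0" using std_cone_bounds[OF x \<kappa>] by simp
    have "norm (of_real (exp (3 * s)) * f (exp s *\<^sub>R x)) = exp (3 * s) * exp (- \<mu> * (exp s * x $ 3))"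
      unfolding norm_mult nf by simp
    also have "\<dots> \<le> exp 3 * exp (- \<mu> * x $ 3)"
      using s by (intro mult_mono decay t) auto
    also have "\<dots> \<le> C * exp (- (\<mu> / 2) * x $ 3)"
      using C C0 t \<mu> by (intro mult_mono) auto
    finally show ?thesis .
  qed
  have "cone_integral \<kappa> (\<lambda>x. of_real (exp (3 * 1)) * f (exp 1 *\<^sub>R x)) - cone_integral \<kappa> (\<lambda>x. of_real (exp (3 * 0)) * f (exp 0 *\<^sub>R x))
    = of_real 1 * cone_integral \<kappa> g"
  proof (rule cone_integral_flow[OF \<kappa>, where E' = "\<lambda>x s. of_real (exp (3 * s)) * g (exp s *\<^sub>R x)" and C = C and \<mu> = "\<mu> / 2"])
    show "((\<lambda>s. of_real (exp (3 * s)) * f (exp s *\<^sub>R x)) has_vector_derivative of_real (exp (3 * s)) * g (exp s *\<^sub>R x)) (at s)" for x s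
    proof -
      have 1: "((\<lambda>s. exp (3 * s)) has_real_derivative 3 * exp (3 * s)) (at s)"
        by (auto intro!: derivative_eq_intros)
      have 2: "((\<lambda>s. exp s * x $ 3) has_real_derivative exp s * x $ 3) (at s)"
        by (auto intro!: derivative_eq_intros)
      have "((\<lambda>s. c * of_real (exp s * x $ 3)) has_vector_derivative c * of_real (exp s * x $ 3)) (at s)"
        by (intro has_vector_derivative_mult_right has_vector_derivative_of_real 2)
      from field_vector_diff_chain_at[OF this DERIV_exp]
      have 3: "((\<lambda>s. exp (c * of_real (exp s * x $ 3))) has_vector_derivative
          c * of_real (exp s * x $ 3) * exp (c * of_real (exp s * x $ 3))) (at s)"
        by (simp only: o_def)
      have "((\<lambda>s. of_real (exp (3 * s)) * exp (c * of_real (exp s * x $ 3))) has_vector_derivative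
         of_real (exp (3 * s)) * (c * of_real (exp s * x $ 3) * exp (c * of_real (exp s * x $ 3))) +
         of_real (3 * exp (3 * s)) * exp (c * of_real (exp s * x $ 3))) (at s)"
        by (intro has_vector_derivative_mult has_vector_derivative_of_real 1 3)
      then show ?thesis by (simp add: f_def g_def algebra_simps)
    qed
    show "continuous_on UNIV (\<lambda>x. of_real (exp (3 * s)) * f (exp s *\<^sub>R x))" for s
      unfolding f_def by (intro continuous_intros)
    show "continuous_on UNIV (\<lambda>q. of_real (exp (3 * snd q)) * g (exp (snd q) *\<^sub>R fst q))"
      unfolding g_def by (intro continuous_intros)
    show "norm (of_real (exp (3 * s)) * f (exp s *\<^sub>R x)) \<le> C * exp (- (\<mu> / 2) * x $ 3)"
      if "x \<in> std_cone \<kappa>" "0 \<le> s" "s \<le> 1" for x s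
      by (rule Ele[OF that])
    show "norm (of_real (exp (3 * s)) * g (exp s *\<^sub>R x)) \<le> C * exp (- (\<mu> / 2) * x $ 3)"
      if x: "x \<in> std_cone \<kappa>" and s: "0 \<le> s" "s \<le> 1" for x s
    proof -
      have t: "x $ 3 > 0" using std_cone_bounds[OF x \<kappa>] by simp
      have "norm (3 + c * of_real (exp s * x $ 3)) \<le> 3 + norm c * (exp s * x $ 3)"
        using t by (intro norm_triangle_le) (simp add: norm_mult)
      also have "\<dots> \<le> 3 + norm c * (exp 1 * x $ 3)"
        using t s by (intro add_left_mono mult_left_mono mult_right_mono) auto
      finally have n1: "norm (3 + c * of_real (exp s * x $ 3)) \<le> 3 + norm c * exp 1 * x $ 3" by simp
      have n2: "norm (exp (c * of_real (exp s * x $ 3))) \<le> exp (- \<mu> * x $ 3)"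
        using decay[OF s(1) t] by (simp add: \<mu>_def)
      have "norm (of_real (exp (3 * s)) * g (exp s *\<^sub>R x)) =
          exp (3 * s) * (norm (3 + c * of_real (exp s * x $ 3)) * norm (exp (c * of_real (exp s * x $ 3))))"
        unfolding g_def norm_mult by simp
      also have "\<dots> \<le> exp 3 * ((3 + norm c * exp 1 * x $ 3) * exp (- \<mu> * x $ 3))"
        using s t by (intro mult_mono n1 n2) auto
      also have "\<dots> \<le> exp 3 * ((3 + 2 * (norm c * exp 1) / \<mu>) * exp (- (\<mu> / 2) * x $ 3))"
        using t \<mu> by (intro mult_left_mono affine_times_exp_bound) auto
      finally show ?thesis by (simp add: C_def)
    qed
    show "cone_integral \<kappa> (\<lambda>x. of_real (exp (3 * s)) * g (exp s *\<^sub>R x)) = cone_integral \<kappa> g" for s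
      by (rule inv[OF gm])
  qed (use \<mu> in auto)
  then have "cone_integral \<kappa> g = 0" unfolding inv[OF fm] by simp
  then show ?thesis by (simp add: g_def[abs_def])
qed

lemma cone_integral_exp_minus_nonzero:
  assumes \<kappa>: "\<kappa> > 0"
  shows "cone_integral \<kappa> (\<lambda>x. exp (- of_real (x $ 3))) \<noteq> 0"
proof -
  let ?f = "\<lambda>x::real^3. indicator (std_cone \<kappa>) x *\<^sub>R exp (- (x $ 3)) :: real"
  have int: "integrable lborel ?f"
    by (rule integrable_std_cone[OF \<kappa>, of 1 _ 1]) (auto intro!: borel_measurable_continuous_onI continuous_intros)
  have "cone_integral \<kappa> (\<lambda>x. exp (- of_real (x $ 3))) = (LINT x|lborel. of_real (?f x))"
    unfolding cone_integral_def
    by (intro Bochner_Integration.integral_cong refl) (simp add: scaleR_conv_of_real exp_of_real[symmetric])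
  also have "\<dots> = of_real (LINT x|lborel. ?f x)" by (rule integral_complex_of_real)
  finally have eq: "cone_integral \<kappa> (\<lambda>x. exp (- of_real (x $ 3))) = of_real (LINT x|lborel. ?f x)" .
  have "(LINT x|lborel. ?f x) \<noteq> 0"
  proof
    assume "(LINT x|lborel. ?f x) = 0"
    then have "AE x in lborel. ?f x = 0"
      by (subst (asm) integral_nonneg_eq_0_iff_AE[OF int]) auto
    then have "AE x in lborel. x \<in> std_cone \<kappa> \<longrightarrow> x \<in> {}"
      by eventually_elim (auto simp: indicator_def split: if_splits)
    then have "AE x \<in> std_cone \<kappa> in lebesgue. x \<in> {}" by (rule AE_completion)
    moreover have "axis 3 1 \<in> std_cone \<kappa>" using \<kappa> by (simp add: std_cone_def axis_def)
    ultimately show False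
      using mem_closed_if_AE_lebesgue_open[OF open_std_cone closed_empty] by blast
  qed
  then show ?thesis unfolding eq by simp
qed

text \<open>By the dilation identity the derivative of \<open>\<gamma>\<^sup>3 \<integral> e\<^bsup>\<gamma> x3\<^esup>\<close> with respect to \<open>\<gamma>\<close> is zero. The segment from
\<open>-1\<close> to \<open>c\<close> stays in the half plane where the integral converges.\<close>
lemma cone_integral_axis_nonzero:
  assumes \<kappa>: "\<kappa> > 0" and c: "Re c < 0"
  shows "cone_integral \<kappa> (\<lambda>x. exp (c * of_real (x $ 3))) \<noteq> 0"
proof -
  define \<mu> where "\<mu> = min 1 (- Re c)"
  have \<mu>: "\<mu> > 0" using c by (simp add: \<mu>_def)
  define \<gamma> where "\<gamma> s = - 1 + of_real s * (c + 1)" for s :: real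
  have Re\<gamma>: "Re (\<gamma> s) \<le> - \<mu>" if "0 \<le> s" "s \<le> 1" for s
  proof -
    have "Re (\<gamma> s) = - ((1 - s) * 1 + s * (- Re c))" by (simp add: \<gamma>_def algebra_simps)
    also have "\<dots> \<le> - ((1 - s) * \<mu> + s * \<mu>)"
      using that by (intro le_imp_neg_le add_mono mult_left_mono) (auto simp: \<mu>_def)
    also have "\<dots> = - \<mu>" by (simp add: algebra_simps)
    finally show ?thesis .
  qed
  define L where "L = 1 + norm (c + 1)"
  have L: "L \<ge> 1" by (simp add: L_def)
  have \<gamma>L: "norm (\<gamma> s) \<le> L" if "0 \<le> s" "s \<le> 1" for s
  proof -
    have "norm (\<gamma> s) \<le> norm (- 1 :: complex) + norm (of_real s * (c + 1))"
      unfolding \<gamma>_def by (rule norm_triangle_ineq)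
    also have "\<dots> \<le> L" using that by (simp add: L_def norm_mult mult_left_le_one_le)
    finally show ?thesis .
  qed
  define g where "g s x = (3 + \<gamma> s * of_real (x $ 3)) * exp (\<gamma> s * of_real (x $ 3))" for s and x :: "real^3"
  define C where "C = L ^ 3 * (3 + 2 * L / \<mu>)"
  have C: "C \<ge> L ^ 3" using mult_left_mono[of 1 "3 + 2 * L / \<mu>" "L ^ 3"] \<mu> L by (simp add: C_def)
  have C0: "C \<ge> 0" by (rule order_trans[OF _ C]) (use L in simp)
  have ne: "norm (exp (\<gamma> s * of_real (x $ 3))) \<le> exp (- \<mu> * x $ 3)"
    if x: "x \<in> std_cone \<kappa>" and s: "0 \<le> s" "s \<le> 1" for x s
    using mult_right_mono[OF Re\<gamma>[OF s], of "x $ 3"] std_cone_bounds(1)[OF x \<kappa>] by simp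
  have Ele: "norm (\<gamma> s ^ 3 * exp (\<gamma> s * of_real (x $ 3))) \<le> C * exp (- (\<mu> / 2) * x $ 3)"
    if x: "x \<in> std_cone \<kappa>" and s: "0 \<le> s" "s \<le> 1" for x s
  proof -
    have t: "x $ 3 > 0" using std_cone_bounds[OF x \<kappa>] by simp
    have "norm (\<gamma> s ^ 3 * exp (\<gamma> s * of_real (x $ 3))) \<le> L ^ 3 * exp (- \<mu> * x $ 3)"
      unfolding norm_mult norm_power using L by (intro mult_mono ne[OF x s] power_mono \<gamma>L s) auto
    also have "\<dots> \<le> C * exp (- (\<mu> / 2) * x $ 3)"
      using C C0 L t \<mu> by (intro mult_mono) auto
    finally show ?thesis .
  qed
  have "cone_integral \<kappa> (\<lambda>x. \<gamma> 1 ^ 3 * exp (\<gamma> 1 * of_real (x $ 3))) - cone_integral \<kappa> (\<lambda>x. \<gamma> 0 ^ 3 * exp (\<gamma> 0 * of_real (x $ 3)))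
    = of_real 1 * 0"
  proof (rule cone_integral_flow[OF \<kappa>, where E' = "\<lambda>x s. ((c + 1) * \<gamma> s ^ 2) * g s x" and C = C and \<mu> = "\<mu> / 2"])
    show "((\<lambda>s. \<gamma> s ^ 3 * exp (\<gamma> s * of_real (x $ 3))) has_vector_derivative ((c + 1) * \<gamma> s ^ 2) * g s x) (at s)" for x s
    proof -
      define t where "t = complex_of_real (x $ 3)"
      have "((\<lambda>s. of_real s * (c + 1)) has_vector_derivative of_real 1 * (c + 1)) (at s)"
        by (intro has_vector_derivative_mult_left has_vector_derivative_of_real) simp
      then have \<gamma>d: "(\<gamma> has_vector_derivative (c + 1)) (at s)"
        unfolding \<gamma>_def[abs_def] by (auto intro!: derivative_eq_intros)
      have "((\<lambda>w. w ^ 3 * exp (w * t)) has_field_derivative \<gamma> s ^ 2 * (3 + \<gamma> s * t) * exp (\<gamma> s * t)) (at (\<gamma> s))"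
        by (auto intro!: derivative_eq_intros simp: algebra_simps power2_eq_square power3_eq_cube)
      from field_vector_diff_chain_at[OF \<gamma>d this]
      show ?thesis by (simp add: o_def g_def t_def mult_ac)
    qed
    show "continuous_on UNIV (\<lambda>x. \<gamma> s ^ 3 * exp (\<gamma> s * of_real (x $ 3)))" for s
      by (intro continuous_intros)
    show "continuous_on UNIV (\<lambda>q. ((c + 1) * \<gamma> (snd q) ^ 2) * g (snd q) (fst q))"
      unfolding g_def \<gamma>_def by (intro continuous_intros)
    show "norm (\<gamma> s ^ 3 * exp (\<gamma> s * of_real (x $ 3))) \<le> C * exp (- (\<mu> / 2) * x $ 3)"
      if "x \<in> std_cone \<kappa>" "0 \<le> s" "s \<le> 1" for x s
      by (rule Ele[OF that])
    show "norm (((c + 1) * \<gamma> s ^ 2) * g s x) \<le> C * exp (- (\<mu> / 2) * x $ 3)"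
      if x: "x \<in> std_cone \<kappa>" and s: "0 \<le> s" "s \<le> 1" for x s
    proof -
      have t: "x $ 3 > 0" using std_cone_bounds[OF x \<kappa>] by simp
      have "norm (3 + \<gamma> s * of_real (x $ 3)) \<le> 3 + norm (\<gamma> s) * x $ 3"
        using t by (intro norm_triangle_le) (simp add: norm_mult)
      also have "\<dots> \<le> 3 + L * x $ 3"
        using t \<gamma>L[OF s] by (intro add_left_mono mult_right_mono) auto
      finally have n1: "norm (3 + \<gamma> s * of_real (x $ 3)) \<le> 3 + L * x $ 3" .
      have n0: "norm ((c + 1) * \<gamma> s ^ 2) \<le> L * L ^ 2"
        unfolding norm_mult norm_power using L by (intro mult_mono power_mono \<gamma>L s) (auto simp: L_def)
      have "norm (((c + 1) * \<gamma> s ^ 2) * g s x) \<le> (L * L ^ 2) * ((3 + L * x $ 3) * exp (- \<mu> * x $ 3))"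
        unfolding g_def norm_mult[of "_ * _ ^ 2"] norm_mult[of "3 + _"]
        using L t by (intro mult_mono n0 n1 ne[OF x s]) auto
      also have "\<dots> \<le> (L * L ^ 2) * ((3 + 2 * L / \<mu>) * exp (- (\<mu> / 2) * x $ 3))"
        using t \<mu> L by (intro mult_left_mono affine_times_exp_bound) auto
      finally show ?thesis by (simp add: C_def power3_eq_cube power2_eq_square mult_ac)
    qed
    show "cone_integral \<kappa> (\<lambda>x. ((c + 1) * \<gamma> s ^ 2) * g s x) = 0" if "0 \<le> s" "s \<le> 1" for s
    proof -
      have "Re (\<gamma> s) < 0" using Re\<gamma>[OF that] \<mu> by linarith
      from dilation_identity[OF \<kappa> this] show ?thesis
        unfolding cone_integral_cmult g_def by simp
    qed
  qed (use \<mu> in auto)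
  then have "c ^ 3 * cone_integral \<kappa> (\<lambda>x. exp (c * of_real (x $ 3))) +
      cone_integral \<kappa> (\<lambda>x. exp (- of_real (x $ 3))) = 0"
    unfolding cone_integral_cmult by (simp add: \<gamma>_def)
  then show ?thesis using cone_integral_exp_minus_nonzero[OF \<kappa>] by auto
qed

theorem cone_integral_null_exp_nonzero:
  assumes th: "0 < \<theta>" "\<theta> < pi / 2" and \<mu>: "\<mu> > 0"
    and dec: "cone_decay (tan \<theta>) \<mu> z" and null: "cdot z z = 0"
  shows "cone_integral (tan \<theta>) (\<lambda>x. exp (cdot z (cvec x))) \<noteq> 0"
proof -
  have c0: "cos \<theta> > 0" and \<kappa>: "tan \<theta> > 0" using th by (auto intro: cos_gt_zero simp: tan_gt_zero)
  have "axis 3 1 \<in> std_cone (tan \<theta>)" using \<kappa> by (simp add: std_cone_def axis_def)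
  then have "Re (z $ 3) \<le> - \<mu>" using dec by (auto simp: cone_decay_def cdot_cvec_3 axis_def dest!: bspec)
  then have "Re (z $ 3 / of_real (cos \<theta>)) < 0" using \<mu> c0 by (simp add: divide_neg_pos)
  from cone_integral_axis_nonzero[OF \<kappa> this] show ?thesis
    unfolding cone_integral_rotate_to_axis[OF th \<mu> dec null] .
qed

section \<open>Asymptotics at the vertex\<close>

lemma orthonormal_frame_exists:
  assumes "norm m = 1"
  obtains a b where "orthonormal_frame a b m"
proof -
  obtain f :: "real^3 \<Rightarrow> real^3" where f: "orthogonal_transformation f" "f (axis 3 1) = m"
    using orthogonal_transformation_exists[of "axis 3 1 :: real^3" m] assms by auto
  have "f x \<bullet> f y = x \<bullet> y" for x y using f(1) by (simp add: orthogonal_transformation_def)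
  moreover have "norm (f x) = norm x" for x using f(1) by (rule orthogonal_transformation_norm)
  ultimately have "orthonormal_frame (f (axis 1 1)) (f (axis 2 1)) m"
    unfolding orthonormal_frame_def f(2)[symmetric] by (simp add: inner_axis_axis)
  then show ?thesis by (rule that)
qed

lemma frame_vec_in_cone:
  assumes fr: "orthonormal_frame a b m" and th: "0 < \<theta>" "\<theta> < pi / 2"
  shows "frame_vec a b m y \<in> cone_at 0 m \<theta> \<longleftrightarrow> y \<in> std_cone (tan \<theta>)"
proof -
  have c0: "cos \<theta> > 0" using th by (intro cos_gt_zero) auto
  have "frame_vec a b m y \<bullet> m = y $ 3"
    using orthonormal_frame_inner[OF fr] by (simp add: frame_vec_def inner_simps)
  then have "frame_vec a b m y \<in> cone_at 0 m \<theta> \<longleftrightarrow> norm y * cos \<theta> < y $ 3"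
    by (simp add: cone_at_def norm_frame_vec[OF fr])
  also have "\<dots> \<longleftrightarrow> 0 < y $ 3 \<and> (norm y * cos \<theta>)\<^sup>2 < (y $ 3)\<^sup>2"
  proof -
    have "0 \<le> norm y * cos \<theta>" using c0 by simp
    then show ?thesis
      by (meson le_less_trans less_imp_le power2_less_imp_less power_strict_mono zero_less_numeral)
  qed
  also have "(norm y * cos \<theta>)\<^sup>2 < (y $ 3)\<^sup>2 \<longleftrightarrow> (y $ 1)\<^sup>2 + (y $ 2)\<^sup>2 < (tan \<theta> * y $ 3)\<^sup>2"
  proof -
    have n: "(norm y)\<^sup>2 = (y $ 1)\<^sup>2 + (y $ 2)\<^sup>2 + (y $ 3)\<^sup>2"
      unfolding power2_norm_eq_inner by (simp add: inner_vec_def sum_3 power2_eq_square)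
    have s: "(sin \<theta>)\<^sup>2 = 1 - (cos \<theta>)\<^sup>2" by (simp add: sin_squared_eq)
    have "(y $ 1)\<^sup>2 + (y $ 2)\<^sup>2 < (tan \<theta> * y $ 3)\<^sup>2 \<longleftrightarrow>
       (cos \<theta>)\<^sup>2 * ((y $ 1)\<^sup>2 + (y $ 2)\<^sup>2) < (cos \<theta>)\<^sup>2 * (tan \<theta> * y $ 3)\<^sup>2"
      using c0 by simp
    also have "(cos \<theta>)\<^sup>2 * (tan \<theta> * y $ 3)\<^sup>2 = (1 - (cos \<theta>)\<^sup>2) * (y $ 3)\<^sup>2"
      using c0 by (simp add: tan_def power_mult_distrib power_divide s)
    finally show ?thesis by (simp add: power_mult_distrib n algebra_simps)
  qed
  finally show ?thesis by (simp add: std_cone_def)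
qed

text \<open>Dominated convergence with the majorant \<open>M e\<^bsup>w\<cdot>y\<^esup>\<close>. The function \<open>g\<close> stands for the density near the vertex, cut off by zero; the factor \<open>\<beta>\<close> is the ratio of
the two lengths \<open>(\<tau>\<^sup>2+k\<^sup>2)\<^bsup>1/2\<^esup>\<close> and \<open>\<tau>\<close>.\<close>
lemma cone_integral_blow_up:
  fixes g :: "real^3 \<Rightarrow> complex"
  assumes \<kappa>: "\<kappa> > 0" and \<mu>: "\<mu> > 0" and g: "g \<in> borel_measurable borel" "\<And>x. norm (g x) \<le> M" "isCont g 0"
    and dec: "\<And>x. x \<in> std_cone \<kappa> \<Longrightarrow> w \<bullet> x \<le> - \<mu> * x $ 3" and \<beta>: "(\<beta> \<longlongrightarrow> 1) at_top"
  shows "((\<lambda>\<tau>. cone_integral \<kappa> (\<lambda>y. g ((1 / \<tau>) *\<^sub>R y) * exp (of_real (w \<bullet> y) + \<i> * of_real (\<beta> \<tau> * (t \<bullet> y))))) \<longlongrightarrow>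
      g 0 * cone_integral \<kappa> (\<lambda>y. exp (of_real (w \<bullet> y) + \<i> * of_real (t \<bullet> y)))) at_top"
proof -
  have [measurable]: "g \<in> borel_measurable borel" by (rule g)
  have 1: "((\<lambda>\<tau>. cone_integral \<kappa> (\<lambda>y. g ((1 / \<tau>) *\<^sub>R y) * exp (of_real (w \<bullet> y) + \<i> * of_real (\<beta> \<tau> * (t \<bullet> y))))) \<longlongrightarrow>
     cone_integral \<kappa> (\<lambda>y. g 0 * exp (of_real (w \<bullet> y) + \<i> * of_real (1 * (t \<bullet> y))))) at_top"
    unfolding cone_integral_def
  proof (rule integral_dominated_convergence_at_top)
    have M: "M \<ge> 0" using g(2)[of 0] norm_ge_zero order_trans by blast
    show "integrable lborel (\<lambda>y. indicator (std_cone \<kappa>) y *\<^sub>R (M * exp (w \<bullet> y)))"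
    proof (rule integrable_std_cone[OF \<kappa> \<mu>, of _ M])
      show "norm (M * exp (w \<bullet> x)) \<le> M * exp (- \<mu> * x $ 3)" if "x \<in> std_cone \<kappa>" for x
        using M dec[OF that] by (simp add: abs_mult mult_left_mono)
    qed (intro borel_measurable_continuous_onI continuous_intros)
    show "\<forall>\<^sub>F \<tau> in at_top. AE y in lborel. norm (indicator (std_cone \<kappa>) y *\<^sub>R (g ((1 / \<tau>) *\<^sub>R y) *
        exp (of_real (w \<bullet> y) + \<i> * of_real (\<beta> \<tau> * (t \<bullet> y))))) \<le> indicator (std_cone \<kappa>) y *\<^sub>R (M * exp (w \<bullet> y))"
      using g(2) by (intro always_eventually allI AE_I2) (simp add: norm_mult mult_right_mono split: split_indicator)
    show "AE y in lborel. ((\<lambda>\<tau>. indicator (std_cone \<kappa>) y *\<^sub>R (g ((1 / \<tau>) *\<^sub>R y) *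
        exp (of_real (w \<bullet> y) + \<i> * of_real (\<beta> \<tau> * (t \<bullet> y))))) \<longlongrightarrow>
        indicator (std_cone \<kappa>) y *\<^sub>R (g 0 * exp (of_real (w \<bullet> y) + \<i> * of_real (1 * (t \<bullet> y))))) at_top"
    proof (rule AE_I2)
      fix y :: "real^3"
      have "((\<lambda>\<tau>::real. inverse \<tau>) \<longlongrightarrow> 0) at_top" by (rule tendsto_inverse_0_at_top[OF filterlim_ident])
      then have "((\<lambda>\<tau>::real. (1 / \<tau>) *\<^sub>R y) \<longlongrightarrow> 0 *\<^sub>R y) at_top"
        by (intro tendsto_intros) (simp add: divide_inverse)
      then have "((\<lambda>\<tau>. g ((1 / \<tau>) *\<^sub>R y)) \<longlongrightarrow> g 0) at_top"
        using isCont_tendsto_compose[OF g(3)] by simp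
      then show "((\<lambda>\<tau>. indicator (std_cone \<kappa>) y *\<^sub>R (g ((1 / \<tau>) *\<^sub>R y) *
        exp (of_real (w \<bullet> y) + \<i> * of_real (\<beta> \<tau> * (t \<bullet> y))))) \<longlongrightarrow>
        indicator (std_cone \<kappa>) y *\<^sub>R (g 0 * exp (of_real (w \<bullet> y) + \<i> * of_real (1 * (t \<bullet> y))))) at_top"
        by (intro tendsto_intros \<beta>)
    qed
  qed measurable
  then show ?thesis by (simp only: cone_integral_cmult mult_1)
qed

lemma inner_le_support_fun:
  assumes bd: "bounded D" and x: "x \<in> closure D"
  shows "x \<bullet> \<omega> \<le> support_fun D \<omega>"
proof -
  obtain B where B: "\<And>x. x \<in> D \<Longrightarrow> norm x \<le> B" using bd by (auto simp: bounded_iff)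
  have "x \<bullet> \<omega> \<le> B * norm \<omega>" if "x \<in> D" for x
    using norm_cauchy_schwarz[of x \<omega>] mult_right_mono[OF B[OF that] norm_ge_zero[of \<omega>]] by linarith
  then have bdd: "bdd_above ((\<lambda>x. x \<bullet> \<omega>) ` D)" by (intro bdd_aboveI2)
  have "D \<subseteq> {x. x \<bullet> \<omega> \<le> support_fun D \<omega>}"
    unfolding support_fun_def using cSUP_upper[OF _ bdd] by auto
  then have "closure D \<subseteq> {x. x \<bullet> \<omega> \<le> support_fun D \<omega>}"
    by (rule closure_minimal) (intro closed_Collect_le continuous_intros)
  then show ?thesis using x by blast
qed

text \<open>Every direction in the closed cone leads from \<open>p\<close> to other points of the closure of \<open>D\<close>, where \<open>x\<cdot>\<omega>\<close> is
strictly smaller than at \<open>p\<close>. Compactness of the set of unit directions makes this uniform.\<close>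
lemma cone_decay_geometry:
  assumes p: "{x \<in> closure D. x \<bullet> \<omega> = support_fun D \<omega>} = {p}"
    and bd: "bounded D"
    and cone: "\<epsilon> > 0" "norm m = 1" "0 < \<theta>" "\<theta> < pi / 2" "D \<inter> ball p \<epsilon> = cone_at p m \<theta> \<inter> ball p \<epsilon>"
  obtains \<mu> where "\<mu> > 0" "\<And>y. y \<in> cone_at 0 m \<theta> \<Longrightarrow> y \<bullet> \<omega> \<le> - \<mu> * norm y"
proof -
  note le = inner_le_support_fun[OF bd, of _ \<omega>]
  have pc: "p \<in> closure D" "p \<bullet> \<omega> = support_fun D \<omega>" using p by auto
  define S where "S = {y. norm y = 1 \<and> cos \<theta> \<le> y \<bullet> m}"
  have c1: "cos \<theta> < 1" using cone cos_monotone_0_pi[of 0 \<theta>] by simp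
  have c0: "cos \<theta> > 0" using cone by (intro cos_gt_zero) auto
  have neg: "y \<bullet> \<omega> < 0" if y: "y \<in> S" for y
  proof -
    define t where "t = \<epsilon> / 2"
    have t: "t > 0" "t < \<epsilon>" using cone by (auto simp: t_def)
    have "p + t *\<^sub>R y \<in> closure D"
      unfolding closure_approachable
    proof (intro allI impI)
      fix e :: real assume e: "e > 0"
      define \<delta> where "\<delta> = min e (\<epsilon> / 2) / 2"
      have \<delta>: "\<delta> > 0" "\<delta> < e" "t + \<delta> < \<epsilon>" using e cone(1) by (auto simp: \<delta>_def t_def)
      let ?x = "p + t *\<^sub>R y + \<delta> *\<^sub>R m"
      have nx: "norm (t *\<^sub>R y + \<delta> *\<^sub>R m) \<le> t + \<delta>"
        using y t \<delta> cone(2) by (intro norm_triangle_le) (simp add: S_def)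
      have "norm (t *\<^sub>R y + \<delta> *\<^sub>R m) * cos \<theta> \<le> (t + \<delta>) * cos \<theta>"
        using nx c0 by (intro mult_right_mono) auto
      also have "\<dots> < t * cos \<theta> + \<delta>" using c1 \<delta> by (simp add: distrib_right)
      also have "\<dots> \<le> t * (y \<bullet> m) + \<delta>" using y t by (simp add: S_def)
      also have "\<dots> = (t *\<^sub>R y + \<delta> *\<^sub>R m) \<bullet> m"
        using cone(2) by (simp add: inner_simps norm_eq_1)
      finally have "?x \<in> cone_at p m \<theta>" by (simp add: cone_at_def add.assoc)
      moreover have "?x \<in> ball p \<epsilon>"
      proof -
        have "dist ?x p = norm (t *\<^sub>R y + \<delta> *\<^sub>R m)"
          unfolding dist_norm by (rule arg_cong[of _ _ norm]) simp
        then have "dist p ?x < \<epsilon>" unfolding dist_commute[of p] using nx \<delta> by linarith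
        then show ?thesis by simp
      qed
      ultimately have "?x \<in> D" using cone(5) by blast
      moreover have "dist ?x (p + t *\<^sub>R y) < e"
        using \<delta> cone(2) by (simp add: dist_norm)
      ultimately show "\<exists>x\<in>D. dist x (p + t *\<^sub>R y) < e" by blast
    qed
    moreover have "p + t *\<^sub>R y \<noteq> p" using y t by (auto simp: S_def)
    ultimately have "(p + t *\<^sub>R y) \<bullet> \<omega> < p \<bullet> \<omega>"
      using le[of "p + t *\<^sub>R y"] p pc by force
    then show ?thesis using t by (simp add: inner_simps mult_less_0_iff)
  qed
  have "compact S"
  proof -
    have "S = sphere 0 1 \<inter> {y. cos \<theta> \<le> y \<bullet> m}" by (auto simp: S_def)
    moreover have "closed {y. cos \<theta> \<le> y \<bullet> m}" by (intro closed_Collect_le continuous_intros)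
    ultimately show ?thesis by (simp add: compact_Int_closed)
  qed
  moreover have "m \<in> S" using cone c1 by (simp add: S_def norm_eq_1)
  moreover have "continuous_on S (\<lambda>y. y \<bullet> \<omega>)" by (intro continuous_intros)
  ultimately obtain y0 where y0: "y0 \<in> S" "\<And>y. y \<in> S \<Longrightarrow> y \<bullet> \<omega> \<le> y0 \<bullet> \<omega>"
    using continuous_attains_sup[of S "\<lambda>y. y \<bullet> \<omega>"] by blast
  show ?thesis
  proof (rule that[of "- (y0 \<bullet> \<omega>)"])
    show "0 < - (y0 \<bullet> \<omega>)" using neg[OF y0(1)] by simp
    fix y assume y: "y \<in> cone_at 0 m \<theta>"
    then have y': "norm y * cos \<theta> < y \<bullet> m" by (simp add: cone_at_def)
    then have n: "norm y > 0" by auto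
    have "cos \<theta> \<le> (y \<bullet> m) / norm y" using y' n by (simp add: field_simps)
    then have "(1 / norm y) *\<^sub>R y \<in> S" using n by (simp add: S_def)
    from y0(2)[OF this] show "y \<bullet> \<omega> \<le> - (- (y0 \<bullet> \<omega>)) * norm y"
      using n by (simp add: field_simps)
  qed
qed

lemma far_from_support_point:
  assumes p: "{x \<in> closure D. x \<bullet> \<omega> = support_fun D \<omega>} = {p}"
    and bd: "bounded D" and \<delta>: "\<delta> > 0"
  obtains c where "c > 0" "\<And>x. x \<in> D \<Longrightarrow> x \<notin> ball p \<delta> \<Longrightarrow> (x - p) \<bullet> \<omega> \<le> - c"
proof -
  note le = inner_le_support_fun[OF bd, of _ \<omega>]
  have pc: "p \<bullet> \<omega> = support_fun D \<omega>" using p by auto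
  define S where "S = closure D - ball p \<delta>"
  have S: "compact S" using bd by (simp add: S_def compact_diff compact_closure)
  have neg: "(x - p) \<bullet> \<omega> < 0" if "x \<in> S" for x
  proof -
    have "x \<in> closure D" "x \<noteq> p" using that \<delta> by (auto simp: S_def)
    then have "x \<bullet> \<omega> \<noteq> support_fun D \<omega>" using p by blast
    then have "x \<bullet> \<omega> < p \<bullet> \<omega>" using le[OF \<open>x \<in> closure D\<close>] pc by simp
    then show ?thesis by (simp add: inner_diff_left)
  qed
  show ?thesis
  proof (cases "S = {}")
    case True
    then have "D \<subseteq> ball p \<delta>" using closure_subset[of D] unfolding S_def by blast
    then show ?thesis by (intro that[of 1]) auto
  next
    case False
    have "continuous_on S (\<lambda>x. (x - p) \<bullet> \<omega>)" by (intro continuous_intros)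
    then obtain x0 where x0: "x0 \<in> S" "\<And>x. x \<in> S \<Longrightarrow> (x - p) \<bullet> \<omega> \<le> (x0 - p) \<bullet> \<omega>"
      using continuous_attains_sup[OF S False] by blast
    have "(x - p) \<bullet> \<omega> \<le> - (- ((x0 - p) \<bullet> \<omega>))" if "x \<in> D" "x \<notin> ball p \<delta>" for x
      using x0(2)[of x] that closure_subset by (auto simp: S_def)
    then show ?thesis using that[of "- ((x0 - p) \<bullet> \<omega>)"] neg[OF x0(1)] by simp
  qed
qed

lemma orthonormal_frame_Parseval:
  assumes "orthonormal_frame a b e"
  shows "x \<bullet> y = (x \<bullet> a) * (y \<bullet> a) + (x \<bullet> b) * (y \<bullet> b) + (x \<bullet> e) * (y \<bullet> e)"
proof -
  have "x \<bullet> y = x \<bullet> ((y \<bullet> a) *\<^sub>R a + (y \<bullet> b) *\<^sub>R b + (y \<bullet> e) *\<^sub>R e)"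
    using orthonormal_frame_expand[OF assms, of y] by (rule arg_cong)
  then show ?thesis by (simp add: inner_simps mult.commute)
qed

lemma integral_change_frame:
  fixes f :: "real^3 \<Rightarrow> complex"
  assumes fr: "orthonormal_frame a b m" and f: "f \<in> borel_measurable borel" and c: "c > 0"
  shows "(LINT x|lborel. f x) = of_real (c ^ 3) * (LINT y|lborel. f (p + c *\<^sub>R frame_vec a b m y))"
proof -
  note f [measurable]
  have [measurable]: "frame_vec a b m \<in> borel \<rightarrow>\<^sub>M borel"
    by (intro borel_measurable_continuous_onI) (simp add: linear_continuous_on linear_linear linear_frame_vec)
  have "(LINT x|lborel. f x) = (LINT x|density (distr lborel borel (\<lambda>x. p + c *\<^sub>R x)) (\<lambda>_. ennreal (\<bar>c\<bar> ^ DIM(real^3))). f x)"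
    using lborel_affine[of c p] c by simp
  also have "\<dots> = (LINT x|distr lborel borel (\<lambda>x. p + c *\<^sub>R x). (\<bar>c\<bar> ^ DIM(real^3)) *\<^sub>R f x)"
    by (subst integral_density) auto
  also have "\<dots> = (LINT x|lborel. (\<bar>c\<bar> ^ DIM(real^3)) *\<^sub>R f (p + c *\<^sub>R x))"
    by (subst integral_distr) auto
  also have "\<dots> = (LINT x|distr lborel borel (frame_vec a b m). (\<bar>c\<bar> ^ DIM(real^3)) *\<^sub>R f (p + c *\<^sub>R x))"
    by (simp add: distr_frame_vec[OF fr])
  also have "\<dots> = (LINT y|lborel. (\<bar>c\<bar> ^ DIM(real^3)) *\<^sub>R f (p + c *\<^sub>R frame_vec a b m y))"
    by (subst integral_distr) auto
  also have "\<dots> = (LINT y|lborel. of_real (c ^ 3) * f (p + c *\<^sub>R frame_vec a b m y))"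
    using c by (intro Bochner_Integration.integral_cong refl) (simp add: scaleR_conv_of_real)
  finally show ?thesis by (simp only: integral_mult_right_zero)
qed

lemma cone_at_scale:
  assumes "c > 0"
  shows "p + c *\<^sub>R y \<in> cone_at p m \<theta> \<longleftrightarrow> y \<in> cone_at 0 m \<theta>"
proof -
  have "c * (norm y * cos \<theta>) < c * (y \<bullet> m) \<longleftrightarrow> norm y * cos \<theta> < y \<bullet> m" using assms by simp
  then show ?thesis using assms by (simp add: cone_at_def mult.assoc)
qed

lemma tendsto_sqrt_ratio: "((\<lambda>\<tau>::real. sqrt (\<tau>\<^sup>2 + k\<^sup>2) / \<tau>) \<longlongrightarrow> 1) at_top"
proof -
  have "((\<lambda>\<tau>::real. inverse \<tau>) \<longlongrightarrow> 0) at_top" by (rule tendsto_inverse_0_at_top[OF filterlim_ident])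
  then have "((\<lambda>\<tau>::real. sqrt (1 + (k * inverse \<tau>)\<^sup>2)) \<longlongrightarrow> sqrt (1 + (k * 0)\<^sup>2)) at_top"
    by (intro tendsto_intros)
  then have "((\<lambda>\<tau>::real. sqrt (1 + (k * inverse \<tau>)\<^sup>2)) \<longlongrightarrow> 1) at_top" by simp
  moreover have "\<forall>\<^sub>F \<tau> in at_top. sqrt (1 + (k * inverse \<tau>)\<^sup>2) = sqrt (\<tau>\<^sup>2 + k\<^sup>2) / \<tau>"
    using eventually_gt_at_top[of 0]
  proof eventually_elim
    fix \<tau> :: real assume \<tau>: "\<tau> > 0"
    have "1 + (k * inverse \<tau>)\<^sup>2 = (\<tau>\<^sup>2 + k\<^sup>2) / \<tau>\<^sup>2"
      using \<tau> by (simp add: field_simps)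
    then show "sqrt (1 + (k * inverse \<tau>)\<^sup>2) = sqrt (\<tau>\<^sup>2 + k\<^sup>2) / \<tau>"
      using \<tau> by (simp add: real_sqrt_divide)
  qed
  ultimately show ?thesis by (rule Lim_transform_eventually)
qed

definition phase :: "real \<Rightarrow> real^3 \<Rightarrow> real^3 \<Rightarrow> real \<Rightarrow> real^3 \<Rightarrow> complex" where
  "phase k \<omega> \<theta> \<tau> x = of_real (\<tau> * (x \<bullet> \<omega>)) + \<i> * of_real (sqrt (\<tau>\<^sup>2 + k\<^sup>2) * (x \<bullet> \<theta>))"

lemma v_sol_phase: "v_sol k \<omega> \<theta> \<tau> x = exp (phase k \<omega> \<theta> \<tau> x)"
  by (simp add: v_sol_def phase_def cdot_complex_direction)

lemma phase_diff: "phase k \<omega> \<theta> \<tau> (x - y) = phase k \<omega> \<theta> \<tau> x - phase k \<omega> \<theta> \<tau> y"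
  by (simp add: phase_def inner_simps algebra_simps)

lemma norm_exp_phase: "norm (exp (phase k \<omega> \<theta> \<tau> x)) = exp (\<tau> * (x \<bullet> \<omega>))"
  by (simp add: phase_def)

lemma tendsto_power_exp_minus:
  assumes "c > (0::real)"
  shows "((\<lambda>\<tau>. \<tau> ^ n * exp (- (c * \<tau>))) \<longlongrightarrow> 0) at_top"
proof -
  have "((\<lambda>x. x ^ n / exp x) \<longlongrightarrow> 0) (at_top :: real filter)" by (rule tendsto_power_div_exp_0)
  moreover have "filterlim (\<lambda>\<tau>. c * \<tau>) at_top at_top"
    using assms by (intro filterlim_tendsto_pos_mult_at_top[OF tendsto_const _ filterlim_ident])
  ultimately have "((\<lambda>\<tau>. (c * \<tau>) ^ n / exp (c * \<tau>)) \<longlongrightarrow> 0) at_top" by (rule filterlim_compose)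
  then have "((\<lambda>\<tau>. inverse (c ^ n) * ((c * \<tau>) ^ n / exp (c * \<tau>))) \<longlongrightarrow> inverse (c ^ n) * 0) at_top"
    by (intro tendsto_mult tendsto_const)
  moreover have "inverse (c ^ n) * ((c * \<tau>) ^ n / exp (c * \<tau>)) = \<tau> ^ n * exp (- (c * \<tau>))" for \<tau>
    using assms by (simp add: power_mult_distrib exp_minus field_simps)
  ultimately show ?thesis by simp
qed

lemma integrable_mult_indicator_weak:
  fixes f :: "_ \<Rightarrow> 'b::{banach, second_countable_topology}"
  assumes "integrable M f" "A \<inter> space M \<in> sets M"
  shows "integrable M (\<lambda>x. indicator A x *\<^sub>R f x)"
proof -
  have "integrable M (\<lambda>x. indicator (A \<inter> space M) x *\<^sub>R f x)"
    using assms by (intro integrable_mult_indicator)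
  then show ?thesis
    by (rule Bochner_Integration.integrable_cong[THEN iffD1, rotated -1]) (auto split: split_indicator)
qed

text \<open>The situation at the vertex: \<open>m\<close> is the axis of the cone, completed to a frame, \<open>\<phi>\<close> its angle, and \<open>\<mu>\<close>
the rate of decay from \<open>cone_decay_geometry\<close>.\<close>
locale conical_vertex =
  fixes D :: "(real^3) set" and \<omega> p m a b :: "real^3" and \<epsilon> \<phi> \<mu> :: real
  assumes D: "open D" "bounded D"
    and p: "{x \<in> closure D. x \<bullet> \<omega> = support_fun D \<omega>} = {p}"
    and cone: "\<epsilon> > 0" "0 < \<phi>" "\<phi> < pi / 2" "D \<inter> ball p \<epsilon> = cone_at p m \<phi> \<inter> ball p \<epsilon>"
    and fr: "orthonormal_frame a b m"
    and \<mu>: "\<mu> > 0" "\<And>y. y \<in> cone_at 0 m \<phi> \<Longrightarrow> y \<bullet> \<omega> \<le> - \<mu> * norm y"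
begin

definition coords :: "real^3 \<Rightarrow> real^3" where
  "coords w = vector [a \<bullet> w, b \<bullet> w, m \<bullet> w]"

text \<open>The integral of \<open>e\<^bsup>y\<cdot>(\<omega>+i\<theta>)\<^esup>\<close> over the cone, in the coordinates of the frame.\<close>
definition cone_const :: "real^3 \<Rightarrow> complex" where
  "cone_const \<theta> = cone_integral (tan \<phi>) (\<lambda>y. exp (of_real (coords \<omega> \<bullet> y) + \<i> * of_real (coords \<theta> \<bullet> y)))"

lemma cone_frame_inner: "coords w \<bullet> y = frame_vec a b m y \<bullet> w"
  by (simp add: coords_def frame_vec_def inner_vec_def[of "vector _"] sum_3 inner_simps)

lemma cone_frame_decay:
  assumes "y \<in> std_cone (tan \<phi>)"
  shows "coords \<omega> \<bullet> y \<le> - \<mu> * y $ 3"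
proof -
  have y: "frame_vec a b m y \<in> cone_at 0 m \<phi>"
    using assms frame_vec_in_cone[OF fr cone(2,3)] by simp
  have "y $ 3 \<le> norm y" using component_le_norm_cart[of y 3] by simp
  then have "\<mu> * y $ 3 \<le> \<mu> * norm y" using \<mu>(1) by (intro mult_left_mono) auto
  then show ?thesis
    using \<mu>(2)[OF y] unfolding cone_frame_inner norm_frame_vec[OF fr] by linarith
qed

lemma cone_const_nonzero:
  assumes "norm \<omega> = 1" "norm \<theta> = 1" "\<omega> \<bullet> \<theta> = 0"
  shows "cone_const \<theta> \<noteq> 0"
proof -
  define z :: "complex^3" where "z = vector [of_real (a \<bullet> \<omega>) + \<i> * of_real (a \<bullet> \<theta>),
     of_real (b \<bullet> \<omega>) + \<i> * of_real (b \<bullet> \<theta>), of_real (m \<bullet> \<omega>) + \<i> * of_real (m \<bullet> \<theta>)]"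
  have zc: "cdot z (cvec y) = of_real (coords \<omega> \<bullet> y) + \<i> * of_real (coords \<theta> \<bullet> y)" for y
    by (simp add: coords_def cdot_cvec_3 z_def inner_vec_def[of "vector _"] sum_3 algebra_simps)
  note P = orthonormal_frame_Parseval[OF fr]
  have re: "(\<omega> \<bullet> a)\<^sup>2 + (\<omega> \<bullet> b)\<^sup>2 + (\<omega> \<bullet> m)\<^sup>2 = (\<theta> \<bullet> a)\<^sup>2 + (\<theta> \<bullet> b)\<^sup>2 + (\<theta> \<bullet> m)\<^sup>2"
    using P[of \<omega> \<omega>] P[of \<theta> \<theta>] assms by (simp add: norm_eq_1 power2_eq_square)
  have im: "(\<omega> \<bullet> a) * (\<theta> \<bullet> a) + (\<omega> \<bullet> b) * (\<theta> \<bullet> b) + (\<omega> \<bullet> m) * (\<theta> \<bullet> m) = 0"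
    using P[of \<omega> \<theta>] assms by simp
  have "cdot z z = 0"
  proof (rule complex_eqI)
    show "Re (cdot z z) = Re 0"
      using re by (simp add: cdot_def sum_3 z_def inner_commute power2_eq_square)
    show "Im (cdot z z) = Im 0"
      using im by (simp add: cdot_def sum_3 z_def inner_commute algebra_simps)
  qed
  moreover have "cone_decay (tan \<phi>) \<mu> z"
    unfolding cone_decay_def zc using cone_frame_decay by simp
  ultimately have "cone_integral (tan \<phi>) (\<lambda>x. exp (cdot z (cvec x))) \<noteq> 0"
    by (intro cone_integral_null_exp_nonzero[OF cone(2,3) \<mu>(1)])
  then show ?thesis unfolding zc cone_const_def .
qed

text \<open>After division by the value at \<open>p\<close>, the exponential is bounded by \<open>e\<^bsup>-c\<tau>\<^esup>\<close> on the far part of \<open>D\<close>, which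
kills the factor \<open>\<tau>\<^sup>3\<close>. The near part is a cone; the substitution \<open>x = p + y/\<tau>\<close> absorbs \<open>\<tau>\<^sup>3\<close> as its Jacobian.\<close>
lemma source_asymptotics:
  fixes r rt :: "real^3 \<Rightarrow> complex"
  assumes r: "integrable (lebesgue_on D) r" and \<eta>: "\<eta> > 0"
    and rt: "continuous_on (cball p \<eta>) rt"
    and ae: "AE x in lebesgue. x \<in> ball p \<eta> \<inter> D \<longrightarrow> r x = rt x"
  shows "((\<lambda>\<tau>. of_real (\<tau> ^ 3) * exp (- phase k \<omega> \<theta> \<tau> p) *
     (LINT x|lebesgue_on D. r x * exp (phase k \<omega> \<theta> \<tau> x))) \<longlongrightarrow> rt p * cone_const \<theta>) at_top"
proof -
  define \<delta> where "\<delta> = min \<epsilon> \<eta>"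
  have \<delta>: "\<delta> > 0" "\<delta> \<le> \<epsilon>" "\<delta> \<le> \<eta>" using cone(1) \<eta> by (auto simp: \<delta>_def)
  have Db: "D \<in> sets borel" using D by simp
  obtain c where c: "c > 0" "\<And>x. x \<in> D \<Longrightarrow> x \<notin> ball p \<delta> \<Longrightarrow> (x - p) \<bullet> \<omega> \<le> - c"
    using far_from_support_point[OF p D(2) \<delta>(1)] by blast
  have \<kappa>: "tan \<phi> > 0" using cone by (simp add: tan_gt_zero)
  have inD: "x \<in> D \<longleftrightarrow> x \<in> cone_at p m \<phi>" if "x \<in> ball p \<delta>" for x
  proof -
    have "x \<in> ball p \<epsilon>" using that \<delta> by simp
    moreover have "x \<in> D \<inter> ball p \<epsilon> \<longleftrightarrow> x \<in> cone_at p m \<phi> \<inter> ball p \<epsilon>" unfolding cone(4) ..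
    ultimately show ?thesis by blast
  qed
  let ?e = "\<lambda>\<tau> x. exp (phase k \<omega> \<theta> \<tau> (x - p))"
  have ec: "continuous_on S (?e \<tau>)" for S \<tau>
    unfolding phase_def by (intro continuous_intros)
  define near far where "near \<tau> = (LINT x|lebesgue_on D. indicator (ball p \<delta>) x *\<^sub>R (r x * ?e \<tau> x))"
    and "far \<tau> = (LINT x|lebesgue_on D. indicator (- ball p \<delta>) x *\<^sub>R (r x * ?e \<tau> x))" for \<tau>
  have em: "?e \<tau> \<in> borel_measurable (lebesgue_on D)" for \<tau>
    by (intro borel_measurable_lebesgue_on borel_measurable_continuous_onI ec)
  have rm: "r \<in> borel_measurable (lebesgue_on D)" using r by (rule borel_measurable_integrable)
  have re_int: "integrable (lebesgue_on D) (\<lambda>x. r x * ?e \<tau> x)" for \<tau>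
  proof -
    have "bounded (?e \<tau> ` closure D)"
      using D by (intro compact_imp_bounded compact_continuous_image ec) (simp add: compact_closure)
    then obtain B where B: "\<And>x. x \<in> closure D \<Longrightarrow> norm (?e \<tau> x) \<le> B" by (auto simp: bounded_iff)
    show ?thesis
    proof (rule Bochner_Integration.integrable_bound)
      show "integrable (lebesgue_on D) (\<lambda>x. B * norm (r x))" using r by simp
      show "AE x in lebesgue_on D. norm (r x * ?e \<tau> x) \<le> norm (B * norm (r x))"
      proof (rule AE_I2)
        fix x assume "x \<in> space (lebesgue_on D)"
        then have "x \<in> closure D" using closure_subset by auto
        then have "norm (?e \<tau> x) \<le> \<bar>B\<bar>" using B[of x] by linarith
        then have "norm (r x) * norm (?e \<tau> x) \<le> norm (r x) * \<bar>B\<bar>" by (intro mult_left_mono) auto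
        then show "norm (r x * ?e \<tau> x) \<le> norm (B * norm (r x))" by (simp add: norm_mult abs_mult mult.commute)
      qed
    qed (intro borel_measurable_times rm em)
  qed
  have ballm: "ball p \<delta> \<inter> space (lebesgue_on D) \<in> sets (lebesgue_on D)"
    "- ball p \<delta> \<inter> space (lebesgue_on D) \<in> sets (lebesgue_on D)"
    using Db by (auto simp: sets_restrict_space)
  have split: "(LINT x|lebesgue_on D. r x * exp (phase k \<omega> \<theta> \<tau> x)) = exp (phase k \<omega> \<theta> \<tau> p) * (near \<tau> + far \<tau>)" for \<tau>
  proof -
    have "near \<tau> + far \<tau> = (LINT x|lebesgue_on D. indicator (ball p \<delta>) x *\<^sub>R (r x * ?e \<tau> x) + indicator (- ball p \<delta>) x *\<^sub>R (r x * ?e \<tau> x))"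
      unfolding near_def far_def
      by (intro Bochner_Integration.integral_add[symmetric] integrable_mult_indicator_weak re_int ballm)
    also have "\<dots> = (LINT x|lebesgue_on D. r x * ?e \<tau> x)"
      by (intro Bochner_Integration.integral_cong refl) (auto split: split_indicator)
    finally have "exp (phase k \<omega> \<theta> \<tau> p) * (near \<tau> + far \<tau>) = (LINT x|lebesgue_on D. exp (phase k \<omega> \<theta> \<tau> p) * (r x * ?e \<tau> x))"
      by (simp only: integral_mult_right_zero)
    also have "\<dots> = (LINT x|lebesgue_on D. r x * exp (phase k \<omega> \<theta> \<tau> x))"
      by (intro Bochner_Integration.integral_cong refl) (simp add: phase_diff exp_diff)
    finally show ?thesis ..
  qed
  have far: "((\<lambda>\<tau>. of_real (\<tau> ^ 3) * far \<tau>) \<longlongrightarrow> 0) at_top"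
  proof (rule Lim_null_comparison)
    define R where "R = (LINT x|lebesgue_on D. norm (r x))"
    show "((\<lambda>\<tau>. (\<tau> ^ 3 * exp (- (c * \<tau>))) * R) \<longlongrightarrow> 0) at_top"
      using tendsto_mult_left_zero[OF tendsto_power_exp_minus[OF c(1), of 3]] .
    show "\<forall>\<^sub>F \<tau> in at_top. norm (of_real (\<tau> ^ 3) * far \<tau>) \<le> (\<tau> ^ 3 * exp (- (c * \<tau>))) * R"
      using eventually_gt_at_top[of 0]
    proof eventually_elim
      fix \<tau> :: real assume \<tau>: "\<tau> > 0"
      have "norm (far \<tau>) \<le> (LINT x|lebesgue_on D. norm (indicator (- ball p \<delta>) x *\<^sub>R (r x * ?e \<tau> x)))"
        unfolding far_def by (rule integral_norm_bound)
      also have "\<dots> \<le> (LINT x|lebesgue_on D. exp (- (c * \<tau>)) * norm (r x))"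
      proof (rule integral_mono)
        show "integrable (lebesgue_on D) (\<lambda>x. norm (indicator (- ball p \<delta>) x *\<^sub>R (r x * ?e \<tau> x)))"
          by (intro integrable_norm integrable_mult_indicator_weak re_int ballm)
        show "integrable (lebesgue_on D) (\<lambda>x. exp (- (c * \<tau>)) * norm (r x))" using r by simp
        fix x assume "x \<in> space (lebesgue_on D)"
        then have x: "x \<in> D" by simp
        show "norm (indicator (- ball p \<delta>) x *\<^sub>R (r x * ?e \<tau> x)) \<le> exp (- (c * \<tau>)) * norm (r x)"
        proof (cases "x \<in> ball p \<delta>")
          case False
          have "\<tau> * ((x - p) \<bullet> \<omega>) \<le> \<tau> * (- c)" using c(2)[OF x False] \<tau> by (intro mult_left_mono) auto
          then have "norm (?e \<tau> x) \<le> exp (- (c * \<tau>))"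
            unfolding norm_exp_phase by (simp add: mult.commute)
          then have "norm (r x) * norm (?e \<tau> x) \<le> norm (r x) * exp (- (c * \<tau>))" by (intro mult_left_mono) auto
          then show ?thesis using False by (simp add: norm_mult mult.commute)
        qed simp
      qed
      also have "\<dots> = exp (- (c * \<tau>)) * R" by (simp add: R_def)
      finally have "\<tau> ^ 3 * norm (far \<tau>) \<le> \<tau> ^ 3 * (exp (- (c * \<tau>)) * R)"
        using \<tau> by (intro mult_left_mono) auto
      then show "norm (of_real (\<tau> ^ 3) * far \<tau>) \<le> (\<tau> ^ 3 * exp (- (c * \<tau>))) * R"
        using \<tau> by (simp add: norm_mult norm_power mult.assoc)
    qed
  qed
  define g where "g y = indicator (ball 0 \<delta>) y *\<^sub>R rt (p + frame_vec a b m y)" for y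
  have rtg: "indicator (ball p \<delta>) x *\<^sub>R rt x = indicator (ball p \<delta>) x *\<^sub>R (indicator (cball p \<eta>) x *\<^sub>R rt x)" for x
    using \<delta> by (auto split: split_indicator)
  have rtm: "(\<lambda>x. indicator (ball p \<delta>) x *\<^sub>R rt x) \<in> borel_measurable borel"
    unfolding rtg
    by (intro borel_measurable_scaleR borel_measurable_indicator borel_measurable_continuous_on_indicator rt) auto
  have ball_frame: "p + c *\<^sub>R frame_vec a b m y \<in> ball p \<delta> \<longleftrightarrow> c *\<^sub>R y \<in> ball 0 \<delta>" for c y
    by (simp add: dist_norm norm_frame_vec[OF fr])
  have frm: "(\<lambda>y. p + frame_vec a b m y) \<in> borel \<rightarrow>\<^sub>M borel"
    by (intro borel_measurable_continuous_onI continuous_intros)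
       (simp add: linear_continuous_on linear_linear linear_frame_vec)
  have g_eq: "g = (\<lambda>y. indicator (ball p \<delta>) (p + frame_vec a b m y) *\<^sub>R rt (p + frame_vec a b m y))"
    using ball_frame[of 1] by (auto simp: g_def fun_eq_iff split: split_indicator)
  have gm: "g \<in> borel_measurable borel"
    unfolding g_eq using measurable_compose[OF frm rtm] by simp
  obtain M where M: "\<And>x. x \<in> cball p \<eta> \<Longrightarrow> norm (rt x) \<le> M"
  proof -
    have "bounded (rt ` cball p \<eta>)" by (intro compact_imp_bounded compact_continuous_image rt) simp
    then obtain B where "\<forall>x\<in>cball p \<eta>. norm (rt x) \<le> B" by (auto simp: bounded_iff)
    then show ?thesis using that by blast
  qed
  have gM: "norm (g y) \<le> M" for y
  proof (cases "y \<in> ball 0 \<delta>")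
    case True
    then have "p + frame_vec a b m y \<in> cball p \<eta>" using \<delta> by (simp add: dist_norm norm_frame_vec[OF fr])
    moreover have "g y = rt (p + frame_vec a b m y)"
      unfolding g_def using True by (simp only: indicator_simps scaleR_one)
    ultimately show ?thesis using M by simp
  next
    case False
    then have "g y = 0" unfolding g_def by (simp only: indicator_simps scaleR_zero_left not_False_eq_True)
    moreover have "norm (rt p) \<le> M" using \<eta> by (intro M) simp
    then have "0 \<le> M" by (rule order_trans[OF norm_ge_zero])
    ultimately show ?thesis by simp
  qed
  have g0: "isCont g 0"
  proof -
    have "continuous_on (ball 0 \<delta>) (\<lambda>y. rt (p + frame_vec a b m y))"
      using \<delta> by (intro continuous_on_compose2[OF rt] continuous_intros)
        (auto simp: linear_continuous_on linear_linear linear_frame_vec dist_norm norm_frame_vec[OF fr])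
    then have "continuous_on (ball 0 \<delta>) g"
      by (rule continuous_on_eq) (simp add: g_def)
    then show ?thesis using \<delta> by (simp add: continuous_on_eq_continuous_at)
  qed
  have gp: "g 0 = rt p" using \<delta> by (simp add: g_def frame_vec_def)
  define \<beta> where "\<beta> \<tau> = sqrt (\<tau>\<^sup>2 + k\<^sup>2) / \<tau>" for \<tau>
  have near: "of_real (\<tau> ^ 3) * near \<tau> = cone_integral (tan \<phi>) (\<lambda>y. g ((1 / \<tau>) *\<^sub>R y) *
     exp (of_real (coords \<omega> \<bullet> y) + \<i> * of_real (\<beta> \<tau> * (coords \<theta> \<bullet> y))))"
    if \<tau>: "\<tau> > 0" for \<tau>
  proof -
    let ?C = "cone_at p m \<phi>"
    have Cm: "?C \<in> sets borel"
      unfolding cone_at_def by (intro borel_open open_Collect_less continuous_intros)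
    define F where "F x = indicator ?C x *\<^sub>R ((indicator (ball p \<delta>) x *\<^sub>R rt x) * ?e \<tau> x)" for x
    have Fm: "F \<in> borel_measurable borel"
      unfolding F_def
      by (intro borel_measurable_scaleR borel_measurable_indicator Cm borel_measurable_times rtm
          borel_measurable_continuous_onI ec)
    have "near \<tau> = (LINT x|lebesgue. indicator D x *\<^sub>R (indicator (ball p \<delta>) x *\<^sub>R (r x * ?e \<tau> x)))"
      unfolding near_def using Db by (intro integral_restrict_space) auto
    also have "\<dots> = (LINT x|lebesgue. F x)"
    proof (rule integral_cong_AE)
      show "AE x in lebesgue. indicator D x *\<^sub>R (indicator (ball p \<delta>) x *\<^sub>R (r x * ?e \<tau> x)) = F x"
        using ae
      proof eventually_elim
        fix x assume "x \<in> ball p \<eta> \<inter> D \<longrightarrow> r x = rt x"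
        then show "indicator D x *\<^sub>R (indicator (ball p \<delta>) x *\<^sub>R (r x * ?e \<tau> x)) = F x"
          using inD[of x] \<delta> by (auto simp: F_def split: split_indicator)
      qed
      show "F \<in> borel_measurable lebesgue" using Fm by (intro measurable_completion) simp
      have "integrable (lebesgue_on D) (\<lambda>x. indicator (ball p \<delta>) x *\<^sub>R (r x * ?e \<tau> x))"
        by (intro integrable_mult_indicator_weak re_int ballm)
      then show "(\<lambda>x. indicator D x *\<^sub>R (indicator (ball p \<delta>) x *\<^sub>R (r x * ?e \<tau> x))) \<in> borel_measurable lebesgue"
        using Db by (subst (asm) integrable_restrict_space) (auto dest: borel_measurable_integrable)
    qed
    also have "\<dots> = (LINT x|lborel. F x)" using Fm by (intro integral_completion) simp
    also have "\<dots> = of_real ((1 / \<tau>) ^ 3) * (LINT y|lborel. F (p + (1 / \<tau>) *\<^sub>R frame_vec a b m y))"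
      using \<tau> by (intro integral_change_frame[OF fr Fm]) simp
    finally have "of_real (\<tau> ^ 3) * near \<tau> = (LINT y|lborel. F (p + (1 / \<tau>) *\<^sub>R frame_vec a b m y))"
      using \<tau> by (simp add: power_divide)
    also have "\<dots> = cone_integral (tan \<phi>) (\<lambda>y. g ((1 / \<tau>) *\<^sub>R y) *
     exp (of_real (coords \<omega> \<bullet> y) + \<i> * of_real (\<beta> \<tau> * (coords \<theta> \<bullet> y))))"
      unfolding cone_integral_def
    proof (intro Bochner_Integration.integral_cong refl)
      fix y
      have t0: "1 / \<tau> > 0" using \<tau> by simp
      have i1: "p + (1 / \<tau>) *\<^sub>R frame_vec a b m y \<in> ?C \<longleftrightarrow> y \<in> std_cone (tan \<phi>)"
        unfolding cone_at_scale[OF t0] by (rule frame_vec_in_cone[OF fr cone(2,3)])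
      have i2: "indicator (ball p \<delta>) (p + (1 / \<tau>) *\<^sub>R frame_vec a b m y) *\<^sub>R rt (p + (1 / \<tau>) *\<^sub>R frame_vec a b m y) = g ((1 / \<tau>) *\<^sub>R y)"
        unfolding g_def using ball_frame[of "1 / \<tau>" y]
        by (auto simp: linear_scale[OF linear_frame_vec] split: split_indicator)
      have i3: "phase k \<omega> \<theta> \<tau> (p + (1 / \<tau>) *\<^sub>R frame_vec a b m y - p) =
         of_real (coords \<omega> \<bullet> y) + \<i> * of_real (\<beta> \<tau> * (coords \<theta> \<bullet> y))"
        using \<tau> by (simp add: phase_def \<beta>_def cone_frame_inner)
      show "F (p + (1 / \<tau>) *\<^sub>R frame_vec a b m y) = indicator (std_cone (tan \<phi>)) y *\<^sub>R (g ((1 / \<tau>) *\<^sub>R y) *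
         exp (of_real (coords \<omega> \<bullet> y) + \<i> * of_real (\<beta> \<tau> * (coords \<theta> \<bullet> y))))"
        unfolding F_def i2 i3 using i1 by (simp add: indicator_def)
    qed
    finally show ?thesis .
  qed
  have "((\<lambda>\<tau>. cone_integral (tan \<phi>) (\<lambda>y. g ((1 / \<tau>) *\<^sub>R y) *
     exp (of_real (coords \<omega> \<bullet> y) + \<i> * of_real (\<beta> \<tau> * (coords \<theta> \<bullet> y))))) \<longlongrightarrow> g 0 * cone_const \<theta>) at_top"
    unfolding cone_const_def
    by (rule cone_integral_blow_up[OF \<kappa> \<mu>(1) gm gM g0 cone_frame_decay])
       (auto simp: \<beta>_def[abs_def] tendsto_sqrt_ratio)
  then have "((\<lambda>\<tau>. of_real (\<tau> ^ 3) * near \<tau>) \<longlongrightarrow> rt p * cone_const \<theta>) at_top"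
    unfolding gp
    by (rule Lim_transform_eventually) (use eventually_gt_at_top[of 0] in eventually_elim, simp only: near)
  from tendsto_add[OF this far]
  have "((\<lambda>\<tau>. of_real (\<tau> ^ 3) * near \<tau> + of_real (\<tau> ^ 3) * far \<tau>) \<longlongrightarrow> rt p * cone_const \<theta>) at_top" by simp
  moreover have "of_real (\<tau> ^ 3) * exp (- phase k \<omega> \<theta> \<tau> p) * (LINT x|lebesgue_on D. r x * exp (phase k \<omega> \<theta> \<tau> x)) =
     of_real (\<tau> ^ 3) * near \<tau> + of_real (\<tau> ^ 3) * far \<tau>" for \<tau>
    unfolding split by (simp add: exp_minus field_simps)
  ultimately show ?thesis by (simp only:)
qed

end

section \<open>Extraction of the vertex\<close>

lemma hoelder_imp_continuous_on:
  assumes "hoelder_on \<alpha> S f" "\<alpha> > 0"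
  shows "continuous_on S f"
proof -
  obtain C where C: "\<And>x y. x \<in> S \<Longrightarrow> y \<in> S \<Longrightarrow> norm (f x - f y) \<le> C * norm (x - y) powr \<alpha>"
    using assms by (auto simp: hoelder_on_def)
  show ?thesis
    unfolding continuous_on_def
  proof
    fix x assume x: "x \<in> S"
    have "((\<lambda>y. norm (y - x)) \<longlongrightarrow> norm (x - x)) (at x within S)" by (intro tendsto_intros)
    then have "((\<lambda>y. norm (y - x) powr \<alpha>) \<longlongrightarrow> norm (x - x) powr \<alpha>) (at x within S)"
      by (rule tendsto_powr2[OF _ tendsto_const]) (use assms(2) in auto)
    then have "((\<lambda>y. C * norm (y - x) powr \<alpha>) \<longlongrightarrow> C * norm (x - x) powr \<alpha>) (at x within S)"
      by (rule tendsto_mult_left)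
    then have lim: "((\<lambda>y. C * norm (y - x) powr \<alpha>) \<longlongrightarrow> 0) (at x within S)" by simp
    have "((\<lambda>y. f y - f x) \<longlongrightarrow> 0) (at x within S)"
    proof (rule Lim_null_comparison[OF _ lim])
      show "\<forall>\<^sub>F y in at x within S. norm (f y - f x) \<le> C * norm (y - x) powr \<alpha>"
        using C x by (auto simp: eventually_at_filter)
    qed
    then show "(f \<longlongrightarrow> f x) (at x within S)" by (rule LIM_zero_cancel)
  qed
qed

lemma support_point_eq:
  assumes "regular_direction D \<omega>"
  shows "{x \<in> closure D. x \<bullet> \<omega> = support_fun D \<omega>} = {support_point D \<omega>}"
proof -
  have "\<exists>!p. {x \<in> closure D. x \<bullet> \<omega> = support_fun D \<omega>} = {p}"
    using assms unfolding regular_direction_def by (metis singleton_inject)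
  then show ?thesis unfolding support_point_def by (rule theI')
qed

lemma cdot_complex_directions:
  assumes "norm \<omega> = 1" "norm \<theta> = 1" "\<omega> \<bullet> \<theta> = 0"
  shows "cdot (complex_direction s t \<omega> \<theta>) (complex_direction s' t' \<omega> \<theta>) = of_real (s * s' - t * t')"
proof -
  have o: "\<omega>$1 * \<omega>$1 + \<omega>$2 * \<omega>$2 + \<omega>$3 * \<omega>$3 = 1" "\<theta>$1 * \<theta>$1 + \<theta>$2 * \<theta>$2 + \<theta>$3 * \<theta>$3 = 1"
    "\<omega>$1 * \<theta>$1 + \<omega>$2 * \<theta>$2 + \<omega>$3 * \<theta>$3 = 0"
    using assms by (simp_all add: norm_eq_1 inner_vec_def sum_3)
  show ?thesis
  proof (rule complex_eqI)
    have "Re (cdot (complex_direction s t \<omega> \<theta>) (complex_direction s' t' \<omega> \<theta>)) =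
       s * s' * (\<omega>$1 * \<omega>$1 + \<omega>$2 * \<omega>$2 + \<omega>$3 * \<omega>$3) - t * t' * (\<theta>$1 * \<theta>$1 + \<theta>$2 * \<theta>$2 + \<theta>$3 * \<theta>$3)"
      by (simp add: cdot_def complex_direction_def sum_3 algebra_simps)
    then show "Re (cdot (complex_direction s t \<omega> \<theta>) (complex_direction s' t' \<omega> \<theta>)) = Re (of_real (s * s' - t * t'))"
      by (simp add: o)
    have "Im (cdot (complex_direction s t \<omega> \<theta>) (complex_direction s' t' \<omega> \<theta>)) =
       (s * t' + t * s') * (\<omega>$1 * \<theta>$1 + \<omega>$2 * \<theta>$2 + \<omega>$3 * \<theta>$3)"
      by (simp add: cdot_def complex_direction_def sum_3 algebra_simps)
    then show "Im (cdot (complex_direction s t \<omega> \<theta>) (complex_direction s' t' \<omega> \<theta>)) = Im (of_real (s * s' - t * t'))"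
      by (simp add: o)
  qed
qed

lemma cdot_commute: "cdot a b = cdot b a"
  by (simp add: cdot_def mult.commute)

lemma v_sol_affine_exp:
  "v_sol k \<omega> \<theta> \<tau> = affine_exp 1 0 (complex_direction \<tau> (sqrt (\<tau>\<^sup>2 + k\<^sup>2)) \<omega> \<theta>)"
proof -
  have "cdot 0 y = 0" for y by (simp add: cdot_def)
  then show ?thesis by (simp add: fun_eq_iff v_sol_def affine_exp_def cdot_commute[of _ "complex_direction _ _ _ _"])
qed

lemma v_sol_tau_affine_exp:
  "v_sol_tau k \<omega> \<theta> \<tau> = affine_exp 0 (complex_direction 1 (\<tau> / sqrt (\<tau>\<^sup>2 + k\<^sup>2)) \<omega> \<theta>) (complex_direction \<tau> (sqrt (\<tau>\<^sup>2 + k\<^sup>2)) \<omega> \<theta>)"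
  by (simp add: fun_eq_iff v_sol_tau_def v_sol_def affine_exp_def cdot_commute[of _ "complex_direction _ _ _ _"])

lemma integral_source:
  fixes V :: "real^3 \<Rightarrow> complex"
  assumes \<Omega>: "open \<Omega>" and D: "open D" "bounded D" "D \<subseteq> \<Omega>" and \<rho>: "L2 (lebesgue_on D) \<rho>"
    and V: "continuous_on UNIV V"
  shows "integrable (lebesgue_on \<Omega>) (\<lambda>x. source \<rho> D x * V x)"
    and "(LINT x|lebesgue_on \<Omega>. source \<rho> D x * V x) = (LINT x|lebesgue_on D. \<rho> x * V x)"
proof -
  have sets: "\<Omega> \<inter> space lebesgue \<in> sets lebesgue" "D \<inter> space lebesgue \<in> sets lebesgue"
    using \<Omega> D by auto
  have eq: "(\<lambda>x. indicator \<Omega> x *\<^sub>R (source \<rho> D x * V x)) = (\<lambda>x. indicator D x *\<^sub>R (\<rho> x * V x))"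
    using D(3) by (auto simp: source_def fun_eq_iff split: split_indicator)
  have "integrable (lebesgue_on D) (\<lambda>x. \<rho> x * V x)"
    using D by (intro L2_mult_integrable[OF \<rho>] L2_lebesgue_on_continuous V) auto
  then show "integrable (lebesgue_on \<Omega>) (\<lambda>x. source \<rho> D x * V x)"
    unfolding integrable_restrict_space[OF sets(1)] integrable_restrict_space[OF sets(2)] eq .
  show "(LINT x|lebesgue_on \<Omega>. source \<rho> D x * V x) = (LINT x|lebesgue_on D. \<rho> x * V x)"
    unfolding integral_restrict_space[OF sets(1)] integral_restrict_space[OF sets(2)] eq ..
qed

context conical_vertex
begin

text \<open>The affine factor of \<open>v\<^sub>\<tau>\<close> is its value at \<open>p\<close> plus a function that vanishes at \<open>p\<close>. The second part
contributes terms to which \<open>source_asymptotics\<close> assigns the limit zero.\<close>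
lemma source_ratio_limit:
  fixes r rt :: "real^3 \<Rightarrow> complex"
  assumes unit: "norm \<omega> = 1" "norm \<theta> = 1" "\<omega> \<bullet> \<theta> = 0"
    and r: "L2 (lebesgue_on D) r" and \<eta>: "\<eta> > 0"
    and rt: "continuous_on (cball p \<eta>) rt" "rt p \<noteq> 0"
    and ae: "AE x in lebesgue. x \<in> ball p \<eta> \<inter> D \<longrightarrow> r x = rt x"
  shows "\<forall>\<^sub>F \<tau> in at_top. (LINT x|lebesgue_on D. r x * v_sol k \<omega> \<theta> \<tau> x) \<noteq> 0" (is ?nz)
    and "((\<lambda>\<tau>. (LINT x|lebesgue_on D. r x * v_sol_tau k \<omega> \<theta> \<tau> x) / (LINT x|lebesgue_on D. r x * v_sol k \<omega> \<theta> \<tau> x))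
      \<longlongrightarrow> of_real (p \<bullet> \<omega>) + \<i> * of_real (p \<bullet> \<theta>)) at_top" (is ?lim)
proof -
  define N where "N \<tau> = of_real (\<tau> ^ 3) * exp (- phase k \<omega> \<theta> \<tau> p)" for \<tau>
  define J where "J h \<tau> = (LINT x|lebesgue_on D. (r x * h x) * exp (phase k \<omega> \<theta> \<tau> x))" for h \<tau>
  define \<beta> where "\<beta> \<tau> = \<tau> / sqrt (\<tau>\<^sup>2 + k\<^sup>2)" for \<tau> :: real
  have Db: "D \<in> sets borel" using D by simp
  have asym: "((\<lambda>\<tau>. N \<tau> * J h \<tau>) \<longlongrightarrow> (rt p * h p) * cone_const \<theta>) at_top"
    if h: "continuous_on UNIV h" for h
    unfolding N_def J_def
  proof (rule source_asymptotics[OF _ \<eta>])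
    show "integrable (lebesgue_on D) (\<lambda>x. r x * h x)"
      by (intro L2_mult_integrable[OF r] L2_lebesgue_on_continuous Db D h)
    show "continuous_on (cball p \<eta>) (\<lambda>x. rt x * h x)"
      by (intro continuous_intros rt continuous_on_subset[OF h]) simp
    show "AE x in lebesgue. x \<in> ball p \<eta> \<inter> D \<longrightarrow> r x * h x = rt x * h x"
      using ae by eventually_elim simp
  qed
  define h\<omega> h\<theta> :: "real^3 \<Rightarrow> complex" where "h\<omega> x = of_real ((x - p) \<bullet> \<omega>)" and "h\<theta> x = of_real ((x - p) \<bullet> \<theta>)" for x
  have hc: "continuous_on UNIV h\<omega>" "continuous_on UNIV h\<theta>"
    unfolding h\<omega>_def h\<theta>_def by (intro continuous_intros)+
  have J0: "J (\<lambda>_. 1) \<tau> = (LINT x|lebesgue_on D. r x * v_sol k \<omega> \<theta> \<tau> x)" for \<tau>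
    by (simp add: J_def v_sol_phase)
  have l0: "((\<lambda>\<tau>. N \<tau> * J (\<lambda>_. 1) \<tau>) \<longlongrightarrow> rt p * cone_const \<theta>) at_top"
    using asym[of "\<lambda>_. 1"] by simp
  have l1: "((\<lambda>\<tau>. N \<tau> * J h\<omega> \<tau>) \<longlongrightarrow> 0) at_top" and l2: "((\<lambda>\<tau>. N \<tau> * J h\<theta> \<tau>) \<longlongrightarrow> 0) at_top"
    using asym[OF hc(1)] asym[OF hc(2)] by (simp_all add: h\<omega>_def h\<theta>_def)
  have K: "rt p * cone_const \<theta> \<noteq> 0" using rt(2) cone_const_nonzero[OF unit] by simp
  have nz: "\<forall>\<^sub>F \<tau> in at_top. N \<tau> * J (\<lambda>_. 1) \<tau> \<noteq> 0" by (rule tendsto_imp_eventually_ne[OF l0 K])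
  then show ?nz unfolding J0[symmetric] by eventually_elim simp
  have int: "integrable (lebesgue_on D) (\<lambda>x. (r x * h x) * exp (phase k \<omega> \<theta> \<tau> x))"
    if "continuous_on UNIV h" for h \<tau>
    unfolding mult.assoc phase_def using that
    by (intro L2_mult_integrable[OF r] L2_lebesgue_on_continuous Db D continuous_intros)
  have J': "(LINT x|lebesgue_on D. r x * v_sol_tau k \<omega> \<theta> \<tau> x) =
     (of_real (p \<bullet> \<omega>) + \<i> * of_real (\<beta> \<tau> * (p \<bullet> \<theta>))) * J (\<lambda>_. 1) \<tau> + (J h\<omega> \<tau> + (\<i> * of_real (\<beta> \<tau>)) * J h\<theta> \<tau>)" for \<tau>
  proof -
    let ?E = "\<lambda>x. exp (phase k \<omega> \<theta> \<tau> x)" and ?c = "of_real (p \<bullet> \<omega>) + \<i> * of_real (\<beta> \<tau> * (p \<bullet> \<theta>))"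
    have "(LINT x|lebesgue_on D. r x * v_sol_tau k \<omega> \<theta> \<tau> x) =
      (LINT x|lebesgue_on D. ?c * ((r x * 1) * ?E x) + ((r x * h\<omega> x) * ?E x + (\<i> * of_real (\<beta> \<tau>)) * ((r x * h\<theta> x) * ?E x)))"
      by (intro Bochner_Integration.integral_cong refl)
        (simp add: v_sol_tau_def cdot_complex_direction v_sol_phase \<beta>_def[symmetric] h\<omega>_def h\<theta>_def inner_diff_left algebra_simps)
    also have "\<dots> = (LINT x|lebesgue_on D. ?c * ((r x * 1) * ?E x)) + ((LINT x|lebesgue_on D. (r x * h\<omega> x) * ?E x) +
        (LINT x|lebesgue_on D. (\<i> * of_real (\<beta> \<tau>)) * ((r x * h\<theta> x) * ?E x)))"
    proof -
      have i0: "integrable (lebesgue_on D) (\<lambda>x. ?c * ((r x * 1) * ?E x))"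
        by (intro integrable_mult_right int[of "\<lambda>_. 1"] continuous_intros)
      have i2: "integrable (lebesgue_on D) (\<lambda>x. (\<i> * of_real (\<beta> \<tau>)) * ((r x * h\<theta> x) * ?E x))"
        by (intro integrable_mult_right int hc)
      show ?thesis
        unfolding Bochner_Integration.integral_add[OF i0 Bochner_Integration.integrable_add[OF int[OF hc(1)] i2]]
          Bochner_Integration.integral_add[OF int[OF hc(1)] i2] ..
    qed
    also have "\<dots> = ?c * J (\<lambda>_. 1) \<tau> + (J h\<omega> \<tau> + (\<i> * of_real (\<beta> \<tau>)) * J h\<theta> \<tau>)"
      unfolding integral_mult_right_zero J_def ..
    finally show ?thesis .
  qed
  have \<beta>: "(\<beta> \<longlongrightarrow> 1) at_top"
  proof -
    have "((\<lambda>\<tau>. inverse (sqrt (\<tau>\<^sup>2 + k\<^sup>2) / \<tau>)) \<longlongrightarrow> inverse 1) at_top"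
      by (intro tendsto_inverse tendsto_sqrt_ratio) simp
    then show ?thesis by (simp add: \<beta>_def[abs_def])
  qed
  have "((\<lambda>\<tau>. (of_real (p \<bullet> \<omega>) + \<i> * of_real (\<beta> \<tau> * (p \<bullet> \<theta>))) +
      (N \<tau> * J h\<omega> \<tau> + (\<i> * of_real (\<beta> \<tau>)) * (N \<tau> * J h\<theta> \<tau>)) / (N \<tau> * J (\<lambda>_. 1) \<tau>)) \<longlongrightarrow>
      (of_real (p \<bullet> \<omega>) + \<i> * of_real (1 * (p \<bullet> \<theta>))) +
      (0 + (\<i> * of_real 1) * 0) / (rt p * cone_const \<theta>)) at_top"
    by (intro tendsto_intros \<beta> l0 l1 l2 K)
  then have lim: "((\<lambda>\<tau>. (of_real (p \<bullet> \<omega>) + \<i> * of_real (\<beta> \<tau> * (p \<bullet> \<theta>))) +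
      (N \<tau> * J h\<omega> \<tau> + (\<i> * of_real (\<beta> \<tau>)) * (N \<tau> * J h\<theta> \<tau>)) / (N \<tau> * J (\<lambda>_. 1) \<tau>)) \<longlongrightarrow>
      of_real (p \<bullet> \<omega>) + \<i> * of_real (p \<bullet> \<theta>)) at_top" by simp
  show ?lim
  proof (rule Lim_transform_eventually[OF lim])
    show "\<forall>\<^sub>F \<tau> in at_top. (of_real (p \<bullet> \<omega>) + \<i> * of_real (\<beta> \<tau> * (p \<bullet> \<theta>))) +
      (N \<tau> * J h\<omega> \<tau> + (\<i> * of_real (\<beta> \<tau>)) * (N \<tau> * J h\<theta> \<tau>)) / (N \<tau> * J (\<lambda>_. 1) \<tau>) =
      (LINT x|lebesgue_on D. r x * v_sol_tau k \<omega> \<theta> \<tau> x) / (LINT x|lebesgue_on D. r x * v_sol k \<omega> \<theta> \<tau> x)"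
      using nz
    proof eventually_elim
      fix \<tau> assume "N \<tau> * J (\<lambda>_. 1) \<tau> \<noteq> 0"
      then have n: "N \<tau> \<noteq> 0" "J (\<lambda>_. 1) \<tau> \<noteq> 0" by auto
      have "N \<tau> * J h\<omega> \<tau> + (\<i> * of_real (\<beta> \<tau>)) * (N \<tau> * J h\<theta> \<tau>) = N \<tau> * (J h\<omega> \<tau> + (\<i> * of_real (\<beta> \<tau>)) * J h\<theta> \<tau>)"
        by (simp add: algebra_simps)
      then have "(N \<tau> * J h\<omega> \<tau> + (\<i> * of_real (\<beta> \<tau>)) * (N \<tau> * J h\<theta> \<tau>)) / (N \<tau> * J (\<lambda>_. 1) \<tau>) =
         (J h\<omega> \<tau> + (\<i> * of_real (\<beta> \<tau>)) * J h\<theta> \<tau>) / J (\<lambda>_. 1) \<tau>"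
        using n(1) by simp
      then show "(of_real (p \<bullet> \<omega>) + \<i> * of_real (\<beta> \<tau> * (p \<bullet> \<theta>))) +
      (N \<tau> * J h\<omega> \<tau> + (\<i> * of_real (\<beta> \<tau>)) * (N \<tau> * J h\<theta> \<tau>)) / (N \<tau> * J (\<lambda>_. 1) \<tau>) =
      (LINT x|lebesgue_on D. r x * v_sol_tau k \<omega> \<theta> \<tau> x) / (LINT x|lebesgue_on D. r x * v_sol k \<omega> \<theta> \<tau> x)"
        unfolding J' J0[symmetric] add_divide_distrib[of "_ * J (\<lambda>_. 1) \<tau>"] using n(2) by simp
    qed
  qed
qed

end

lemma orthogonal_to_three_eq_0:
  fixes \<omega> \<theta>1 \<theta>2 x :: "real^3"
  assumes "norm \<omega> = 1" "\<theta>1 \<in> S_perp \<omega>" "\<theta>2 \<in> S_perp \<omega>" "\<theta>1 \<noteq> \<theta>2" "independent {\<theta>1, \<theta>2}"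
    and x: "x \<bullet> \<omega> = 0" "x \<bullet> \<theta>1 = 0" "x \<bullet> \<theta>2 = 0"
  shows "x = 0"
proof -
  have o: "\<omega> \<bullet> \<theta>1 = 0" "\<omega> \<bullet> \<theta>2 = 0" using assms by (auto simp: S_perp_def)
  have "\<omega> \<notin> span {\<theta>1, \<theta>2}"
  proof
    assume "\<omega> \<in> span {\<theta>1, \<theta>2}"
    then have "orthogonal \<omega> \<omega>"
      by (rule orthogonal_to_span) (use o in \<open>auto simp: orthogonal_def\<close>)
    then have "\<omega> = 0" by (simp add: orthogonal_def)
    then show False using assms(1) by simp
  qed
  then have ind: "independent {\<omega>, \<theta>1, \<theta>2}"
    using assms(5) by (rule independent_insertI)
  have "card {\<omega>, \<theta>1, \<theta>2} = 3"
  proof -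
    have "\<omega> \<noteq> \<theta>1" "\<omega> \<noteq> \<theta>2" using o assms(1) by (auto simp: norm_eq_1)
    then show ?thesis using assms(4) by simp
  qed
  then have "UNIV \<subseteq> span {\<omega>, \<theta>1, \<theta>2}"
    using ind by (intro card_ge_dim_independent) auto
  then have "orthogonal x x"
    using x by (intro orthogonal_to_span[of x "{\<omega>, \<theta>1, \<theta>2}"]) (auto simp: orthogonal_def)
  then show ?thesis by (simp add: orthogonal_def)
qed

theorem corollary1p3:
  fixes \<Omega> D :: "(real^3) set" and \<rho> u f :: "real^3 \<Rightarrow> complex" and Du :: "real^3 \<Rightarrow> complex^3"
    and \<nu> :: "real^3 \<Rightarrow> real^3" and \<sigma> :: "(real^3) measure"
    and \<Lambda> :: "(real^3 \<Rightarrow> complex) \<Rightarrow> complex"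
    and k :: real and \<omega> \<theta>1 \<theta>2 :: "real^3"
  assumes "open \<Omega>" "connected \<Omega>" "bounded \<Omega>" "C2_boundary \<Omega>"
    and "surface_measure \<Omega> \<sigma>" "outward_unit_normal \<Omega> \<nu>"
    and "k \<ge> 0"
    and "open D" "D \<noteq> {}" "closure D \<subseteq> \<Omega>"
    and "L2 (lebesgue_on D) \<rho>"
    and "weak_solution \<Omega> k (source \<rho> D) u Du"
    and "cauchy_data \<Omega> \<sigma> k (source \<rho> D) u Du f \<Lambda>"
    and "\<omega> \<in> sphere 0 1" "regular_direction D \<omega>"
    and "circular_cone_singularity D (support_point D \<omega>)"
    and "active_at \<rho> D (support_point D \<omega>)"
    and "\<theta>1 \<in> S_perp \<omega>" "\<theta>2 \<in> S_perp \<omega>" "\<theta>1 \<noteq> \<theta>2" "independent {\<theta>1, \<theta>2}"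
  shows "(\<forall>\<theta>\<in>{\<theta>1, \<theta>2}.
            (\<forall>\<^sub>F \<tau> in at_top. I_fun \<sigma> \<nu> f \<Lambda> k \<omega> \<theta> \<tau> \<noteq> 0) \<and>
            ((\<lambda>\<tau>. I_fun' \<sigma> \<nu> f \<Lambda> k \<omega> \<theta> \<tau> / I_fun \<sigma> \<nu> f \<Lambda> k \<omega> \<theta> \<tau>) \<longlongrightarrow>
               of_real (support_point D \<omega> \<bullet> \<omega>) + \<i> * of_real (support_point D \<omega> \<bullet> \<theta>)) at_top) \<and>
         (\<forall>q. (\<forall>\<theta>\<in>{\<theta>1, \<theta>2}.
                 ((\<lambda>\<tau>. I_fun' \<sigma> \<nu> f \<Lambda> k \<omega> \<theta> \<tau> / I_fun \<sigma> \<nu> f \<Lambda> k \<omega> \<theta> \<tau>) \<longlongrightarrow>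
                    of_real (q \<bullet> \<omega>) + \<i> * of_real (q \<bullet> \<theta>)) at_top) \<longrightarrow>
              q = support_point D \<omega>) \<and>
         support_fun D \<omega> = support_point D \<omega> \<bullet> \<omega>"
proof -
  let ?p = "support_point D \<omega>"
  note op = assms(1) and bd = assms(3) and C2 = assms(4) and sm = assms(5) and nu = assms(6)
  note opD = assms(8) and rho = assms(11) and cd = assms(13)
  have DO: "D \<subseteq> \<Omega>" using assms(10) closure_subset by blast
  have bdD: "bounded D" using bd DO by (rule bounded_subset)
  have un: "norm \<omega> = 1" using assms(14) by simp
  note pset = support_point_eq[OF assms(15)]
  have "?p \<in> {x \<in> closure D. x \<bullet> \<omega> = support_fun D \<omega>}" unfolding pset by simp
  then have hp: "support_fun D \<omega> = ?p \<bullet> \<omega>" by simp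
  obtain \<epsilon> n \<phi> where c: "\<epsilon> > 0" "n \<in> sphere 0 1" "\<phi> \<in> {0<..<pi/2}"
    "D \<inter> ball ?p \<epsilon> = cone_at ?p (- n) \<phi> \<inter> ball ?p \<epsilon>"
    using assms(16) unfolding circular_cone_singularity_def by blast
  have cone: "\<epsilon> > 0" "norm (- n) = 1" "0 < \<phi>" "\<phi> < pi / 2" "D \<inter> ball ?p \<epsilon> = cone_at ?p (- n) \<phi> \<inter> ball ?p \<epsilon>"
    using c by auto
  obtain \<mu> where \<mu>: "\<mu> > 0" "\<And>y. y \<in> cone_at 0 (- n) \<phi> \<Longrightarrow> y \<bullet> \<omega> \<le> - \<mu> * norm y"
    using cone_decay_geometry[OF pset bdD cone] by blast
  obtain a b where fr: "orthonormal_frame a b (- n)"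
    using orthonormal_frame_exists[OF cone(2)] by blast
  obtain \<eta> \<alpha> \<rho>t where act: "\<eta> > 0" "0 < \<alpha>" "hoelder_on \<alpha> (cball ?p \<eta>) \<rho>t"
      "AE x in lebesgue. x \<in> ball ?p \<eta> \<inter> D \<longrightarrow> \<rho> x = \<rho>t x" "\<rho>t ?p \<noteq> 0"
    using assms(17) unfolding active_at_def by blast
  interpret conical_vertex D \<omega> ?p "- n" a b \<epsilon> \<phi> \<mu>
    by unfold_locales (fact opD bdD pset cone fr \<mu>)+
  have H1: "H1 \<Omega> u Du" using assms(12) by (simp add: weak_solution_def)
  have bracket: "boundary_bracket \<sigma> \<nu> f \<Lambda> (affine_exp A B z) = (LINT x|lebesgue_on D. \<rho> x * affine_exp A B z x)"
    if "cdot z z = - of_real (k\<^sup>2)" "cdot B z = 0" for A B z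
  proof -
    have cont: "continuous_on UNIV (affine_exp A B z)"
      by (intro C1_continuous smooth_imp_C1 smooth_affine_exp)
    note S = integral_source[OF op opD bdD DO rho cont]
    show ?thesis
      using boundary_bracket_affine_exp[OF op sm bd C2 nu H1 cd S(1) that] S(2) by simp
  qed
  have main: "(\<forall>\<^sub>F \<tau> in at_top. I_fun \<sigma> \<nu> f \<Lambda> k \<omega> \<theta> \<tau> \<noteq> 0) \<and>
            ((\<lambda>\<tau>. I_fun' \<sigma> \<nu> f \<Lambda> k \<omega> \<theta> \<tau> / I_fun \<sigma> \<nu> f \<Lambda> k \<omega> \<theta> \<tau>) \<longlongrightarrow>
               of_real (?p \<bullet> \<omega>) + \<i> * of_real (?p \<bullet> \<theta>)) at_top"
    if "\<theta> \<in> S_perp \<omega>" for \<theta>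
  proof -
    have unit: "norm \<omega> = 1" "norm \<theta> = 1" "\<omega> \<bullet> \<theta> = 0" using that un by (auto simp: S_perp_def)
    have zz: "cdot (complex_direction \<tau> (sqrt (\<tau>\<^sup>2 + k\<^sup>2)) \<omega> \<theta>) (complex_direction \<tau> (sqrt (\<tau>\<^sup>2 + k\<^sup>2)) \<omega> \<theta>) = - of_real (k\<^sup>2)" for \<tau>
      unfolding cdot_complex_directions[OF unit] by (simp add: power2_eq_square[symmetric])
    have Bz: "cdot (complex_direction 1 (\<tau> / sqrt (\<tau>\<^sup>2 + k\<^sup>2)) \<omega> \<theta>) (complex_direction \<tau> (sqrt (\<tau>\<^sup>2 + k\<^sup>2)) \<omega> \<theta>) = 0"
      if "\<tau> > 0" for \<tau>
    proof -
      have "\<tau>\<^sup>2 + k\<^sup>2 > 0" using that by (simp add: add_pos_nonneg)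
      then have "\<tau> / sqrt (\<tau>\<^sup>2 + k\<^sup>2) * sqrt (\<tau>\<^sup>2 + k\<^sup>2) = \<tau>" by simp
      then show ?thesis unfolding cdot_complex_directions[OF unit] by simp
    qed
    have "cdot 0 z = 0" for z by (simp add: cdot_def)
    from bracket[OF zz this, of 1]
    have I: "I_fun \<sigma> \<nu> f \<Lambda> k \<omega> \<theta> \<tau> = (LINT x|lebesgue_on D. \<rho> x * v_sol k \<omega> \<theta> \<tau> x)" for \<tau>
      unfolding I_fun_def v_sol_affine_exp .
    have I': "I_fun' \<sigma> \<nu> f \<Lambda> k \<omega> \<theta> \<tau> = (LINT x|lebesgue_on D. \<rho> x * v_sol_tau k \<omega> \<theta> \<tau> x)" if "\<tau> > 0" for \<tau>
      unfolding I_fun'_def v_sol_tau_affine_exp by (rule bracket[OF zz Bz[OF that]])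
    note lim = source_ratio_limit[OF unit rho act(1) hoelder_imp_continuous_on[OF act(3,2)] act(5,4), of k]
    show ?thesis
    proof
      show "\<forall>\<^sub>F \<tau> in at_top. I_fun \<sigma> \<nu> f \<Lambda> k \<omega> \<theta> \<tau> \<noteq> 0" unfolding I by (rule lim(1))
      show "((\<lambda>\<tau>. I_fun' \<sigma> \<nu> f \<Lambda> k \<omega> \<theta> \<tau> / I_fun \<sigma> \<nu> f \<Lambda> k \<omega> \<theta> \<tau>) \<longlongrightarrow>
               of_real (?p \<bullet> \<omega>) + \<i> * of_real (?p \<bullet> \<theta>)) at_top"
        by (rule Lim_transform_eventually[OF lim(2)])
           (use eventually_gt_at_top[of 0] in eventually_elim, simp only: I I')
    qed
  qed
  have uniq: "q = ?p" if q: "\<forall>\<theta>\<in>{\<theta>1, \<theta>2}.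
                 ((\<lambda>\<tau>. I_fun' \<sigma> \<nu> f \<Lambda> k \<omega> \<theta> \<tau> / I_fun \<sigma> \<nu> f \<Lambda> k \<omega> \<theta> \<tau>) \<longlongrightarrow>
                    of_real (q \<bullet> \<omega>) + \<i> * of_real (q \<bullet> \<theta>)) at_top" for q
  proof -
    have "complex_of_real (q \<bullet> \<omega>) + \<i> * of_real (q \<bullet> \<theta>) = of_real (?p \<bullet> \<omega>) + \<i> * of_real (?p \<bullet> \<theta>)"
      if "\<theta> \<in> {\<theta>1, \<theta>2}" for \<theta>
    proof (rule tendsto_unique[OF trivial_limit_at_top_linorder])
      show "((\<lambda>\<tau>. I_fun' \<sigma> \<nu> f \<Lambda> k \<omega> \<theta> \<tau> / I_fun \<sigma> \<nu> f \<Lambda> k \<omega> \<theta> \<tau>) \<longlongrightarrow>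
           of_real (q \<bullet> \<omega>) + \<i> * of_real (q \<bullet> \<theta>)) at_top" using q that by blast
      show "((\<lambda>\<tau>. I_fun' \<sigma> \<nu> f \<Lambda> k \<omega> \<theta> \<tau> / I_fun \<sigma> \<nu> f \<Lambda> k \<omega> \<theta> \<tau>) \<longlongrightarrow>
           of_real (?p \<bullet> \<omega>) + \<i> * of_real (?p \<bullet> \<theta>)) at_top" using main that assms(18,19) by blast
    qed
    then have "q \<bullet> \<omega> = ?p \<bullet> \<omega>" "q \<bullet> \<theta>1 = ?p \<bullet> \<theta>1" "q \<bullet> \<theta>2 = ?p \<bullet> \<theta>2"
      by (auto simp: complex_eq_iff)
    then have "q - ?p = 0"
      by (intro orthogonal_to_three_eq_0[OF un assms(18-21)]) (simp_all add: inner_diff_left)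
    then show ?thesis by simp
  qed
  show ?thesis using main assms(18,19) uniq hp by blast
qed

end
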